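(* Let $\alpha,\beta$ be constants with $0<\beta<\alpha<1$, and consider integers $n\to\infty$ with $k=\beta n$ and $m=\alpha n$ integers. Let $A$ be an $m\times n$ matrix with i.i.d. standard normal entries, let $\mathbf{x}\in\mathbb{R}^n$ be $k$-sparse and nonnegative (a priori known to be so) with the location of its nonzero elements arbitrarily chosen but fixed, let $\mathbf{y}=A\mathbf{x}$, and let $P^+_{err}$ be the probability that the solution of $\min\|\mathbf{z}\|_1$ subject to $A\mathbf{z}=\mathbf{y}$, $\mathbf{z}\ge0$ is not $\mathbf{x}$. Let $\alpha>\alpha_w$, where $\alpha_w\in(\beta,\frac{1+\beta}{2})$ is such that $\xi^+_{\alpha_w}(\beta)=1$. Let $\beta_w\in(\max(2\alpha-1,0),\alpha)$ satisfy $$\xi^+_\alpha(\beta_w)=(1-\beta_w)\frac{\sqrt{\frac1{2\pi}}\,e^{-\left(\mathrm{erfinv}\left(2\frac{1-\alpha}{1-\beta_w}-1\right)\right)^2}}{\alpha\sqrt2\,\mathrm{erfinv}\left(2\frac{1-\alpha}{1-\beta_w}-1\right)}=1,$$ and let $\beta_0\in(2\alpha-1,\alpha)$ satisfy $$\frac{\alpha-\beta}{\alpha-\beta_0}\,\xi^+_\alpha(\beta_0)=\frac{\alpha-\beta}{\alpha-\beta_0}(1-\beta_0)\frac{\sqrt{\frac1{2\pi}}\,e^{-\left(\mathrm{erfinv}\left(2\frac{1-\alpha}{1-\beta_0}-1\right)\right)^2}}{\alpha\sqrt2\,\mathrm{erfinv}\left(2\frac{1-\alpha}{1-\beta_0}-1\right)}=1.$$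 Then $$I^+_{err}(\alpha,\beta):=\lim_{n\to\infty}\frac{\log P^+_{err}}{n}\le I^+_{ldp}(\alpha,\beta),$$ where $$I^+_{ldp}(\alpha,\beta):=\alpha\log\left(\frac{\mathrm{erfinv}\left(2\frac{1-\alpha}{1-\beta_w}-1\right)}{\mathrm{erfinv}\left(2\frac{1-\alpha}{1-\beta_0}-1\right)}\right)+(1-\beta)\log\left(\frac{1-\beta}{1-\beta_w}\right)+\beta\log\left(\frac{(\alpha-\beta)(1-\beta_0)}{(\alpha-\beta_0)(1-\beta_w)}\right).$$ Moreover, with $F^{+}$ the objective function defined in the context, the choice $$\nu=\sqrt2\,\mathrm{erfinv}\left(2\tfrac{1-\alpha}{1-\beta_w}-1\right),\quad A_0=\frac{\mathrm{erfinv}\left(2\frac{1-\alpha}{1-\beta_w}-1\right)}{\mathrm{erfinv}\left(2\frac{1-\alpha}{1-\beta_0}-1\right)},\quad c_3=\frac{(1-A_0^2)\sqrt\alpha}{A_0},\quad \gamma=\frac{c_3}{2(1-A_0^2)}=\frac{\sqrt\alpha}{2A_0}$$ achieves $F^{+}(c_3,\nu,\gamma)=I^+_{ldp}(\alpha,\beta)$.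
   Context: A vector is called $k$-sparse here if it has exactly $k$ nonzero entries. $\mathbf{z}\ge0$ means all components are nonnegative. $\mathrm{erf}(x)=\frac{2}{\sqrt\pi}\int_0^x e^{-t^2}dt$, $\mathrm{erfc}=1-\mathrm{erf}$, and $\mathrm{erfinv}:(-1,1)\to\mathbb{R}$ is the inverse of $\mathrm{erf}$. Logarithms are natural. For $\alpha\in(0,1)$ and $b\in(2\alpha-1,\alpha)$, $$\xi^+_\alpha(b)=(1-b)\frac{\sqrt{\frac1{2\pi}}\,e^{-\left(\mathrm{erfinv}\left(2\frac{1-\alpha}{1-b}-1\right)\right)^2}}{\alpha\sqrt2\,\mathrm{erfinv}\left(2\frac{1-\alpha}{1-b}-1\right)}.$$ The numbers $\alpha_w,\beta_w,\beta_0$ exist and are unique in the indicated ranges. The objective function (of the optimization problem bounding $I^+_{err}$, over $c_3\ge0$, $\nu\ge0$, $\gamma>c_3/2$) is $$F^{+}(c_3,\nu,\gamma)=-\frac{c_3^2}{2}+I_{sph}+(1-\beta)\log w_{1,+}+\beta\log w_2+c_3\gamma,$$ with $$I_{sph}=\widehat\gamma c_3-\frac{\alpha}{2}\log\left(1-\frac{c_3}{2\widehat\gamma}\right),\quad \widehat\gamma=\frac{c_3-\sqrt{c_3^2+4\alpha}}{4},$$ $$w_{1,+}=\frac12\left(\frac{e^{\frac{c_3\nu^2/(4\gamma)}{1-c_3/(2\gamma)}}}{\sqrt{1-\frac{c_3}{2\gamma}}}\,\mathrm{erfc}\!\left(\frac{\nu}{\sqrt2\sqrt{1-\frac{c_3}{2\gamma}}}\right)+\mathrm{erf}\!\left(\frac{\nu}{\sqrt2}\right)+1\right),\quad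 w_2=\frac{e^{\frac{c_3\nu^2/(4\gamma)}{1-c_3/(2\gamma)}}}{\sqrt{1-\frac{c_3}{2\gamma}}}.$$ *)

theory Defs
  imports "HOL-Probability.Probability" "Jordan_Normal_Form.Matrix"
begin

text \<open>The interval integral is oriented, so this is the usual odd function on all of the reals.\<close>

definition erf :: "real \<Rightarrow> real" where
  "erf x = 2 / sqrt pi * (LBINT t=ereal 0..ereal x. exp (- (t\<^sup>2)))"

definition erfc :: "real \<Rightarrow> real" where
  "erfc x = 1 - erf x"

text \<open>Only meaningful on the open interval from -1 to 1, the range of \<^const>\<open>erf\<close>.\<close>

definition erfinv :: "real \<Rightarrow> real" where
  "erfinv = inv_into UNIV erf"

abbreviation erfinv_arg :: "real \<Rightarrow> real \<Rightarrow> real" where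
  "erfinv_arg \<alpha> b \<equiv> 2 * ((1 - \<alpha>) / (1 - b)) - 1"

definition xi_plus :: "real \<Rightarrow> real \<Rightarrow> real" where
  "xi_plus \<alpha> b =
     (1 - b) * ((sqrt (1 / (2 * pi)) * exp (- ((erfinv (erfinv_arg \<alpha> b))\<^sup>2)))
       / (\<alpha> * sqrt 2 * erfinv (erfinv_arg \<alpha> b)))"

definition I_ldp_plus :: "real \<Rightarrow> real \<Rightarrow> real \<Rightarrow> real \<Rightarrow> real" where
  "I_ldp_plus \<alpha> \<beta> \<beta>w \<beta>0 =
     \<alpha> * ln (erfinv (erfinv_arg \<alpha> \<beta>w) / erfinv (erfinv_arg \<alpha> \<beta>0))
     + (1 - \<beta>) * ln ((1 - \<beta>) / (1 - \<beta>w))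
     + \<beta> * ln (((\<alpha> - \<beta>) * (1 - \<beta>0)) / ((\<alpha> - \<beta>0) * (1 - \<beta>w)))"

definition gamma_hat :: "real \<Rightarrow> real \<Rightarrow> real" where
  "gamma_hat \<alpha> c3 = (c3 - sqrt (c3\<^sup>2 + 4 * \<alpha>)) / 4"

definition I_sph :: "real \<Rightarrow> real \<Rightarrow> real" where
  "I_sph \<alpha> c3 =
     gamma_hat \<alpha> c3 * c3 - \<alpha> / 2 * ln (1 - c3 / (2 * gamma_hat \<alpha> c3))"

definition w2 :: "real \<Rightarrow> real \<Rightarrow> real \<Rightarrow> real" where
  "w2 c3 \<nu> \<gamma> =
     exp ((c3 * \<nu>\<^sup>2 / (4 * \<gamma>)) / (1 - c3 / (2 * \<gamma>))) / sqrt (1 - c3 / (2 * \<gamma>))"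

definition w1_plus :: "real \<Rightarrow> real \<Rightarrow> real \<Rightarrow> real" where
  "w1_plus c3 \<nu> \<gamma> =
     1 / 2 * (exp ((c3 * \<nu>\<^sup>2 / (4 * \<gamma>)) / (1 - c3 / (2 * \<gamma>))) / sqrt (1 - c3 / (2 * \<gamma>))
              * erfc (\<nu> / (sqrt 2 * sqrt (1 - c3 / (2 * \<gamma>))))
            + erf (\<nu> / sqrt 2) + 1)"

definition F_plus :: "real \<Rightarrow> real \<Rightarrow> real \<Rightarrow> real \<Rightarrow> real \<Rightarrow> real" where
  "F_plus \<alpha> \<beta> c3 \<nu> \<gamma> =
     - (c3\<^sup>2) / 2 + I_sph \<alpha> c3 + (1 - \<beta>) * ln (w1_plus c3 \<nu> \<gamma>)
     + \<beta> * ln (w2 c3 \<nu> \<gamma>) + c3 * \<gamma>"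

definition l1_norm :: "real Matrix.vec \<Rightarrow> real" where
  "l1_norm z = (\<Sum>j<dim_vec z. \<bar>vec_index z j\<bar>)"

definition sparse_vec :: "nat \<Rightarrow> real Matrix.vec \<Rightarrow> bool" where
  "sparse_vec k x \<longleftrightarrow> card {j. j < dim_vec x \<and> vec_index x j \<noteq> 0} = k"

definition feasible_plus :: "real Matrix.mat \<Rightarrow> real Matrix.vec \<Rightarrow> real Matrix.vec set" where
  "feasible_plus A y =
     {z \<in> carrier_vec (dim_col A). A *\<^sub>v z = y \<and> 0\<^sub>v (dim_col A) \<le> z}"

definition l1_solutions_plus :: "real Matrix.mat \<Rightarrow> real Matrix.vec \<Rightarrow> real Matrix.vec set" where
  "l1_solutions_plus A y = {z. is_arg_min l1_norm (\<lambda>z. z \<in> feasible_plus A y) z}"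

definition std_gaussian_matrix ::
    "'w measure \<Rightarrow> nat \<Rightarrow> nat \<Rightarrow> ('w \<Rightarrow> real Matrix.mat) \<Rightarrow> bool" where
  "std_gaussian_matrix M m n A \<longleftrightarrow>
     prob_space M \<and>
     (\<forall>\<omega>\<in>space M. A \<omega> \<in> carrier_mat m n) \<and>
     prob_space.indep_vars M (\<lambda>_. borel) (\<lambda>rc \<omega>. A \<omega> $$ rc) ({..<m} \<times> {..<n}) \<and>
     (\<forall>rc\<in>{..<m} \<times> {..<n}.
        distributed M lborel (\<lambda>\<omega>. A \<omega> $$ rc) (\<lambda>t. ennreal (std_normal_density t)))"

text \<open>Failure means that \<open>x\<close> is not the unique minimizer.\<close>

definition P_err_plus ::
    "'w measure \<Rightarrow> ('w \<Rightarrow> real Matrix.mat) \<Rightarrow> real Matrix.vec \<Rightarrow> real" where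
  "P_err_plus M A x =
     measure M {\<omega> \<in> space M. l1_solutions_plus (A \<omega>) (A \<omega> *\<^sub>v x) \<noteq> {x}}"

text \<open>Logarithm of a probability, with value \<open>-\<infinity>\<close> at 0 (whereas \<open>ln 0 = 0\<close> in the library).\<close>

definition log_prob :: "real \<Rightarrow> ereal" where
  "log_prob p = (if p = 0 then -\<infinity> else ereal (ln p))"

end

theory Submission
  imports Defs "HOL-Real_Asymp.Real_Asymp"
begin

text \<open>
  Recovery fails iff some unit vector \<open>w\<close> of the descent cone (\<open>w j \<ge> 0\<close> off the support of \<open>x\<close>,
  \<open>\<Sum>j. w j \<le> 0\<close>) lies in the kernel of \<open>A\<close>. Gordon's comparison replaces \<open>A w\<close> together with an
  independent scalar \<open>g0\<close> by a Gaussian vector \<open>g\<close> together with \<open>h \<bullet> w\<close>: rotating the one process into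
  the other, Gaussian integration by parts shows that the expectation of
  \<open>exp (- (\<Sum>w. exp (\<kappa> * (u w - sqrt (1 + \<parallel>V w\<parallel>\<^sup>2) - x))))\<close> is monotone along the rotation, because
  \<open>u\<close> has slope 1 and the smoothed norm has slope at most 1. As \<open>\<kappa> \<rightarrow> \<infinity>\<close> this compares
  \<open>P (\<exists>w. A w \<approx> 0) * P (g0 \<ge> x + 2)\<close> with \<open>P (max\<^sub>w h \<bullet> w \<ge> \<parallel>g\<parallel> + x - 1)\<close>. The latter is bounded by
  Chernoff's method, where cone duality with multiplier \<open>\<nu>\<close> makes the exponential moment of
  \<open>max\<^sub>w h \<bullet> w\<close> factorise into powers of \<open>w1_plus\<close> and \<open>w2\<close>. The choice \<open>x = c3 * sqrt n\<close> gives the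
  exponent \<open>F_plus\<close>, which is evaluated at the stated parameters; monotonicity of Mills' ratio
  yields \<open>\<beta> < \<beta>w\<close> and \<open>A0 < 1\<close>, hence \<open>c3 > 0\<close>.
\<close>

section \<open>The standard Gaussian and the error function\<close>

text \<open>The scalar \<open>g0\<close> makes the comparison possible: for unit vectors
  \<open>v\<close> and \<open>w\<close> both \<open>v \<bullet> A w + g0\<close> and
  \<open>v \<bullet> g + h \<bullet> w\<close> have variance 2, so along the rotation the diagonal
  terms cancel and only mixed terms of known sign remain. Its price is visible in the exponent. At
  level \<open>x = c3 * sqrt n\<close>, dividing by the tail of \<open>g0\<close> costs about
  \<open>exp (c3^2 * n / 2)\<close> while Chernoff's method gains \<open>exp (- c3^2 * n)\<close>;
  the balance is the term \<open>- c3^2 / 2\<close> of \<open>F_plus\<close>. The parameter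
  \<open>\<gamma>\<close> linearises a root,
  \<open>sqrt Q \<le> \<gamma> * sqrt n + Q / (4 * \<gamma> * sqrt n)\<close>, so that the moment
  becomes a product over coordinates. \<open>I_sph\<close> is the exponent that bounds the mean of
  \<open>exp (- c3 * sqrt n * \<parallel>g\<parallel>)\<close>. The cone is infinite, the comparison
  treats finite sets \<open>W\<close>. As the resulting bound does not depend on \<open>W\<close>,
  for each fixed \<open>n\<close> the net can be refined without limit before \<open>n\<close>
  grows.\<close>

definition gauss :: "real measure" where
  "gauss = density lborel (\<lambda>t. ennreal (std_normal_density t))"

lemma sets_gauss [simp, measurable_cong]: "sets gauss = sets borel"
  by (simp add: gauss_def)

lemma space_gauss [simp]: "space gauss = UNIV"
  by (simp add: gauss_def)

interpretation gauss: prob_space gauss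
  unfolding gauss_def by (rule prob_space_normal_density) simp

interpretation gauss_PiM: product_prob_space "\<lambda>_. gauss" I for I
  by unfold_locales

lemma integrable_gauss_bounded:
  fixes F :: "real \<Rightarrow> real"
  assumes "F \<in> borel_measurable borel" "\<And>t. \<bar>F t\<bar> \<le> B"
  shows "integrable gauss F"
  using assms by (intro gauss.integrable_const_bound[where B = B]) auto

lemma integrable_gauss_id: "integrable gauss (\<lambda>t. t)"
  unfolding gauss_def
  using integrable_std_normal_moment[of 1] by (subst integrable_density) auto

text \<open>The standard normal density has derivative \<open>- t\<close> times itself, so the two
  sides differ by the integral of the derivative of \<open>F\<close> times the density. Boundedness
  of \<open>F\<close> makes the boundary terms vanish.\<close>

lemma gauss_integral_by_parts:
  fixes F F' :: "real \<Rightarrow> real"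
  assumes D: "\<And>t. (F has_real_derivative F' t) (at t)"
    and C: "\<And>t. isCont F' t"
    and B: "\<And>t. \<bar>F t\<bar> \<le> B" and B': "\<And>t. \<bar>F' t\<bar> \<le> B'"
  shows "(LINT t|gauss. t * F t) = (LINT t|gauss. F' t)"
proof -
  have CF: "isCont F t" for t using D DERIV_isCont by blast
  have mF[measurable]: "F \<in> borel_measurable borel" "F' \<in> borel_measurable borel"
    using CF C by (auto intro!: borel_measurable_continuous_onI continuous_at_imp_continuous_on)
  let ?n = std_normal_density
  have Dn: "(?n has_real_derivative (- t * ?n t)) (at t)" for t
    unfolding std_normal_density_def
    by (rule derivative_eq_intros refl | simp add: field_simps power2_eq_square)+
  have Cn: "isCont ?n t" for t using Dn DERIV_isCont by blast
  have DFn: "((\<lambda>t. F t * ?n t) has_real_derivative (?n t * F' t - ?n t * (t * F t))) (at t)" for t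
    by (rule derivative_eq_intros D Dn refl)+ (simp add: algebra_simps)
  have i1: "integrable lborel (\<lambda>t. ?n t * F' t)"
    using integrable_gauss_bounded[OF mF(2) B'] unfolding gauss_def
    by (subst (asm) integrable_density) auto
  have i2': "integrable gauss (\<lambda>t. t * F t)"
    by (rule Bochner_Integration.integrable_bound[OF integrable_mult_right[OF integrable_gauss_id, of B]])
       (auto simp: abs_mult intro!: AE_I2 mult_right_mono order_trans[OF B]
          simp: mult.commute[of "\<bar>t\<bar>" "\<bar>F t\<bar>" for t])
  hence i2: "integrable lborel (\<lambda>t. ?n t * (t * F t))"
    unfolding gauss_def by (subst (asm) integrable_density) auto
  have nlim: "(?n \<longlongrightarrow> 0) at_top" "(?n \<longlongrightarrow> 0) at_bot"
    unfolding std_normal_density_def by real_asymp+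
  have Fn_lim: "((\<lambda>t. F t * ?n t) \<longlongrightarrow> 0) G" if "(?n \<longlongrightarrow> 0) G" for G
  proof (rule Lim_null_comparison)
    show "\<forall>\<^sub>F t in G. norm (F t * ?n t) \<le> B * ?n t"
      using B by (intro always_eventually allI) (auto simp: abs_mult intro!: mult_right_mono)
    show "((\<lambda>t. B * ?n t) \<longlongrightarrow> 0) G" using tendsto_mult_right_zero[OF that] .
  qed
  have "(LBINT t=-\<infinity>..\<infinity>. ?n t * F' t - ?n t * (t * F t)) = 0 - 0"
  proof (rule interval_integral_FTC_integrable)
    show "((\<lambda>t. F t * ?n t) has_vector_derivative (?n t * F' t - ?n t * (t * F t))) (at t)" for t
      using DFn by (simp add: has_real_derivative_iff_has_vector_derivative)
    show "isCont (\<lambda>t. ?n t * F' t - ?n t * (t * F t)) t" for t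
      by (intro continuous_intros CF C Cn)
    show "set_integrable lborel (einterval (-\<infinity>) \<infinity>) (\<lambda>t. ?n t * F' t - ?n t * (t * F t))"
      using i1 i2 by (simp add: set_integrable_def)
    show "(((\<lambda>t. F t * ?n t) \<circ> real_of_ereal) \<longlongrightarrow> 0) (at_right (-\<infinity>))"
      "(((\<lambda>t. F t * ?n t) \<circ> real_of_ereal) \<longlongrightarrow> 0) (at_left \<infinity>)"
      using Fn_lim nlim by (auto simp: ereal_tendsto_simps)
  qed auto
  hence "(LBINT t. ?n t * F' t - ?n t * (t * F t)) = 0"
    by (simp add: interval_lebesgue_integral_def set_lebesgue_integral_def)
  hence "(LBINT t. ?n t * F' t) = (LBINT t. ?n t * (t * F t))"
    using i1 i2 by (simp add: Bochner_Integration.integral_diff)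
  thus ?thesis unfolding gauss_def by (subst (1 2) integral_density) auto
qed

section \<open>The error function and its inverse\<close>

lemma erf_has_derivative:
  "(erf has_real_derivative (2 / sqrt pi * exp (- (x\<^sup>2)))) (at x within A)"
proof -
  \<comment> \<open>The interval must contain the lower limit 0 of the integral and have
    \<open>x\<close> in its interior, so that the derivative within it is a two-sided one.\<close>
  define a where "a = min x 0 - 1"
  define b where "b = max x 0 + 1"
  have "((\<lambda>u. LBINT t=ereal 0..ereal u. exp (- (t\<^sup>2))) has_vector_derivative exp (- (x\<^sup>2)))
      (at x within {a..b})"
    by (rule interval_integral_FTC2) (auto intro!: continuous_intros simp: a_def b_def)
  hence "((\<lambda>u. LBINT t=ereal 0..ereal u. exp (- (t\<^sup>2))) has_vector_derivative exp (- (x\<^sup>2))) (at x)"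
    by (simp add: at_within_Icc_at a_def b_def)
  hence "((\<lambda>u. LBINT t=ereal 0..ereal u. exp (- (t\<^sup>2))) has_real_derivative exp (- (x\<^sup>2))) (at x)"
    by (simp add: has_real_derivative_iff_has_vector_derivative)
  from DERIV_cmult[OF this, of "2 / sqrt pi"] show ?thesis
    unfolding erf_def[abs_def] using has_field_derivative_at_within by blast
qed

lemma erf_0 [simp]: "erf 0 = 0"
  by (simp add: erf_def)

lemma erf_strict_mono: "x < y \<Longrightarrow> erf x < erf y"
  by (rule DERIV_pos_imp_increasing)
     (auto intro!: exI erf_has_derivative)

lemma continuous_on_erf: "continuous_on A erf"
  by (meson DERIV_continuous continuous_on_eq_continuous_within erf_has_derivative)

lemma measure_gauss_half_line: "measure gauss {..0} = 1 / 2" "measure gauss {0<..} = 1 / 2"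
proof -
  have m: "emeasure gauss A = (\<integral>\<^sup>+ t. ennreal (std_normal_density t) * indicator A t \<partial>lborel)"
    if "A \<in> sets borel" for A
    unfolding gauss_def using that by (subst emeasure_density) auto
  have "emeasure gauss {..<0} = (\<integral>\<^sup>+ t. ennreal (std_normal_density (0 + (-1) * t)) * indicator {..<0} (0 + (-1) * t) \<partial>lborel)"
    unfolding m[of "{..<0}", simplified] by (subst nn_integral_real_affine[of _ "-1" 0]) auto
  also have "\<dots> = emeasure gauss {0<..}"
    unfolding m[of "{0<..}", simplified]
    by (intro nn_integral_cong) (auto simp: std_normal_density_def indicator_def)
  finally have 1: "measure gauss {..<0} = measure gauss {0<..}" by (simp add: measure_def)
  have "emeasure gauss {0} = 0"
    unfolding m[of "{0}", simplified]
    by simp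
  hence 2: "measure gauss {0} = 0" by (simp add: measure_def)
  have "measure gauss ({..<0} \<union> {0}) = measure gauss {..<0} + measure gauss {0}"
    by (rule gauss.finite_measure_Union) auto
  moreover have "{..<0} \<union> {0} = {..0::real}" by auto
  ultimately have 3: "measure gauss {..0} = measure gauss {..<0}" using 2 by simp
  have "measure gauss (space gauss - {..0}) = 1 - measure gauss {..0}"
    by (rule gauss.prob_compl) auto
  moreover have "space gauss - {..0} = {0<..}" by auto
  ultimately have "measure gauss {0<..} = 1 - measure gauss {..0}" by simp
  thus "measure gauss {..0} = 1 / 2" "measure gauss {0<..} = 1 / 2" using 1 3 by auto
qed

lemma measure_gauss_atMost:
  assumes "0 \<le> x"
  shows "measure gauss {..x} = (1 + erf (x / sqrt 2)) / 2"
proof -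
  let ?y = "x / sqrt 2"
  have i: "set_integrable lborel {0..x / sqrt 2} (\<lambda>t. exp (- (t\<^sup>2)))"
    by (rule borel_integrable_atLeastAtMost') (auto intro!: continuous_intros)
  have "measure gauss {0..x} = (LBINT t. std_normal_density t * indicator {0..x} t)"
    using integral_density[of "indicator {0..x} :: real \<Rightarrow> real" lborel std_normal_density]
    unfolding gauss_def by simp
  also have "\<dots> = \<bar>sqrt 2\<bar> *\<^sub>R (LBINT t. std_normal_density (0 + sqrt 2 * t) * indicator {0..x} (0 + sqrt 2 * t))"
    by (rule lborel_integral_real_affine) simp
  also have "\<dots> = sqrt 2 * (LBINT t. (1 / (sqrt 2 * sqrt pi)) * (indicator {0..?y} t * exp (- (t\<^sup>2))))"
    by (simp add: std_normal_density_def real_sqrt_mult power_mult_distrib)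
       (intro Bochner_Integration.integral_cong,
         auto simp: indicator_def field_simps zero_le_mult_iff)
  also have "\<dots> = 1 / sqrt pi * (LBINT t. indicator {0..?y} t * exp (- (t\<^sup>2)))"
    by simp
  also have "\<dots> = erf ?y / 2"
    using assms unfolding erf_def
    by (subst interval_integral_Icc) (auto simp: set_lebesgue_integral_def)
  finally have 1: "measure gauss {0..x} = erf ?y / 2" .
  have "measure gauss {0} = 0"
    by (auto simp: gauss_def measure_def emeasure_density
        intro!: nn_integral_zero' eventually_mono[OF AE_lborel_singleton[of 0]])
  moreover have "measure gauss ({0} \<union> {0<..x}) = measure gauss {0} + measure gauss {0<..x}"
    by (rule gauss.finite_measure_Union) auto
  moreover have "{0} \<union> {0<..x} = {0..x}" using assms by auto
  moreover have "measure gauss ({..0} \<union> {0<..x}) = measure gauss {..0} + measure gauss {0<..x}"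
    by (rule gauss.finite_measure_Union) auto
  moreover have "{..0} \<union> {0<..x} = {..x}" using assms by auto
  ultimately show ?thesis using 1 measure_gauss_half_line by (simp add: field_simps)
qed

text \<open>The value 1 is the total mass of \<open>gauss\<close>, since \<open>erf x\<close> equals
  \<open>2 * cdf gauss (sqrt 2 * x) - 1\<close> for nonnegative \<open>x\<close>.\<close>

lemma erf_at_top: "(erf \<longlongrightarrow> 1) at_top"
proof -
  interpret real_distribution gauss by unfold_locales auto
  have "((\<lambda>x. 2 * cdf gauss x - 1) \<longlongrightarrow> 2 * 1 - 1) at_top"
    by (intro tendsto_intros cdf_lim_at_top_prob)
  moreover have "filterlim (\<lambda>x. sqrt 2 * x) at_top at_top"
    by (rule filterlim_tendsto_pos_mult_at_top[OF tendsto_const _ filterlim_ident]) auto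
  ultimately have "((\<lambda>x. 2 * cdf gauss (sqrt 2 * x) - 1) \<longlongrightarrow> 2 * 1 - 1) at_top"
    by (rule filterlim_compose)
  moreover have "\<forall>\<^sub>F x in at_top. 2 * cdf gauss (sqrt 2 * x) - 1 = erf x"
    using eventually_ge_at_top[of 0]
    by eventually_elim (simp add: cdf_def measure_gauss_atMost field_simps)
  ultimately show ?thesis using tendsto_cong by force
qed

text \<open>\<open>erfinv\<close> chooses a preimage, so the point is that \<open>y\<close> lies in
  the range of \<open>erf\<close>, by the intermediate value theorem. Nonnegative \<open>y\<close>
  suffices because \<open>erfinv_arg \<alpha> b\<close> is positive for
  \<open>2 * \<alpha> - 1 < b < \<alpha> < 1\<close>.\<close>

lemma erf_erfinv:
  assumes "0 \<le> y" "y < 1"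
  shows "erf (erfinv y) = y"
proof -
  have "\<forall>\<^sub>F x in at_top. y < erf x \<and> 0 < x"
    using order_tendstoD(1)[OF erf_at_top assms(2)] eventually_gt_at_top[of 0]
    by eventually_elim simp
  then obtain X where X: "y < erf X" "0 < X"
    using eventually_happens'[OF trivial_limit_at_top_linorder] by blast
  have "\<exists>x\<ge>0. x \<le> X \<and> erf x = y"
    by (rule IVT') (use X assms continuous_on_erf in auto)
  hence "y \<in> range erf" by auto
  thus ?thesis unfolding erfinv_def by (rule f_inv_into_f)
qed

lemma erfinv_pos:
  assumes "0 < y" "y < 1"
  shows "0 < erfinv y"
proof (rule ccontr)
  assume "\<not> 0 < erfinv y"
  hence "erf (erfinv y) \<le> erf 0"
    using erf_strict_mono[of "erfinv y" 0] by (cases "erfinv y = 0") auto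
  thus False using erf_erfinv[of y] assms by simp
qed

section \<open>Gaussian comparison\<close>

text \<open>Stated for \<open>k\<close> outside \<open>I\<close> as well, where every point of the
  product takes the value \<open>undefined\<close>; later measurability proofs then carry no index
  conditions.\<close>

lemma measurable_gauss_component [measurable]:
  "(\<lambda>\<xi>. \<xi> k) \<in> borel_measurable (PiM I (\<lambda>_. gauss))"
proof (cases "k \<in> I")
  case True
  have "(\<lambda>\<xi>. \<xi> k) \<in> measurable (PiM I (\<lambda>_. gauss)) gauss"
    using True by (rule measurable_component_singleton)
  thus ?thesis by (simp cong: measurable_cong_sets)
next
  case False
  hence "\<xi> k = undefined" if "\<xi> \<in> space (PiM I (\<lambda>_. gauss))" for \<xi>
    using that by (auto simp: space_PiM PiE_def extensional_def)
  thus ?thesis by (subst measurable_cong[where g = "\<lambda>_. undefined"]) auto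
qed

lemma integrable_gauss_PiM_component:
  assumes "k \<in> I"
  shows "integrable (PiM I (\<lambda>_. gauss)) (\<lambda>\<xi>. \<xi> k)"
proof -
  have "distr (PiM I (\<lambda>_. gauss)) gauss (\<lambda>\<xi>. \<xi> k) = gauss"
    using gauss_PiM.PiM_component[of k I] assms by simp
  hence "integrable (distr (PiM I (\<lambda>_. gauss)) gauss (\<lambda>\<xi>. \<xi> k)) (\<lambda>t. t)"
    using integrable_gauss_id by simp
  thus ?thesis
    by (subst (asm) integrable_distr_eq) (use assms in \<open>auto simp: measurable_cong_sets[of _ _ borel gauss]\<close>)
qed

lemma integrable_gauss_PiM_component_mult:
  fixes F :: "('i \<Rightarrow> real) \<Rightarrow> real"
  assumes "k \<in> I" and [measurable]: "F \<in> borel_measurable (PiM I (\<lambda>_. gauss))"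
    and B: "\<And>\<xi>. \<bar>F \<xi>\<bar> \<le> B"
  shows "integrable (PiM I (\<lambda>_. gauss)) (\<lambda>\<xi>. \<xi> k * F \<xi>)"
  by (rule Bochner_Integration.integrable_bound
        [OF integrable_mult_right[OF integrable_gauss_PiM_component[OF assms(1)], of B]])
     (auto simp: abs_mult intro!: AE_I2 mult_right_mono order_trans[OF B]
          simp: mult.commute[of "\<bar>t\<bar>" "\<bar>F u\<bar>" for t u])

text \<open>Fubini singles out coordinate \<open>k\<close>; with the others frozen this is the
  one-dimensional identity.\<close>

lemma gauss_PiM_integral_by_parts:
  fixes F F' :: "('i \<Rightarrow> real) \<Rightarrow> real"
  assumes I: "finite I" "k \<in> I"
    and [measurable]: "F \<in> borel_measurable (PiM I (\<lambda>_. gauss))"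
      "F' \<in> borel_measurable (PiM I (\<lambda>_. gauss))"
    and D: "\<And>\<xi> t. ((\<lambda>t. F (\<xi>(k := t))) has_real_derivative F' (\<xi>(k := t))) (at t)"
    and C: "\<And>\<xi> t. isCont (\<lambda>t. F' (\<xi>(k := t))) t"
    and B: "\<And>\<xi>. \<bar>F \<xi>\<bar> \<le> B" and B': "\<And>\<xi>. \<bar>F' \<xi>\<bar> \<le> B'"
  shows "(LINT \<xi>|PiM I (\<lambda>_. gauss). \<xi> k * F \<xi>) = (LINT \<xi>|PiM I (\<lambda>_. gauss). F' \<xi>)"
proof -
  define J where "J = I - {k}"
  have J: "finite J" "k \<notin> J" "insert k J = I" using I by (auto simp: J_def)
  have i1: "integrable (PiM I (\<lambda>_. gauss)) (\<lambda>\<xi>. \<xi> k * F \<xi>)"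
    by (rule integrable_gauss_PiM_component_mult[OF I(2) _ B]) measurable
  have i2: "integrable (PiM I (\<lambda>_. gauss)) F'"
    using B' by (intro gauss_PiM.integrable_const_bound[where B = B']) auto
  show ?thesis
    using gauss_PiM.product_integral_insert[OF J(1,2), of "\<lambda>\<xi>. \<xi> k * F \<xi>"]
      gauss_PiM.product_integral_insert[OF J(1,2), of F'] i1 i2
    by (simp add: J(3) gauss_integral_by_parts[OF D C B B'])
qed

text \<open>The function \<open>s\<close> below is unbounded, but \<open>f\<close> is the
  exponential of minus a sum of such terms. These estimates bound \<open>f * s\<close> and
  \<open>f * s * s\<close>, as integration by parts demands.\<close>

lemma mult_exp_minus_le:
  fixes S :: real
  assumes "0 \<le> S"
  shows "exp (- S) * S \<le> 1" "exp (- S) * S\<^sup>2 \<le> 2"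
proof -
  have "S \<le> exp S" using exp_ge_add_one_self[of S] by linarith
  thus "exp (- S) * S \<le> 1" by (simp add: exp_minus field_simps)
  have "1 + S + S\<^sup>2 / 2 \<le> exp S" by (rule exp_lower_Taylor_quadratic[OF assms])
  hence "S\<^sup>2 \<le> 2 * exp S" using assms by simp
  thus "exp (- S) * S\<^sup>2 \<le> 2" by (simp add: exp_minus field_simps)
qed

text \<open>The Gaussian array \<open>\<xi>\<close> holds \<open>A\<close> in its upper left \<open>m \<times> n\<close> block, \<open>g\<close> in the last column,
  \<open>h\<close> in the last row and \<open>g0\<close> in the corner.\<close>

locale gaussian_comparison =
  fixes W :: "(nat \<Rightarrow> real) set" and m n :: nat and \<kappa> x :: real
  assumes finite_W: "finite W" and \<kappa>_nonneg: "0 \<le> \<kappa>"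
    and unit_W: "\<And>w. w \<in> W \<Longrightarrow> (\<Sum>j<n. (w j)\<^sup>2) = 1"
begin

section \<open>The rotated process and its smooth functional\<close>

abbreviation "P \<equiv> PiM ({..m} \<times> {..n}) (\<lambda>_. gauss)"

text \<open>Rows below \<open>m\<close> interpolate
  \<open>cos \<theta> * g + sin \<theta> * A w\<close>, row \<open>m\<close> interpolates
  \<open>cos \<theta> * (h \<bullet> w) + sin \<theta> * g0\<close>. Angle 0 is the decoupled
  process, angle \<open>pi / 2\<close> the one with the matrix.\<close>

definition c :: "(nat \<Rightarrow> real) \<Rightarrow> nat \<Rightarrow> nat \<Rightarrow> real \<Rightarrow> real" where
  "c w i j \<theta> = (if i < m then if j < n then sin \<theta> * w j else cos \<theta>
                else if j < n then cos \<theta> * w j else sin \<theta>)"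

definition c' :: "(nat \<Rightarrow> real) \<Rightarrow> nat \<Rightarrow> nat \<Rightarrow> real \<Rightarrow> real" where
  "c' w i j \<theta> = (if i < m then if j < n then cos \<theta> * w j else - sin \<theta>
                else if j < n then - sin \<theta> * w j else cos \<theta>)"

definition Z :: "real \<Rightarrow> (nat \<times> nat \<Rightarrow> real) \<Rightarrow> (nat \<Rightarrow> real) \<Rightarrow> nat \<Rightarrow> real" where
  "Z \<theta> \<xi> w i = (\<Sum>j\<le>n. \<xi> (i, j) * c w i j \<theta>)"

text \<open>The 1 under the root makes the norm smooth at the origin and changes it by at most
  1.\<close>

definition N :: "(nat \<Rightarrow> real) \<Rightarrow> real" where
  "N z = sqrt (1 + (\<Sum>i<m. (z i)\<^sup>2))"

definition s :: "(nat \<Rightarrow> real) \<Rightarrow> real" where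
  "s z = exp (\<kappa> * (z m - N z - x))"

text \<open>A smooth stand-in for the indicator that no \<open>w\<close> in \<open>W\<close>
  satisfies \<open>z w m \<ge> N (z w) + x\<close>: for large \<open>\<kappa>\<close> each
  \<open>s\<close> is huge or tiny according to the sign of its exponent.\<close>

definition f :: "((nat \<Rightarrow> real) \<Rightarrow> nat \<Rightarrow> real) \<Rightarrow> real" where
  "f z = exp (- (\<Sum>w\<in>W. s (z w)))"

text \<open>Logarithmic derivative of \<open>s\<close> in coordinate \<open>i\<close>.\<close>

definition q :: "(nat \<Rightarrow> real) \<Rightarrow> nat \<Rightarrow> real" where
  "q z i = (if i < m then - \<kappa> * z i / N z else \<kappa>)"

text \<open>Partial derivative of \<open>q z i\<close> with respect to \<open>z i\<close>.\<close>

definition r :: "(nat \<Rightarrow> real) \<Rightarrow> nat \<Rightarrow> real" where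
  "r z i = (if i < m then - \<kappa> * (1 / N z - (z i)\<^sup>2 / N z ^ 3) else 0)"

text \<open>Partial derivative of \<open>f z * s (z w) * q (z w) i\<close> with respect to
  coordinate \<open>i\<close> of \<open>z w'\<close>, hence minus a second partial derivative of
  \<open>f\<close>. The factors \<open>s\<close> and \<open>q\<close> depend on \<open>z w\<close>
  alone, so they contribute only for \<open>w = w'\<close>.\<close>

definition D :: "((nat \<Rightarrow> real) \<Rightarrow> nat \<Rightarrow> real) \<Rightarrow> (nat \<Rightarrow> real) \<Rightarrow> (nat \<Rightarrow> real) \<Rightarrow> nat \<Rightarrow> real" where
  "D z w w' i = (if w = w' then f z * s (z w) * ((q (z w) i)\<^sup>2 + r (z w) i) else 0)
     - f z * s (z w) * s (z w') * q (z w) i * q (z w') i"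

section \<open>Uniform bounds on the functionals\<close>

lemma N_ge_1: "1 \<le> N z"
  by (simp add: N_def sum_nonneg)

lemma N_pos: "0 < N z" using N_ge_1[of z] by linarith

lemma N_sq: "(N z)\<^sup>2 = 1 + (\<Sum>i<m. (z i)\<^sup>2)"
  unfolding N_def by (simp add: sum_nonneg add_nonneg_nonneg)

lemma s_pos: "0 < s z" by (simp add: s_def)

lemma f_pos: "0 < f z" by (simp add: f_def)

lemma f_le_1: "f z \<le> 1" by (simp add: f_def sum_nonneg less_imp_le s_pos)

lemma s_le_sum: "w \<in> W \<Longrightarrow> s (z w) \<le> (\<Sum>w\<in>W. s (z w))"
  using finite_W s_pos by (intro member_le_sum) (auto intro: less_imp_le)

lemma f_s_le: "w \<in> W \<Longrightarrow> f z * s (z w) \<le> 1"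
  using mult_exp_minus_le(1)[of "\<Sum>w\<in>W. s (z w)"] s_le_sum[of w z] s_pos
  unfolding f_def by (smt (verit) exp_gt_zero mult_left_mono sum_nonneg)

lemma f_s_s_le:
  assumes "w \<in> W" "w' \<in> W"
  shows "f z * s (z w) * s (z w') \<le> 2"
proof -
  let ?S = "\<Sum>w\<in>W. s (z w)"
  have "s (z w) * s (z w') \<le> ?S * ?S"
    using s_le_sum assms s_pos by (intro mult_mono sum_nonneg) (auto intro: less_imp_le)
  hence "f z * (s (z w) * s (z w')) \<le> exp (- ?S) * ?S\<^sup>2"
    unfolding f_def power2_eq_square by (intro mult_left_mono) auto
  also have "\<dots> \<le> 2" by (intro mult_exp_minus_le(2) sum_nonneg) (auto intro: less_imp_le s_pos)
  finally show ?thesis by (simp add: mult.assoc)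
qed

lemma abs_component_le_N: "i < m \<Longrightarrow> \<bar>z i\<bar> \<le> N z"
proof -
  assume "i < m"
  hence "(z i)\<^sup>2 \<le> (\<Sum>i<m. (z i)\<^sup>2)" by (intro member_le_sum) auto
  hence "\<bar>z i\<bar>\<^sup>2 \<le> (N z)\<^sup>2" by (simp add: N_sq)
  thus ?thesis using N_pos[of z] by (meson abs_ge_zero less_imp_le power2_le_imp_le)
qed

lemma abs_q_le: "\<bar>q z i\<bar> \<le> \<kappa>"
proof (cases "i < m")
  case True
  have "\<kappa> * \<bar>z i\<bar> \<le> \<kappa> * N z" by (intro mult_left_mono abs_component_le_N True \<kappa>_nonneg)
  thus ?thesis using True N_pos[of z] \<kappa>_nonneg by (simp add: q_def abs_mult field_simps)
qed (simp add: q_def \<kappa>_nonneg)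

lemma abs_r_le: "\<bar>r z i\<bar> \<le> \<kappa>"
proof (cases "i < m")
  case True
  have "(z i)\<^sup>2 \<le> (N z)\<^sup>2" using abs_component_le_N[OF True] N_pos[of z] abs_le_square_iff by fastforce
  hence 1: "(z i)\<^sup>2 / N z ^ 3 \<le> 1 / N z"
    using N_pos[of z] by (simp add: field_simps power2_eq_square power3_eq_cube)
  have 2: "0 \<le> (z i)\<^sup>2 / N z ^ 3" using N_pos[of z] by simp
  have 3: "1 / N z \<le> 1" using N_ge_1[of z] by simp
  have "\<bar>1 / N z - (z i)\<^sup>2 / N z ^ 3\<bar> \<le> 1" using 1 2 3 by linarith
  hence "\<kappa> * \<bar>1 / N z - (z i)\<^sup>2 / N z ^ 3\<bar> \<le> \<kappa> * 1" by (intro mult_left_mono \<kappa>_nonneg)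
  thus ?thesis using True \<kappa>_nonneg by (simp add: r_def abs_mult)
qed (simp add: r_def \<kappa>_nonneg)

lemma abs_f_s_le: "w \<in> W \<Longrightarrow> \<bar>f z * s (z w)\<bar> \<le> 1"
  using f_s_le[of w z] f_pos[of z] s_pos[of "z w"] by (simp add: abs_mult)

lemma abs_f_s_q_le: "w \<in> W \<Longrightarrow> \<bar>f z * s (z w) * q (z w) i\<bar> \<le> \<kappa>"
proof -
  assume "w \<in> W"
  hence "\<bar>f z * s (z w)\<bar> * \<bar>q (z w) i\<bar> \<le> 1 * \<kappa>"
    by (intro mult_mono abs_f_s_le abs_q_le) auto
  thus ?thesis by (simp add: abs_mult)
qed

lemma abs_D_le:
  assumes "w \<in> W" "w' \<in> W"
  shows "\<bar>D z w w' i\<bar> \<le> 3 * \<kappa>\<^sup>2 + \<kappa>"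
proof -
  have q2: "(q (z w) i)\<^sup>2 \<le> \<kappa>\<^sup>2"
    using abs_q_le[of "z w" i] \<kappa>_nonneg abs_le_square_iff by fastforce
  have "\<bar>f z * s (z w)\<bar> * \<bar>(q (z w) i)\<^sup>2 + r (z w) i\<bar> \<le> 1 * (\<kappa>\<^sup>2 + \<kappa>)"
    using q2 abs_r_le[of "z w" i] zero_le_power2[of "q (z w) i"] assms
    by (intro mult_mono abs_f_s_le) (unfold abs_le_iff, linarith+)
  moreover have "\<bar>f z * s (z w) * s (z w')\<bar> * (\<bar>q (z w) i\<bar> * \<bar>q (z w') i\<bar>) \<le> 2 * (\<kappa> * \<kappa>)"
    using f_s_s_le[of w w' z] f_pos[of z] s_pos[of "z w"] s_pos[of "z w'"] abs_q_le assms \<kappa>_nonneg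
    by (intro mult_mono) (auto simp: abs_mult)
  moreover have "\<bar>(if w = w' then a else 0) - b\<bar> \<le> A + B" if "\<bar>a\<bar> \<le> A" "\<bar>b\<bar> \<le> B" for a b A B :: real
    using that by auto
  ultimately have "\<bar>D z w w' i\<bar> \<le> 1 * (\<kappa>\<^sup>2 + \<kappa>) + 2 * (\<kappa> * \<kappa>)"
    unfolding D_def mult.assoc[of _ "q (z w) i"] abs_mult[symmetric] by blast
  thus ?thesis by (simp add: power2_eq_square)
qed

section \<open>Derivatives, measurability and continuity\<close>

lemma s_has_derivative:
  assumes "\<And>i. i \<le> m \<Longrightarrow> ((\<lambda>t. z t i) has_real_derivative z' i) (at t within A)"
  shows "((\<lambda>t. s (z t)) has_real_derivative s (z t) * (\<Sum>i\<le>m. q (z t) i * z' i)) (at t within A)"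
proof -
  have pos: "0 < 1 + (\<Sum>i<m. (z t i)\<^sup>2)" by (simp add: sum_nonneg add_pos_nonneg)
  have inner: "((\<lambda>t. 1 + (\<Sum>i<m. (z t i)\<^sup>2)) has_real_derivative (\<Sum>i<m. 2 * (z t i * z' i))) (at t within A)"
    by (auto intro!: derivative_eq_intros assms simp: mult_ac)
  have "((\<lambda>t. N (z t)) has_real_derivative (\<Sum>i<m. z t i * z' i) / N (z t)) (at t within A)"
    unfolding N_def
    by (rule DERIV_cong[OF DERIV_chain2[where f = sqrt, OF DERIV_real_sqrt[OF pos] inner]])
       (simp add: sum_distrib_left[symmetric] mult.assoc divide_simps)
  hence "((\<lambda>t. s (z t)) has_real_derivative
      exp (\<kappa> * (z t m - N (z t) - x)) * (\<kappa> * (z' m - (\<Sum>i<m. z t i * z' i) / N (z t)))) (at t within A)"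
    unfolding s_def by (auto intro!: derivative_eq_intros assms)
  moreover have "(\<Sum>i\<le>m. q (z t) i * z' i) = \<kappa> * (z' m - (\<Sum>i<m. z t i * z' i) / N (z t))"
    unfolding lessThan_Suc_atMost[symmetric]
    by (simp add: q_def sum_distrib_left sum_divide_distrib sum_negf algebra_simps)
  ultimately show ?thesis by (simp add: s_def)
qed

lemma f_has_derivative:
  assumes "\<And>w i. w \<in> W \<Longrightarrow> i \<le> m \<Longrightarrow> ((\<lambda>t. z t w i) has_real_derivative z' w i) (at t within A)"
  shows "((\<lambda>t. f (z t)) has_real_derivative
     - (\<Sum>w\<in>W. \<Sum>i\<le>m. f (z t) * s (z t w) * q (z t w) i * z' w i)) (at t within A)"
proof -
  have "((\<lambda>t. f (z t)) has_real_derivative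
     f (z t) * - (\<Sum>w\<in>W. s (z t w) * (\<Sum>i\<le>m. q (z t w) i * z' w i))) (at t within A)"
    unfolding f_def
    by (auto intro!: derivative_eq_intros s_has_derivative assms simp: algebra_simps)
  thus ?thesis by (simp add: sum_distrib_left algebra_simps sum_negf)
qed

lemma c_has_derivative: "(c w i j has_real_derivative c' w i j \<theta>) (at \<theta> within A)"
  unfolding c_def[abs_def] c'_def by (auto intro!: derivative_eq_intros)

lemma Z_has_derivative:
  "((\<lambda>\<theta>. Z \<theta> \<xi> w i) has_real_derivative (\<Sum>j\<le>n. \<xi> (i, j) * c' w i j \<theta>)) (at \<theta> within A)"
  unfolding Z_def by (auto intro!: derivative_eq_intros c_has_derivative simp: mult.commute)

lemma Z_update_has_derivative:
  assumes "j \<le> n"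
  shows "((\<lambda>t. Z \<theta> (\<xi>((i, j) := t)) w l) has_real_derivative (if l = i then c w i j \<theta> else 0))
    (at t within A)"
proof -
  have "((\<lambda>t. (\<xi>((i, j) := t)) (l, j') * c w l j' \<theta>) has_real_derivative
      (if j' = j then if l = i then c w i j \<theta> else 0 else 0)) (at t within A)" for j'
    by (cases "l = i \<and> j' = j") (auto intro!: derivative_eq_intros)
  hence "((\<lambda>t. \<Sum>j'\<le>n. (\<xi>((i, j) := t)) (l, j') * c w l j' \<theta>) has_real_derivative
      (\<Sum>j'\<le>n. if j' = j then if l = i then c w i j \<theta> else 0 else 0)) (at t within A)"
    by (rule DERIV_sum)
  thus ?thesis unfolding Z_def using assms by simp
qed

lemma isCont_Z_update: "isCont (\<lambda>t. Z \<theta> (\<xi>((i, j) := t)) w l) t"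
  unfolding Z_def
  by (rule continuous_sum, rename_tac j') (case_tac "l = i \<and> j' = j", auto intro!: continuous_intros)

lemma measurable_Z [measurable]: "(\<lambda>\<xi>. Z \<theta> \<xi> w i) \<in> borel_measurable P"
  unfolding Z_def by measurable

lemma measurable_Z' [measurable]: "(\<lambda>(\<xi>, \<theta>). Z \<theta> \<xi> w i) \<in> borel_measurable (P \<Otimes>\<^sub>M lborel)"
  unfolding Z_def c_def case_prod_beta by measurable

lemma borel_measurable_functionals:
  assumes "\<And>w i. (\<lambda>y. z y w i) \<in> borel_measurable M"
  shows "(\<lambda>y. N (z y w)) \<in> borel_measurable M"
    "(\<lambda>y. s (z y w)) \<in> borel_measurable M"
    "(\<lambda>y. f (z y)) \<in> borel_measurable M"
    "(\<lambda>y. q (z y w) i) \<in> borel_measurable M"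
    "(\<lambda>y. r (z y w) i) \<in> borel_measurable M"
    "(\<lambda>y. D (z y) w w' i) \<in> borel_measurable M"
  using assms unfolding N_def s_def f_def q_def r_def D_def by measurable

lemma continuous_functionals:
  assumes "\<And>w i. continuous G (\<lambda>y. z y w i)" and "G \<noteq> bot" 
  shows "continuous G (\<lambda>y. N (z y w))"
    "continuous G (\<lambda>y. s (z y w))"
    "continuous G (\<lambda>y. f (z y))"
    "continuous G (\<lambda>y. q (z y w) i)"
    "continuous G (\<lambda>y. r (z y w) i)"
    "continuous G (\<lambda>y. D (z y) w w' i)"
proof -
  have N0: "N z \<noteq> 0" for z using N_pos[of z] by simp
  show N: "continuous G (\<lambda>y. N (z y w))" for w
    unfolding N_def by (intro continuous_intros assms)
  show s: "continuous G (\<lambda>y. s (z y w))" for w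
    unfolding s_def by (intro continuous_intros assms N)
  show f: "continuous G (\<lambda>y. f (z y))"
    unfolding f_def by (intro continuous_intros s)
  show q: "continuous G (\<lambda>y. q (z y w) i)" for w
    unfolding q_def by (cases "i < m") (auto intro!: continuous_intros continuous_divide assms N simp: N0)
  show r: "continuous G (\<lambda>y. r (z y w) i)" for w
    unfolding r_def by (cases "i < m") (auto intro!: continuous_intros continuous_divide assms N simp: N0)
  show "continuous G (\<lambda>y. D (z y) w w' i)"
    unfolding D_def by (cases "w = w'") (auto intro!: continuous_intros s f q r)
qed

lemma q_has_derivative:
  assumes "\<And>l. l \<le> m \<Longrightarrow> ((\<lambda>t. z t l) has_real_derivative (if l = i then a else 0)) (at t within A)"
    and "i \<le> m"
  shows "((\<lambda>t. q (z t) i) has_real_derivative r (z t) i * a) (at t within A)"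
proof (cases "i < m")
  case True
  have pos: "0 < 1 + (\<Sum>i<m. (z t i)\<^sup>2)" by (simp add: sum_nonneg add_pos_nonneg)
  have inner: "((\<lambda>t. 1 + (\<Sum>i<m. (z t i)\<^sup>2)) has_real_derivative (\<Sum>l<m. 2 * z t l * (if l = i then a else 0))) (at t within A)"
    by (auto intro!: derivative_eq_intros assms simp: mult_ac)
  have "((\<lambda>t. N (z t)) has_real_derivative z t i * a / N (z t)) (at t within A)"
    unfolding N_def
    by (rule DERIV_cong[OF DERIV_chain2[where f = sqrt, OF DERIV_real_sqrt[OF pos] inner]])
       (use True in \<open>simp add: if_distrib[of "\<lambda>x. _ * x"] divide_simps cong: if_cong\<close>)
  note dN = this
  have "((\<lambda>t. - \<kappa> * z t i / N (z t)) has_real_derivative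
      (- \<kappa> * a * N (z t) - (- \<kappa> * z t i) * (z t i * a / N (z t))) / (N (z t) * N (z t))) (at t within A)"
    using assms(1)[of i] True N_pos[of "z t"]
    by (intro DERIV_divide DERIV_cmult dN) auto
  also have "(- \<kappa> * a * N (z t) - (- \<kappa> * z t i) * (z t i * a / N (z t))) / (N (z t) * N (z t)) = r (z t) i * a"
    using N_pos[of "z t"] True unfolding r_def
    by (simp add: field_simps power2_eq_square power3_eq_cube)
  finally show ?thesis using True by (simp add: q_def[abs_def])
qed (use assms in \<open>simp add: q_def r_def\<close>)

text \<open>Entry \<open>(i, j)\<close> of the array moves coordinate \<open>i\<close> of
  \<open>Z\<close> for all \<open>w'\<close> at once, with rate \<open>c w' i j \<theta>\<close>;
  the chain rule therefore sums over \<open>W\<close>.\<close>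

lemma f_s_q_update_has_derivative:
  fixes \<theta> :: real and \<xi> :: "nat \<times> nat \<Rightarrow> real"
  assumes w: "w \<in> W" and i: "i \<le> m" and j: "j \<le> n"
  defines "\<zeta> \<equiv> \<lambda>t. Z \<theta> (\<xi>((i, j) := t))"
  shows "((\<lambda>t. f (\<zeta> t) * s (\<zeta> t w) * q (\<zeta> t w) i) has_real_derivative
    (\<Sum>w'\<in>W. c w' i j \<theta> * D (\<zeta> t) w w' i)) (at t)"
proof -
  have dz: "((\<lambda>t. \<zeta> t w l) has_real_derivative (if l = i then c w i j \<theta> else 0)) (at t)" for w l
    unfolding \<zeta>_def by (rule Z_update_has_derivative[OF j])
  have cz: "(\<Sum>l\<le>m. g l * (if l = i then b else 0)) = g i * b" for g :: "nat \<Rightarrow> real" and b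
    using i by (simp add: if_distrib[of "\<lambda>x. _ * x"] cong: if_cong)
  have "((\<lambda>t. f (\<zeta> t)) has_real_derivative
     - (\<Sum>w'\<in>W. f (\<zeta> t) * s (\<zeta> t w') * q (\<zeta> t w') i * c w' i j \<theta>)) (at t)"
    by (rule DERIV_cong[OF f_has_derivative[OF dz]]) (simp add: cz)
  moreover have "((\<lambda>t. s (\<zeta> t w)) has_real_derivative s (\<zeta> t w) * (q (\<zeta> t w) i * c w i j \<theta>)) (at t)"
    by (rule DERIV_cong[OF s_has_derivative[OF dz]]) (simp add: cz)
  moreover have "((\<lambda>t. q (\<zeta> t w) i) has_real_derivative r (\<zeta> t w) i * c w i j \<theta>) (at t)"
    by (rule q_has_derivative[OF dz i])
  ultimately have "((\<lambda>t. f (\<zeta> t) * s (\<zeta> t w) * q (\<zeta> t w) i) has_real_derivative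
     (- (\<Sum>w'\<in>W. f (\<zeta> t) * s (\<zeta> t w') * q (\<zeta> t w') i * c w' i j \<theta>) * s (\<zeta> t w)
      + s (\<zeta> t w) * (q (\<zeta> t w) i * c w i j \<theta>) * f (\<zeta> t)) * q (\<zeta> t w) i
      + r (\<zeta> t w) i * c w i j \<theta> * (f (\<zeta> t) * s (\<zeta> t w))) (at t)"
    by (intro DERIV_mult)
  also have "(- (\<Sum>w'\<in>W. f (\<zeta> t) * s (\<zeta> t w') * q (\<zeta> t w') i * c w' i j \<theta>) * s (\<zeta> t w)
      + s (\<zeta> t w) * (q (\<zeta> t w) i * c w i j \<theta>) * f (\<zeta> t)) * q (\<zeta> t w) i
      + r (\<zeta> t w) i * c w i j \<theta> * (f (\<zeta> t) * s (\<zeta> t w)) =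
     (\<Sum>w'\<in>W. c w' i j \<theta> * D (\<zeta> t) w w' i)"
    using w finite_W
    by (simp add: D_def right_diff_distrib sum_subtractf if_distrib[of "\<lambda>x. _ * x"] cong: if_cong)
       (simp add: sum_distrib_left sum_distrib_right algebra_simps power2_eq_square)
  finally show ?thesis .
qed

section \<open>Monotonicity of the expectation along the rotation\<close>

lemma abs_c_le: "\<bar>c w i j \<theta>\<bar> \<le> 1 + \<bar>w j\<bar>" "\<bar>c' w i j \<theta>\<bar> \<le> 1 + \<bar>w j\<bar>"
proof -
  have "\<bar>sin \<theta>\<bar> * \<bar>w j\<bar> \<le> 1 * \<bar>w j\<bar>" "\<bar>cos \<theta>\<bar> * \<bar>w j\<bar> \<le> 1 * \<bar>w j\<bar>"
    by (intro mult_right_mono; simp)+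
  thus "\<bar>c w i j \<theta>\<bar> \<le> 1 + \<bar>w j\<bar>" "\<bar>c' w i j \<theta>\<bar> \<le> 1 + \<bar>w j\<bar>"
    by (auto simp: c_def c'_def abs_mult add_increasing2)
qed

lemma expectation_ibp:
  assumes w: "w \<in> W" and i: "i \<le> m" and j: "j \<le> n"
  shows "(LINT \<xi>|P. \<xi> (i, j) * (f (Z \<theta> \<xi>) * s (Z \<theta> \<xi> w) * q (Z \<theta> \<xi> w) i)) =
    (\<Sum>w'\<in>W. c w' i j \<theta> * (LINT \<xi>|P. D (Z \<theta> \<xi>) w w' i))"
proof -
  note [measurable] = borel_measurable_functionals[where z = "\<lambda>\<xi>. Z \<theta> \<xi>" and M = P, OF measurable_Z]
  have bD: "\<bar>c w' i j \<theta> * D z w w' i\<bar> \<le> (1 + \<bar>w' j\<bar>) * (3 * \<kappa>\<^sup>2 + \<kappa>)" if "w' \<in> W" for w' z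
    unfolding abs_mult by (intro mult_mono abs_c_le abs_D_le w that) auto
  have "(LINT \<xi>|P. \<xi> (i, j) * (f (Z \<theta> \<xi>) * s (Z \<theta> \<xi> w) * q (Z \<theta> \<xi> w) i)) =
    (LINT \<xi>|P. (\<Sum>w'\<in>W. c w' i j \<theta> * D (Z \<theta> \<xi>) w w' i))"
  proof (rule gauss_PiM_integral_by_parts)
    show "((\<lambda>t. f (Z \<theta> (\<xi>((i, j) := t))) * s (Z \<theta> (\<xi>((i, j) := t)) w) * q (Z \<theta> (\<xi>((i, j) := t)) w) i)
        has_real_derivative (\<Sum>w'\<in>W. c w' i j \<theta> * D (Z \<theta> (\<xi>((i, j) := t))) w w' i)) (at t)" for \<xi> t
      by (rule f_s_q_update_has_derivative[OF assms])
    show "isCont (\<lambda>t. \<Sum>w'\<in>W. c w' i j \<theta> * D (Z \<theta> (\<xi>((i, j) := t))) w w' i) t" for \<xi> t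
      by (intro continuous_intros continuous_functionals isCont_Z_update) auto
    show "\<bar>f (Z \<theta> \<xi>) * s (Z \<theta> \<xi> w) * q (Z \<theta> \<xi> w) i\<bar> \<le> \<kappa>" for \<xi>
      by (rule abs_f_s_q_le[OF w])
    show "\<bar>\<Sum>w'\<in>W. c w' i j \<theta> * D (Z \<theta> \<xi>) w w' i\<bar> \<le> (\<Sum>w'\<in>W. (1 + \<bar>w' j\<bar>) * (3 * \<kappa>\<^sup>2 + \<kappa>))" for \<xi>
      by (rule order_trans[OF sum_abs]) (intro sum_mono bD)
  qed (use i j in auto)
  also have "\<dots> = (\<Sum>w'\<in>W. (LINT \<xi>|P. c w' i j \<theta> * D (Z \<theta> \<xi>) w w' i))"
    by (intro Bochner_Integration.integral_sum gauss_PiM.integrable_const_bound[OF AE_I2]) (auto intro!: bD)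
  finally show ?thesis by simp
qed

text \<open>Covariance between the velocity of the process at \<open>w\<close> and its position at
  \<open>w'\<close>. Rows below \<open>m\<close> and row \<open>m\<close> carry opposite signs, and
  for \<open>w = w'\<close> a unit vector it vanishes: this is the equality of variances that
  \<open>g0\<close> provides.\<close>

lemma sum_c'_c:
  "(\<Sum>j\<le>n. c' w i j \<theta> * c w' i j \<theta>) =
    (if i < m then 1 else - 1) * (sin \<theta> * cos \<theta>) * ((\<Sum>j<n. w j * w' j) - 1)"
  unfolding lessThan_Suc_atMost[symmetric]
  by (simp add: c_def c'_def sum_distrib_left algebra_simps sum_negf)

lemma inner_le_1:
  assumes "w \<in> W" "w' \<in> W"
  shows "(\<Sum>j<n. w j * w' j) \<le> 1"
proof -
  have "(\<Sum>j<n. w j * w' j) \<le> (\<Sum>j<n. ((w j)\<^sup>2 + (w' j)\<^sup>2) / 2)"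
    by (intro sum_mono) (use sum_squares_bound in \<open>simp add: field_simps\<close>)
  also have "\<dots> = 1" using unit_W[OF assms(1)] unit_W[OF assms(2)]
    by (simp add: sum_divide_distrib[symmetric] sum.distrib)
  finally show ?thesis .
qed

text \<open>Up to the factor \<open>- \<kappa>\<close> the first \<open>m\<close> entries of
  \<open>q\<close> form the gradient of \<open>N\<close>, whose length is at most 1. The bound is
  the product of the two entries at \<open>m\<close>, so the norm part never outweighs the linear
  part.\<close>

lemma sum_q_le: "(\<Sum>i<m. q z i * q z' i) \<le> \<kappa>\<^sup>2"
proof -
  have 1: "(\<Sum>i<m. (q z i)\<^sup>2) \<le> \<kappa>\<^sup>2" for z
  proof -
    have "(\<Sum>i<m. (q z i)\<^sup>2) = \<kappa>\<^sup>2 * ((\<Sum>i<m. (z i)\<^sup>2) / (N z)\<^sup>2)"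
      by (simp add: q_def power_divide power_mult_distrib sum_divide_distrib sum_distrib_left)
    also have "\<dots> \<le> \<kappa>\<^sup>2 * 1"
      using sum_nonneg[of "{..<m}" "\<lambda>i. (z i)\<^sup>2"] by (intro mult_left_mono) (auto simp: N_sq[of z])
    finally show ?thesis by simp
  qed
  have "(\<Sum>i<m. q z i * q z' i) \<le> (\<Sum>i<m. ((q z i)\<^sup>2 + (q z' i)\<^sup>2) / 2)"
    by (intro sum_mono) (use sum_squares_bound[of "q z i" "q z' i" for i] in \<open>simp add: field_simps\<close>)
  also have "\<dots> \<le> \<kappa>\<^sup>2" using 1[of z] 1[of z']
    by (simp add: sum_divide_distrib[symmetric] sum.distrib)
  finally show ?thesis .
qed

definition g :: "real \<Rightarrow> (nat \<times> nat \<Rightarrow> real) \<Rightarrow> real" where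
  "g \<theta> \<xi> = - (\<Sum>w\<in>W. \<Sum>i\<le>m. \<Sum>j\<le>n.
     c' w i j \<theta> * (\<xi> (i, j) * (f (Z \<theta> \<xi>) * s (Z \<theta> \<xi> w) * q (Z \<theta> \<xi> w) i)))"

lemma f_Z_has_derivative: "((\<lambda>\<theta>. f (Z \<theta> \<xi>)) has_real_derivative g \<theta> \<xi>) (at \<theta> within A)"
  by (rule DERIV_cong[OF f_has_derivative[OF Z_has_derivative]])
     (simp add: g_def sum_distrib_left mult_ac)

lemma continuous_on_g: "continuous_on A (\<lambda>\<theta>. g \<theta> \<xi>)"
proof -
  have "isCont (\<lambda>\<theta>. Z \<theta> \<xi> w i) \<theta>" for w i \<theta>
    using Z_has_derivative DERIV_isCont by blast
  moreover have "isCont (\<lambda>\<theta>. c' w i j \<theta>) \<theta>" for w i j \<theta>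
    unfolding c'_def by (cases "i < m"; cases "j < n") (auto intro!: continuous_intros)
  ultimately show ?thesis
    unfolding g_def
    by (auto intro!: continuous_at_imp_continuous_on continuous_intros continuous_functionals)
qed

text \<open>Integration by parts and \<open>sum_c'_c\<close> leave a double sum over
  \<open>w\<close> and \<open>w'\<close> with weights
  \<open>sin \<theta> * cos \<theta> * (1 - w \<bullet> w')\<close>, nonnegative on the quarter turn
  and zero on the diagonal. Off the diagonal the other factor is the mean of
  \<open>f * s * s\<close> times the nonnegative gap in \<open>sum_q_le\<close>.\<close>

lemma expectation_g_nonneg:
  assumes "0 \<le> \<theta>" "\<theta> \<le> pi / 2"
  shows "0 \<le> (LINT \<xi>|P. g \<theta> \<xi>)"
proof -
  note [measurable] = borel_measurable_functionals[where z = "\<lambda>\<xi>. Z \<theta> \<xi>" and M = P, OF measurable_Z]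
  let ?E = "\<lambda>w w' i. LINT \<xi>|P. D (Z \<theta> \<xi>) w w' i"
  let ?ip = "\<lambda>w w'. \<Sum>j<n. w j * w' j"
  have sc: "0 \<le> sin \<theta> * cos \<theta>" using assms by (intro mult_nonneg_nonneg sin_ge_zero cos_ge_zero) auto
  have drift: "- ((\<Sum>i<m. (if i < m then 1 else - 1) * a * (b - 1) * E i) + (- 1) * a * (b - 1) * e) =
      a * (1 - b) * ((\<Sum>i<m. E i) - e)" for a b e :: real and E
    by (simp add: sum_distrib_left[symmetric] mult.assoc) (simp add: algebra_simps)
  have split_m: "(\<Sum>i\<le>m. a i) = (\<Sum>i<m. a i) + a m" for a :: "nat \<Rightarrow> real"
    by (simp add: lessThan_Suc_atMost[symmetric])
  have int: "integrable P (\<lambda>\<xi>. \<xi> (i, j) * (f (Z \<theta> \<xi>) * s (Z \<theta> \<xi> w) * q (Z \<theta> \<xi> w) i))"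
    if "w \<in> W" "i \<le> m" "j \<le> n" for w i j
    by (rule integrable_gauss_PiM_component_mult[OF _ _ abs_f_s_q_le]) (use that in auto)
  have intD: "integrable P (\<lambda>\<xi>. D (Z \<theta> \<xi>) w w' i)" if "w \<in> W" "w' \<in> W" for w w' i
    by (rule gauss_PiM.integrable_const_bound[OF AE_I2]) (auto intro!: abs_D_le that)
  have "(LINT \<xi>|P. g \<theta> \<xi>) = - (\<Sum>w\<in>W. \<Sum>i\<le>m. \<Sum>j\<le>n.
      c' w i j \<theta> * (\<Sum>w'\<in>W. c w' i j \<theta> * ?E w w' i))"
  proof -
    let ?h = "\<lambda>w i j \<xi>. c' w i j \<theta> * (\<xi> (i, j) * (f (Z \<theta> \<xi>) * s (Z \<theta> \<xi> w) * q (Z \<theta> \<xi> w) i))"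
    have ih: "integrable P (?h w i j)" if "w \<in> W" "i \<le> m" "j \<le> n" for w i j
      using that by (intro integrable_mult_right int)
    have "(LINT \<xi>|P. (\<Sum>w\<in>W. \<Sum>i\<le>m. \<Sum>j\<le>n. ?h w i j \<xi>)) = (\<Sum>w\<in>W. LINT \<xi>|P. (\<Sum>i\<le>m. \<Sum>j\<le>n. ?h w i j \<xi>))"
      by (intro Bochner_Integration.integral_sum Bochner_Integration.integrable_sum ih) auto
    also have "\<dots> = (\<Sum>w\<in>W. \<Sum>i\<le>m. LINT \<xi>|P. (\<Sum>j\<le>n. ?h w i j \<xi>))"
      by (intro sum.cong refl Bochner_Integration.integral_sum Bochner_Integration.integrable_sum ih) auto
    also have "\<dots> = (\<Sum>w\<in>W. \<Sum>i\<le>m. \<Sum>j\<le>n. LINT \<xi>|P. ?h w i j \<xi>)"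
      by (intro sum.cong refl Bochner_Integration.integral_sum ih) auto
    also have "\<dots> = (\<Sum>w\<in>W. \<Sum>i\<le>m. \<Sum>j\<le>n. c' w i j \<theta> * (\<Sum>w'\<in>W. c w' i j \<theta> * ?E w w' i))"
      by (intro sum.cong refl) (simp add: expectation_ibp)
    finally show ?thesis by (simp add: g_def)
  qed
  \<comment> \<open>Moving the sum over the columns \<open>j\<close> innermost makes the covariances
    of \<open>sum_c'_c\<close> appear.\<close>
  also have "\<dots> = - (\<Sum>w\<in>W. \<Sum>w'\<in>W. \<Sum>i\<le>m. (\<Sum>j\<le>n. c' w i j \<theta> * c w' i j \<theta>) * ?E w w' i)"
    unfolding sum_distrib_left sum_distrib_right
    by (intro arg_cong[where f = uminus] sum.cong refl)
       (simp add: sum.swap[of _ "{..n}" W] sum.swap[of _ "{..m}" W] mult.assoc)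
  also have "\<dots> = (\<Sum>w\<in>W. \<Sum>w'\<in>W. (sin \<theta> * cos \<theta>) * (1 - ?ip w w') *
       ((\<Sum>i<m. ?E w w' i) - ?E w w' m))"
    unfolding sum_c'_c split_m sum_negf[symmetric]
    by (intro sum.cong refl, rule trans[OF _ drift]) simp
  also have "\<dots> \<ge> 0"
  proof (intro sum_nonneg)
    fix w w' assume w: "w \<in> W" "w' \<in> W"
    show "0 \<le> (sin \<theta> * cos \<theta>) * (1 - ?ip w w') * ((\<Sum>i<m. ?E w w' i) - ?E w w' m)"
    proof (cases "w = w'")
      case True
      hence "?ip w w' = 1" using unit_W[OF w(1)] by (simp add: power2_eq_square)
      thus ?thesis by simp
    next
      case False
      have "(\<Sum>i<m. ?E w w' i) - ?E w w' m = (LINT \<xi>|P. (\<Sum>i<m. D (Z \<theta> \<xi>) w w' i) - D (Z \<theta> \<xi>) w w' m)"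
        using intD[OF w] by simp
      also have "\<dots> \<ge> 0"
      proof (rule Bochner_Integration.integral_nonneg)
        fix \<xi>
        let ?z = "Z \<theta> \<xi>"
        have "(\<Sum>i<m. D ?z w w' i) - D ?z w w' m =
            f ?z * s (?z w) * s (?z w') * (\<kappa>\<^sup>2 - (\<Sum>i<m. q (?z w) i * q (?z w') i))"
          using False
          by (simp add: D_def q_def[of _ m] sum_negf sum_distrib_left algebra_simps power2_eq_square)
        also have "\<dots> \<ge> 0"
          using f_pos[of ?z] s_pos[of "?z w"] s_pos[of "?z w'"] sum_q_le by simp
        finally show "0 \<le> (\<Sum>i<m. D ?z w w' i) - D ?z w w' m" .
      qed
      finally show ?thesis
        using inner_le_1[OF w] by (intro mult_nonneg_nonneg[OF mult_nonneg_nonneg[OF sc]]) auto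
    qed
  qed
  finally show ?thesis .
qed

lemma expectation_f_mono: "(LINT \<xi>|P. f (Z 0 \<xi>)) \<le> (LINT \<xi>|P. f (Z (pi / 2) \<xi>))"
proof -
  have mf [measurable]: "(\<lambda>\<xi>. f (Z \<theta> \<xi>)) \<in> borel_measurable P" for \<theta>
    by (rule borel_measurable_functionals, measurable)
  note mg [measurable] = borel_measurable_functionals[where z = "\<lambda>(\<xi>, \<theta>). Z \<theta> \<xi>" and M = "P \<Otimes>\<^sub>M lborel",
      unfolded case_prod_beta, OF measurable_Z'[unfolded case_prod_beta]]
  interpret pair_sigma_finite P lborel by unfold_locales
  define G where "G = (\<lambda>\<xi> \<theta>. indicator {0..pi / 2} \<theta> * g \<theta> \<xi>)"
  \<comment> \<open>\<open>g\<close> is unbounded in \<open>\<xi>\<close>; \<open>h\<close>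
    dominates it for all angles and is integrable, being linear in the absolute values of the
    entries. This justifies Fubini.\<close>
  define h where "h = (\<lambda>\<xi>. \<Sum>w\<in>W. \<Sum>i\<le>m. \<Sum>j\<le>n. (1 + \<bar>w j\<bar>) * (\<bar>\<xi> (i, j)\<bar> * \<kappa>))"
  have mc [measurable]: "c' w i j \<in> borel_measurable borel" for w i j
    unfolding c'_def by measurable
  have mG: "(\<lambda>(\<xi>, \<theta>). G \<xi> \<theta>) \<in> borel_measurable (P \<Otimes>\<^sub>M lborel)"
    unfolding G_def g_def case_prod_beta by measurable
  have inth: "integrable P h"
    unfolding h_def
    by (intro Bochner_Integration.integrable_sum integrable_mult_right integrable_mult_left
        Bochner_Integration.integrable_abs integrable_gauss_PiM_component) auto
  have hbound: "\<bar>g \<theta> \<xi>\<bar> \<le> h \<xi>" for \<theta> \<xi>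
    unfolding g_def h_def abs_minus
    by (intro order_trans[OF sum_abs] sum_mono) (auto simp only: abs_mult[of "c' _ _ _ _"] abs_mult[of "_ (_, _)"]
        intro!: mult_mono mult_nonneg_nonneg abs_ge_zero abs_c_le abs_f_s_q_le)
  have mh [measurable]: "h \<in> borel_measurable P" using inth by auto
  have intB: "integrable (P \<Otimes>\<^sub>M lborel) (\<lambda>(\<xi>, \<theta>). h \<xi> * indicator {0..pi / 2} \<theta>)"
    by (rule Fubini_integrable) (use inth in \<open>auto simp: abs_mult\<close>)
  have intG: "integrable (P \<Otimes>\<^sub>M lborel) (\<lambda>(\<xi>, \<theta>). G \<xi> \<theta>)"
    by (rule Bochner_Integration.integrable_bound[OF intB mG])
       (use hbound in \<open>auto simp: G_def indicator_def intro!: AE_I2 order_trans[OF _ abs_ge_self]\<close>)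
  have FTC: "(LINT \<theta>|lborel. G \<xi> \<theta>) = f (Z (pi / 2) \<xi>) - f (Z 0 \<xi>)" for \<xi>
    unfolding G_def
    using integral_FTC_atLeastAtMost[of 0 "pi / 2" "\<lambda>\<theta>. f (Z \<theta> \<xi>)" "\<lambda>\<theta>. g \<theta> \<xi>"]
      f_Z_has_derivative continuous_on_g
    by (simp add: has_real_derivative_iff_has_vector_derivative)
  have "0 \<le> (LINT \<theta>|lborel. LINT \<xi>|P. G \<xi> \<theta>)"
  proof (rule Bochner_Integration.integral_nonneg)
    show "0 \<le> (LINT \<xi>|P. G \<xi> \<theta>)" for \<theta>
      using expectation_g_nonneg[of \<theta>] by (cases "\<theta> \<in> {0..pi / 2}") (auto simp: G_def)
  qed
  also have "\<dots> = (LINT \<xi>|P. LINT \<theta>|lborel. G \<xi> \<theta>)"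
    by (rule Fubini_integral[OF intG])
  also have "\<dots> = (LINT \<xi>|P. f (Z (pi / 2) \<xi>)) - (LINT \<xi>|P. f (Z 0 \<xi>))"
    unfolding FTC
    by (intro Bochner_Integration.integral_diff gauss_PiM.integrable_const_bound[where B = 1] AE_I2)
       (auto simp: f_le_1 f_pos less_imp_le)
  finally show ?thesis by simp
qed

section \<open>From the smooth functional to probabilities\<close>

lemma Z_0: "i < m \<Longrightarrow> Z 0 \<xi> w i = \<xi> (i, n)" "Z 0 \<xi> w m = (\<Sum>j<n. \<xi> (m, j) * w j)"
  unfolding Z_def lessThan_Suc_atMost[symmetric] by (simp_all add: c_def)

lemma Z_pi_half: "i < m \<Longrightarrow> Z (pi / 2) \<xi> w i = (\<Sum>j<n. \<xi> (i, j) * w j)" "Z (pi / 2) \<xi> w m = \<xi> (m, n)"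
  unfolding Z_def lessThan_Suc_atMost[symmetric] by (simp_all add: c_def)

text \<open>On \<open>E\<close>, at angle \<open>pi / 2\<close>, \<open>1 - f\<close> is at least
  \<open>1 - exp (- 1) \<ge> 1 / 2\<close>, whence the factor 2; off \<open>E'\<close>, at angle 0,
  it is at most \<open>card W * exp (- \<kappa>)\<close>. The shifts of \<open>x\<close> make room
  for this: on \<open>E\<close> some smoothed norm is at most 2, off \<open>E'\<close> every
  exponent is at most \<open>- \<kappa>\<close>.\<close>

lemma prob_escape_le:
  fixes E E'
  defines "E \<equiv> {\<xi> \<in> space P. (\<exists>w\<in>W. (\<Sum>i<m. (\<Sum>j<n. \<xi> (i, j) * w j)\<^sup>2) \<le> 1) \<and> x + 2 \<le> \<xi> (m, n)}"
    and "E' \<equiv> {\<xi> \<in> space P. \<exists>w\<in>W. sqrt (\<Sum>i<m. (\<xi> (i, n))\<^sup>2) + x - 1 \<le> (\<Sum>j<n. \<xi> (m, j) * w j)}"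
  shows "measure P E \<le> 2 * (measure P E' + card W * exp (- \<kappa>))"
proof -
  have mf [measurable]: "(\<lambda>\<xi>. f (Z \<theta> \<xi>)) \<in> borel_measurable P" for \<theta>
    by (rule borel_measurable_functionals, measurable)
  have int: "integrable P (\<lambda>\<xi>. f (Z \<theta> \<xi>))" for \<theta>
    by (rule gauss_PiM.integrable_const_bound[where B = 1, OF AE_I2]) (auto simp: f_le_1 f_pos less_imp_le)
  have E: "E \<in> sets P" unfolding E_def
    by (intro sets.sets_Collect_conj sets.sets_Collect_finite_Ex finite_W) measurable
  have E': "E' \<in> sets P" unfolding E'_def
    by (intro sets.sets_Collect_finite_Ex finite_W) measurable
  have intE: "integrable P (\<lambda>\<xi>. indicator E \<xi> / (2 :: real))"
    using E by (intro gauss_PiM.integrable_const_bound[where B = 1, OF AE_I2]) (auto simp: indicator_def)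
  have intE': "integrable P (indicator E' :: _ \<Rightarrow> real)"
    using E' by (intro gauss_PiM.integrable_const_bound[where B = 1, OF AE_I2]) (auto simp: indicator_def)
  have lower: "indicator E \<xi> / 2 \<le> 1 - f (Z (pi / 2) \<xi>)" for \<xi>
  proof (cases "\<xi> \<in> E")
    case True
    then obtain w where w: "w \<in> W" "(\<Sum>i<m. (Z (pi / 2) \<xi> w i)\<^sup>2) \<le> 1" "x + 2 \<le> Z (pi / 2) \<xi> w m"
      by (auto simp: E_def Z_pi_half)
    have "N (Z (pi / 2) \<xi> w) \<le> sqrt 4" unfolding N_def using w by (intro real_sqrt_le_mono) auto
    hence "1 \<le> s (Z (pi / 2) \<xi> w)"
      unfolding s_def using w \<kappa>_nonneg by (auto intro!: mult_nonneg_nonneg)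
    also have "\<dots> \<le> (\<Sum>w\<in>W. s (Z (pi / 2) \<xi> w))" by (rule s_le_sum[OF w(1)])
    finally have "f (Z (pi / 2) \<xi>) \<le> exp (- 1)" by (simp add: f_def)
    also have "exp (- 1) \<le> (1 / 2 :: real)"
      using exp_ge_add_one_self[of "1 :: real"] by (simp add: exp_minus field_simps)
    finally show ?thesis using True by simp
  qed (use f_le_1 in auto)
  have upper: "1 - f (Z 0 \<xi>) \<le> indicator E' \<xi> + card W * exp (- \<kappa>)" if sp: "\<xi> \<in> space P" for \<xi>
  proof (cases "\<xi> \<in> E'")
    case True
    thus ?thesis using f_pos[of "Z 0 \<xi>"] by (simp add: add_increasing2)
  next
    case False
    have "s (Z 0 \<xi> w) \<le> exp (- \<kappa>)" if w: "w \<in> W" for w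
    proof -
      have "sqrt (\<Sum>i<m. (\<xi> (i, n))\<^sup>2) \<le> N (Z 0 \<xi> w)"
        unfolding N_def by (intro real_sqrt_le_mono) (simp add: Z_0)
      moreover have "Z 0 \<xi> w m < sqrt (\<Sum>i<m. (\<xi> (i, n))\<^sup>2) + x - 1"
        using False w sp by (auto simp: E'_def Z_0 not_le)
      ultimately have "\<kappa> * (Z 0 \<xi> w m - N (Z 0 \<xi> w) - x) \<le> \<kappa> * (- 1)"
        by (intro mult_left_mono \<kappa>_nonneg) linarith
      thus ?thesis by (simp add: s_def)
    qed
    hence "(\<Sum>w\<in>W. s (Z 0 \<xi> w)) \<le> card W * exp (- \<kappa>)"
      by (rule sum_bounded_above)
    moreover have "1 - (\<Sum>w\<in>W. s (Z 0 \<xi> w)) \<le> f (Z 0 \<xi>)"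
      unfolding f_def using exp_ge_add_one_self[of "- (\<Sum>w\<in>W. s (Z 0 \<xi> w))"] by simp
    ultimately show ?thesis using False by simp
  qed
  have "measure P E / 2 = (LINT \<xi>|P. indicator E \<xi> / 2)" using E by simp
  also have "\<dots> \<le> (LINT \<xi>|P. 1 - f (Z (pi / 2) \<xi>))"
    using lower intE int
    by (intro integral_mono Bochner_Integration.integrable_diff) auto
  also have "\<dots> \<le> (LINT \<xi>|P. 1 - f (Z 0 \<xi>))"
    using expectation_f_mono int by simp
  also have "\<dots> \<le> (LINT \<xi>|P. indicator E' \<xi> + card W * exp (- \<kappa>))"
    using upper intE' int
    by (intro integral_mono Bochner_Integration.integrable_diff Bochner_Integration.integrable_add) auto
  also have "\<dots> = measure P E' + card W * exp (- \<kappa>)"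
    using E' intE' prob_space.prob_space[OF prob_space_PiM[OF gauss.prob_space_axioms]] by (subst Bochner_Integration.integral_add) auto
  finally show ?thesis by simp
qed

end

text \<open>Neither event involves \<open>\<kappa>\<close>, so the error term disappears as
  \<open>\<kappa>\<close> tends to infinity, and with it the dependence on the size of
  \<open>W\<close>.\<close>

lemma gaussian_escape:
  fixes W :: "(nat \<Rightarrow> real) set" and m n :: nat and x :: real
  assumes "finite W" "\<And>w. w \<in> W \<Longrightarrow> (\<Sum>j<n. (w j)\<^sup>2) = 1"
  defines "P \<equiv> PiM ({..m} \<times> {..n}) (\<lambda>_. gauss)"
  shows "measure P {\<xi> \<in> space P. (\<exists>w\<in>W. (\<Sum>i<m. (\<Sum>j<n. \<xi> (i, j) * w j)\<^sup>2) \<le> 1) \<and> x + 2 \<le> \<xi> (m, n)}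
    \<le> 2 * measure P {\<xi> \<in> space P. \<exists>w\<in>W. sqrt (\<Sum>i<m. (\<xi> (i, n))\<^sup>2) + x - 1 \<le> (\<Sum>j<n. \<xi> (m, j) * w j)}"
    (is "?L \<le> 2 * ?R")
proof (rule tendsto_lowerbound)
  have "((\<lambda>\<kappa>. exp (- \<kappa>)) \<longlongrightarrow> (0 :: real)) at_top" by real_asymp
  hence "((\<lambda>\<kappa>. 2 * (?R + card W * exp (- \<kappa>))) \<longlongrightarrow> 2 * (?R + real (card W) * 0)) at_top"
    by (intro tendsto_intros)
  thus "((\<lambda>\<kappa>. 2 * (?R + card W * exp (- \<kappa>))) \<longlongrightarrow> 2 * ?R) at_top" by simp
  show "\<forall>\<^sub>F \<kappa> in at_top. ?L \<le> 2 * (?R + card W * exp (- \<kappa>))"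
    using eventually_ge_at_top[of 0]
  proof eventually_elim
    case (elim \<kappa>)
    interpret gaussian_comparison W m n \<kappa> x by standard (use assms elim in auto)
    show ?case using prob_escape_le unfolding P_def by simp
  qed
qed simp

section \<open>Exponential moments\<close>

text \<open>Completing the square: the quadratic tilt gives a multiple of a normal density of
  variance \<open>1 / (1 - 2 * s)\<close>.\<close>

lemma std_normal_density_mult_exp:
  fixes s \<nu> :: real
  assumes s: "s < 1 / 2"
  shows "std_normal_density t * exp (s * (t - \<nu>)\<^sup>2) =
    exp (s * \<nu>\<^sup>2 / (1 - 2 * s)) / sqrt (1 - 2 * s) *
      normal_density (- 2 * s * \<nu> / (1 - 2 * s)) (1 / sqrt (1 - 2 * s)) t"
proof -
  define d where "d = 1 - 2 * s"
  have d: "0 < d" "s = (1 - d) / 2" using s by (auto simp: d_def)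
  have "- t\<^sup>2 / 2 + s * (t - \<nu>)\<^sup>2 = s * \<nu>\<^sup>2 / d - (t - - 2 * s * \<nu> / d)\<^sup>2 / (2 * (1 / sqrt d)\<^sup>2)"
    unfolding d(2) using d(1) by (simp add: power_divide power2_eq_square field_simps)
  hence "exp (- t\<^sup>2 / 2) * exp (s * (t - \<nu>)\<^sup>2) =
      exp (s * \<nu>\<^sup>2 / d) * exp (- (t - - 2 * s * \<nu> / d)\<^sup>2 / (2 * (1 / sqrt d)\<^sup>2))"
    by (simp add: exp_add[symmetric])
  moreover have "1 / sqrt (2 * pi) = 1 / sqrt d * (1 / sqrt (2 * pi * (1 / sqrt d)\<^sup>2))"
    using d by (simp add: power_divide real_sqrt_divide)
  ultimately show ?thesis
    unfolding std_normal_density_def normal_density_def d_def[symmetric] by (simp add: mult_ac)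
qed

lemma has_bochner_integral_gauss_exp_square:
  assumes s: "s < 1 / 2"
  shows "has_bochner_integral gauss (\<lambda>t. exp (s * (t - \<nu>)\<^sup>2))
    (exp (s * \<nu>\<^sup>2 / (1 - 2 * s)) / sqrt (1 - 2 * s))"
proof -
  have "has_bochner_integral lborel
      (\<lambda>t. exp (s * \<nu>\<^sup>2 / (1 - 2 * s)) / sqrt (1 - 2 * s) *
         normal_density (- 2 * s * \<nu> / (1 - 2 * s)) (1 / sqrt (1 - 2 * s)) t)
      (exp (s * \<nu>\<^sup>2 / (1 - 2 * s)) / sqrt (1 - 2 * s) * 1)"
    by (intro has_bochner_integral_mult_right) (use s in \<open>simp add: has_bochner_integral_iff\<close>)
  hence "has_bochner_integral lborel (\<lambda>t. std_normal_density t *\<^sub>R exp (s * (t - \<nu>)\<^sup>2))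
    (exp (s * \<nu>\<^sup>2 / (1 - 2 * s)) / sqrt (1 - 2 * s))"
    by (simp add: std_normal_density_mult_exp[OF s])
  thus ?thesis unfolding gauss_def
    by (intro has_bochner_integral_density) auto
qed

text \<open>Splitting at \<open>\<nu>\<close>: below it the integrand is 1 and yields the mass of a
  half line, above it the tilted normal law has a tail that starts at the standardised threshold
  \<open>y = \<nu> / sqrt (1 - 2 * s)\<close>.\<close>

lemma has_bochner_integral_gauss_exp_pos_square:
  assumes s: "s < 1 / 2" and \<nu>: "0 \<le> \<nu>"
  shows "has_bochner_integral gauss (\<lambda>t. exp (s * (max 0 (t - \<nu>))\<^sup>2))
    (1 / 2 * (exp (s * \<nu>\<^sup>2 / (1 - 2 * s)) / sqrt (1 - 2 * s) * erfc (\<nu> / (sqrt 2 * sqrt (1 - 2 * s)))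
      + erf (\<nu> / sqrt 2) + 1))"
proof -
  define K where "K = exp (s * \<nu>\<^sup>2 / (1 - 2 * s)) / sqrt (1 - 2 * s)"
  define \<mu> where "\<mu> = - 2 * s * \<nu> / (1 - 2 * s)"
  define \<tau> where "\<tau> = 1 / sqrt (1 - 2 * s)"
  define y where "y = \<nu> / sqrt (1 - 2 * s)"
  have \<tau>: "0 < \<tau>" using s by (simp add: \<tau>_def)
  have "\<tau>\<^sup>2 = 1 / (1 - 2 * s)" using s by (simp add: \<tau>_def power_divide)
  hence y\<tau>: "\<nu> - \<mu> = \<tau> * y" using s by (simp add: \<mu>_def y_def \<tau>_def field_simps power2_eq_square)
  have y0: "0 \<le> y" using \<nu> s by (simp add: y_def)
  have i1: "integrable gauss (indicator {..\<nu>} :: real \<Rightarrow> real)"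
    by (rule integrable_gauss_bounded[where B = 1]) (auto simp: indicator_def)
  have i2: "integrable gauss (\<lambda>t. indicator {\<nu><..} t * exp (s * (t - \<nu>)\<^sup>2))"
    using integrable_real_mult_indicator[of "{\<nu><..}" gauss "\<lambda>t. exp (s * (t - \<nu>)\<^sup>2)"]
      has_bochner_integral_gauss_exp_square[OF s, of \<nu>]
    by (simp add: has_bochner_integral_iff mult.commute)
  have pw: "std_normal_density t *\<^sub>R (indicator {\<nu><..} t * exp (s * (t - \<nu>)\<^sup>2)) =
      K * (indicator {\<nu><..} t * normal_density \<mu> \<tau> t)" for t
    using std_normal_density_mult_exp[OF s, of t \<nu>]
    by (auto simp: K_def \<mu>_def \<tau>_def indicator_def)
  have "(LINT t|gauss. indicator {\<nu><..} t * exp (s * (t - \<nu>)\<^sup>2)) =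
      (LBINT t. K * (indicator {\<nu><..} t * normal_density \<mu> \<tau> t))"
    unfolding gauss_def pw[symmetric] by (subst integral_density) auto
  also have "\<dots> = K * (LBINT t. indicator {\<nu><..} t * normal_density \<mu> \<tau> t)" by simp
  also have "(LBINT t. indicator {\<nu><..} t * normal_density \<mu> \<tau> t) =
      \<bar>\<tau>\<bar> *\<^sub>R (LBINT u. indicator {\<nu><..} (\<mu> + \<tau> * u) * normal_density \<mu> \<tau> (\<mu> + \<tau> * u))"
    by (rule lborel_integral_real_affine) (use \<tau> in simp)
  also have "\<dots> = (LBINT u. \<tau> * (indicator {\<nu><..} (\<mu> + \<tau> * u) * normal_density \<mu> \<tau> (\<mu> + \<tau> * u)))"
    using \<tau> by simp
  also have "\<dots> = (LBINT u. std_normal_density u * indicator {y<..} u)"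
  proof (rule Bochner_Integration.integral_cong)
    fix u
    have "\<nu> < \<mu> + \<tau> * u \<longleftrightarrow> y < u" using y\<tau> \<tau> by (smt (verit) mult_less_cancel_left_pos)
    thus "\<tau> * (indicator {\<nu><..} (\<mu> + \<tau> * u) * normal_density \<mu> \<tau> (\<mu> + \<tau> * u)) =
        std_normal_density u * indicator {y<..} u"
      using \<tau> by (simp add: indicator_def normal_density_def real_sqrt_mult power_mult_distrib)
  qed simp
  also have "\<dots> = measure gauss {y<..}"
    using integral_density[of "indicator {y<..} :: real \<Rightarrow> real" lborel std_normal_density]
    unfolding gauss_def by simp
  also have "{y<..} = space gauss - {..y}" by auto
  also have "measure gauss (space gauss - {..y}) = 1 - measure gauss {..y}"
    by (rule gauss.prob_compl) simp
  also have "\<dots> = erfc (y / sqrt 2) / 2"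
    using y0 by (simp add: measure_gauss_atMost erfc_def field_simps)
  finally have 2: "(LINT t|gauss. indicator {\<nu><..} t * exp (s * (t - \<nu>)\<^sup>2)) = K * (erfc (y / sqrt 2) / 2)" .
  have eq: "exp (s * (max 0 (t - \<nu>))\<^sup>2) = indicator {..\<nu>} t + indicator {\<nu><..} t * exp (s * (t - \<nu>)\<^sup>2)" for t
    by (auto simp: indicator_def max_def)
  show ?thesis
    unfolding has_bochner_integral_iff eq
    using i1 i2 2 \<nu> by (simp add: measure_gauss_atMost K_def y_def mult_ac add_divide_distrib)
qed

text \<open>Identifies \<open>w2\<close>, and next \<open>w1_plus\<close>, as exponential moments of
  a single coordinate with \<open>s = c3 / (4 * \<gamma>)\<close>; the condition
  \<open>\<gamma> > c3 / 2\<close> amounts to \<open>s < 1 / 2\<close>. Coordinates on the support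
  may have either sign, hence no positive part in \<open>w2\<close>.\<close>

lemma has_bochner_integral_w2:
  assumes "c3 / 2 < \<gamma>" "0 < \<gamma>"
  shows "has_bochner_integral gauss (\<lambda>t. exp (c3 / (4 * \<gamma>) * (t - \<nu>)\<^sup>2)) (w2 c3 \<nu> \<gamma>)"
  using has_bochner_integral_gauss_exp_square[of "c3 / (4 * \<gamma>)" \<nu>] assms
  by (simp add: w2_def field_simps)

lemma has_bochner_integral_w1:
  assumes "c3 / 2 < \<gamma>" "0 < \<gamma>" "0 \<le> \<nu>"
  shows "has_bochner_integral gauss (\<lambda>t. exp (c3 / (4 * \<gamma>) * (max 0 (t - \<nu>))\<^sup>2)) (w1_plus c3 \<nu> \<gamma>)"
  using has_bochner_integral_gauss_exp_pos_square[of "c3 / (4 * \<gamma>)" \<nu>] assms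
  by (simp add: w1_plus_def field_simps)

lemma has_bochner_integral_PiM_prod:
  fixes F :: "'i \<Rightarrow> real \<Rightarrow> real"
  assumes "finite I" "\<And>i. i \<in> I \<Longrightarrow> has_bochner_integral gauss (F i) (v i)"
  shows "has_bochner_integral (PiM I (\<lambda>_. gauss)) (\<lambda>\<xi>. \<Prod>i\<in>I. F i (\<xi> i)) (\<Prod>i\<in>I. v i)"
  using assms gauss_PiM.product_integrable_prod[of I F] gauss_PiM.product_integral_prod[of I F]
  by (simp add: has_bochner_integral_iff)

text \<open>Duality for the descent cone: the multiplier \<open>\<nu>\<close> belongs to the constraint
  \<open>\<Sum>j. w j \<le> 0\<close>.\<close>

lemma inner_cone_le:
  fixes w h :: "nat \<Rightarrow> real"
  assumes "(\<Sum>j<n. (w j)\<^sup>2) = 1" "(\<Sum>j<n. w j) \<le> 0" "\<And>j. j < n \<Longrightarrow> j \<notin> S \<Longrightarrow> 0 \<le> w j" "0 \<le> \<nu>"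
  shows "(\<Sum>j<n. h j * w j) \<le> sqrt (\<Sum>j<n. if j \<in> S then (h j - \<nu>)\<^sup>2 else (max 0 (h j - \<nu>))\<^sup>2)"
proof -
  let ?v = "\<lambda>j. if j \<in> S then h j - \<nu> else max 0 (h j - \<nu>)"
  have "(\<Sum>j<n. h j * w j) \<le> (\<Sum>j<n. h j * w j) - \<nu> * (\<Sum>j<n. w j)"
    using assms(2,4) by (simp add: mult_nonneg_nonpos)
  also have "\<dots> = (\<Sum>j<n. (h j - \<nu>) * w j)"
    by (simp add: sum_distrib_left sum_subtractf algebra_simps)
  also have "\<dots> \<le> (\<Sum>j<n. ?v j * w j)"
    using assms(3) by (intro sum_mono) (auto intro!: mult_right_mono)
  also have "\<dots> \<le> (\<Sum>j<n. \<bar>?v j\<bar> * \<bar>w j\<bar>)"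
    by (intro sum_mono) (metis abs_ge_self abs_mult)
  also have "\<dots> \<le> L2_set ?v {..<n} * L2_set w {..<n}"
    by (rule L2_set_mult_ineq)
  also have "L2_set w {..<n} = 1" using assms(1) by (simp add: L2_set_def)
  finally show ?thesis by (simp add: L2_set_def if_distrib[of "\<lambda>u. u\<^sup>2"] cong: if_cong)
qed

text \<open>Discretises the radius with step \<open>d\<close>, since \<open>exp (- c * r)\<close> is a convex function of \<open>r\<^sup>2\<close>
  and has no useful Gaussian upper bound on the whole half-line.\<close>

lemma exp_radius_le_gaussian_mixture:
  fixes c d r :: real and \<sigma> :: "nat \<Rightarrow> real"
  assumes "0 \<le> c" "0 < d" "0 \<le> r" "\<And>j. 0 \<le> \<sigma> j"
  shows "exp (- c * r) \<le>
    (\<Sum>j=1..J. exp (- c * (real j - 1) * d + \<sigma> j * (real j * d)\<^sup>2) * exp (- \<sigma> j * r\<^sup>2)) + exp (- c * (real J * d))"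
    (is "_ \<le> (\<Sum>j=1..J. ?t j) + _")
proof (cases "real J * d \<le> r")
  case True
  hence "exp (- c * r) \<le> exp (- c * (real J * d))"
    using assms(1) by (simp add: mult_left_mono)
  moreover have "0 \<le> (\<Sum>j=1..J. ?t j)" by (intro sum_nonneg) simp
  ultimately show ?thesis by linarith
next
  case False
  \<comment> \<open>The radial cell with \<open>(j - 1) * d \<le> r \<le> j * d\<close>. Its left
    end bounds \<open>exp (- c * r)\<close>, its right end makes the factor
    \<open>exp (\<sigma> j * ((j * d)^2 - r^2))\<close> at least 1.\<close>
  define j where "j = nat \<lfloor>r / d\<rfloor> + 1"
  have fl: "real (nat \<lfloor>r / d\<rfloor>) = real_of_int \<lfloor>r / d\<rfloor>" using assms by simp
  have j1: "(real j - 1) * d \<le> r"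
    using of_int_floor_le[of "r / d"] unfolding pos_le_divide_eq[OF assms(2)] fl[symmetric] by (simp add: j_def)
  have j2: "r \<le> real j * d"
    using real_of_int_floor_add_one_ge[of "r / d"] unfolding pos_divide_le_eq[OF assms(2)] fl[symmetric] by (simp add: j_def add.commute)
  have "(real j - 1) * d < real J * d" using j1 False by linarith
  hence "real j - 1 < real J" using assms(2) by simp
  hence J: "j \<in> {1..J}" by (auto simp: j_def)
  have "r\<^sup>2 \<le> (real j * d)\<^sup>2" using j2 assms by (intro power_mono) auto
  hence "\<sigma> j * r\<^sup>2 \<le> \<sigma> j * (real j * d)\<^sup>2" by (intro mult_left_mono assms)
  moreover have "c * ((real j - 1) * d) \<le> c * r" by (intro mult_left_mono j1 assms)
  ultimately have "exp (- c * r) \<le> ?t j" by (simp add: exp_add[symmetric] mult.assoc)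
  also have "\<dots> \<le> (\<Sum>j=1..J. ?t j)" by (rule member_le_sum[OF J]) auto
  finally show ?thesis by (simp add: add_increasing2)
qed

text \<open>Each entry of the array has a factor of its own: those of \<open>h\<close> give
  \<open>w2\<close> or \<open>w1_plus\<close>, those of \<open>g\<close> give
  \<open>1 / sqrt (1 + 2 * \<sigma>)\<close>, all others give 1.\<close>

lemma expectation_exp_quadratic:
  fixes m n :: nat and S :: "nat set" and c3 \<gamma> \<nu> \<sigma> :: real
  assumes "c3 / 2 < \<gamma>" "0 < \<gamma>" "0 \<le> \<nu>" "0 \<le> \<sigma>" "S \<subseteq> {..<n}"
  shows "has_bochner_integral (PiM ({..m} \<times> {..n}) (\<lambda>_. gauss))
    (\<lambda>\<xi>. exp (c3 / (4 * \<gamma>) * (\<Sum>j<n. if j \<in> S then (\<xi> (m, j) - \<nu>)\<^sup>2 else (max 0 (\<xi> (m, j) - \<nu>))\<^sup>2))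
       * exp (- \<sigma> * (\<Sum>i<m. (\<xi> (i, n))\<^sup>2)))
    (w2 c3 \<nu> \<gamma> ^ card S * w1_plus c3 \<nu> \<gamma> ^ (n - card S) * (1 / sqrt (1 + 2 * \<sigma>)) ^ m)"
proof -
  define h where "h = (\<lambda>j t. if j \<in> S then exp (c3 / (4 * \<gamma>) * (t - \<nu>)\<^sup>2) else exp (c3 / (4 * \<gamma>) * (max 0 (t - \<nu>))\<^sup>2))"
  define F where "F = (\<lambda>(i, j) t. if i < m then if j = n then exp (- \<sigma> * t\<^sup>2) else 1
      else if j < n then h j t else (1 :: real))"
  define v where "v = (\<lambda>(i, j). if i < m then if j = n then 1 / sqrt (1 + 2 * \<sigma>) else 1
      else if j < n then if j \<in> S then w2 c3 \<nu> \<gamma> else w1_plus c3 \<nu> \<gamma> else (1 :: real))"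
  have one: "has_bochner_integral gauss (\<lambda>_. 1) (1 :: real)"
    using gauss.prob_space by (simp add: has_bochner_integral_iff)
  have hb: "has_bochner_integral gauss (F p) (v p)" for p
    using has_bochner_integral_gauss_exp_square[of "- \<sigma>" 0] one assms(4)
      has_bochner_integral_w1[OF assms(1-3)] has_bochner_integral_w2[OF assms(1,2), of \<nu>]
    by (cases p) (auto simp: F_def v_def h_def)
  have split: "(\<Prod>p\<in>{..m} \<times> {..n}. u p) = (\<Prod>j<n. u (m, j)) * (\<Prod>i<m. u (i, n))"
    if "\<And>i j. i < m \<Longrightarrow> j < n \<Longrightarrow> u (i, j) = 1" "u (m, n) = 1" for u :: "nat \<times> nat \<Rightarrow> real"
    using that unfolding prod.cartesian_product[symmetric, of "\<lambda>i j. u (i, j)", simplified] lessThan_Suc_atMost[symmetric]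
    by (simp add: mult.commute)
  have "(\<Prod>p\<in>{..m} \<times> {..n}. v p) = (\<Prod>j<n. v (m, j)) * (\<Prod>i<m. v (i, n))"
    by (rule split) (auto simp: v_def)
  also have "(\<Prod>j<n. v (m, j)) = (\<Prod>j\<in>S. w2 c3 \<nu> \<gamma>) * (\<Prod>j\<in>{..<n} - S. w1_plus c3 \<nu> \<gamma>)"
  proof -
    have "S \<inter> {..<n} = S" "{..<n} \<inter> S = S" "{..<n} \<inter> - S = {..<n} - S" using assms(5) by auto
    thus ?thesis by (simp add: v_def prod.If_cases)
  qed
  also have "\<dots> = w2 c3 \<nu> \<gamma> ^ card S * w1_plus c3 \<nu> \<gamma> ^ (n - card S)"
    using assms(5) by (simp add: card_Diff_subset finite_subset)
  also have "(\<Prod>i<m. v (i, n)) = (1 / sqrt (1 + 2 * \<sigma>)) ^ m"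
    by (simp add: v_def)
  finally have V: "(\<Prod>p\<in>{..m} \<times> {..n}. v p) =
      w2 c3 \<nu> \<gamma> ^ card S * w1_plus c3 \<nu> \<gamma> ^ (n - card S) * (1 / sqrt (1 + 2 * \<sigma>)) ^ m" .
  have Fx: "(\<Prod>p\<in>{..m} \<times> {..n}. F p (\<xi> p)) =
      exp (c3 / (4 * \<gamma>) * (\<Sum>j<n. if j \<in> S then (\<xi> (m, j) - \<nu>)\<^sup>2 else (max 0 (\<xi> (m, j) - \<nu>))\<^sup>2))
       * exp (- \<sigma> * (\<Sum>i<m. (\<xi> (i, n))\<^sup>2))" for \<xi>
  proof -
    have "(\<Prod>p\<in>{..m} \<times> {..n}. F p (\<xi> p)) = (\<Prod>j<n. F (m, j) (\<xi> (m, j))) * (\<Prod>i<m. F (i, n) (\<xi> (i, n)))"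
      by (rule split) (auto simp: F_def)
    also have "(\<Prod>i<m. F (i, n) (\<xi> (i, n))) = exp (- \<sigma> * (\<Sum>i<m. (\<xi> (i, n))\<^sup>2))"
      by (simp add: F_def sum_distrib_left exp_sum)
    also have "(\<Prod>j<n. F (m, j) (\<xi> (m, j))) =
        exp (c3 / (4 * \<gamma>) * (\<Sum>j<n. if j \<in> S then (\<xi> (m, j) - \<nu>)\<^sup>2 else (max 0 (\<xi> (m, j) - \<nu>))\<^sup>2))"
      unfolding sum_distrib_left
      by (subst exp_sum) (auto simp: F_def h_def intro!: prod.cong)
    finally show ?thesis .
  qed
  show ?thesis
    using has_bochner_integral_PiM_prod[of "{..m} \<times> {..n}" F v] hb by (simp add: Fx V)
qed

text \<open>Chernoff's method at rate \<open>c3 * sqrt n\<close>, which puts every exponent on the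
  scale of \<open>n\<close>. The bound on \<open>h \<bullet> w\<close> by duality no longer depends
  on \<open>w\<close>, so no union bound over \<open>W\<close> is paid.\<close>

lemma prob_width_le:
  fixes m n J :: nat and S :: "nat set" and W :: "(nat \<Rightarrow> real) set" and c3 \<gamma> \<nu> \<delta> x :: real
  assumes W: "finite W" "\<And>w. w \<in> W \<Longrightarrow> (\<Sum>j<n. (w j)\<^sup>2) = 1" "\<And>w. w \<in> W \<Longrightarrow> (\<Sum>j<n. w j) \<le> 0"
      "\<And>w j. w \<in> W \<Longrightarrow> j < n \<Longrightarrow> j \<notin> S \<Longrightarrow> 0 \<le> w j"
    and par: "0 < c3" "c3 / 2 < \<gamma>" "0 \<le> \<nu>" "0 < \<delta>" "0 < n" "S \<subseteq> {..<n}"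
  defines "P \<equiv> PiM ({..m} \<times> {..n}) (\<lambda>_. gauss)"
  shows "measure P {\<xi> \<in> space P. \<exists>w\<in>W. sqrt (\<Sum>i<m. (\<xi> (i, n))\<^sup>2) + x - 1 \<le> (\<Sum>j<n. \<xi> (m, j) * w j)}
    \<le> exp (- c3 * sqrt n * (x - 1)) * exp (c3 * \<gamma> * n) *
       (w2 c3 \<nu> \<gamma> ^ card S * w1_plus c3 \<nu> \<gamma> ^ (n - card S)) *
       ((\<Sum>j=1..J. exp (n * (c3 * \<delta> - c3 * (real j * \<delta>) / 2)) * (1 / sqrt (1 + c3 / (real j * \<delta>))) ^ m)
         + exp (- (real n * (c3 * (real J * \<delta>)))))"
    (is "measure P ?E \<le> ?C * ?D * ?w * ?B")
proof -
  have \<gamma>: "0 < \<gamma>" using par by linarith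
  define c d where "c = c3 * sqrt n" and "d = \<delta> * sqrt n"
  \<comment> \<open>Seen as a function of \<open>r^2\<close>, \<open>- c * r\<close> has slope
    \<open>- \<sigma> j\<close> at \<open>r = j * d\<close>. This makes
    \<open>\<sigma> j * (j * d)^2\<close> equal to half of \<open>c * (j * d)\<close>.\<close>
  define \<sigma> where "\<sigma> = (\<lambda>j :: nat. c3 / (2 * (real j * \<delta>)))"
  have \<sigma>: "0 \<le> \<sigma> j" for j using par by (simp add: \<sigma>_def)
  have cd: "0 \<le> c" "0 < d" using par by (auto simp: c_def d_def)
  define Q where "Q = (\<lambda>\<xi> :: nat \<times> nat \<Rightarrow> real. \<Sum>j<n. if j \<in> S then (\<xi> (m, j) - \<nu>)\<^sup>2 else (max 0 (\<xi> (m, j) - \<nu>))\<^sup>2)"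
  define R where "R = (\<lambda>\<xi> :: nat \<times> nat \<Rightarrow> real. \<Sum>i<m. (\<xi> (i, n))\<^sup>2)"
  define e where "e = (\<lambda>j :: nat. exp (- c * (real j - 1) * d + \<sigma> j * (real j * d)\<^sup>2))"
  \<comment> \<open>The idle factor \<open>exp (- 0 * R \<xi>)\<close> gives the tail term the shape
    of the others, with \<open>\<sigma> = 0\<close>.\<close>
  define T where "T = (\<lambda>\<xi>. ?C * ?D * ((\<Sum>j=1..J. e j * (exp (c3 / (4 * \<gamma>) * Q \<xi>) * exp (- \<sigma> j * R \<xi>)))
      + exp (- c * (real J * d)) * (exp (c3 / (4 * \<gamma>) * Q \<xi>) * exp (- 0 * R \<xi>))))"
  have R0: "0 \<le> R \<xi>" for \<xi> by (simp add: R_def sum_nonneg)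
  have Q0: "0 \<le> Q \<xi>" for \<xi> by (simp add: Q_def sum_nonneg)
  have T0: "0 \<le> T \<xi>" for \<xi>
    unfolding T_def by (intro mult_nonneg_nonneg add_nonneg_nonneg sum_nonneg) (auto simp: e_def)
  have ET: "has_bochner_integral P T (?C * ?D * ((\<Sum>j=1..J. e j * (?w * (1 / sqrt (1 + 2 * \<sigma> j)) ^ m))
      + exp (- c * (real J * d)) * (?w * (1 / sqrt (1 + 2 * 0)) ^ m)))"
    unfolding T_def P_def Q_def R_def
    by (intro has_bochner_integral_mult_right has_bochner_integral_add has_bochner_integral_sum
        expectation_exp_quadratic par \<gamma> \<sigma>) auto
  have E: "?E \<in> sets P" unfolding P_def
    by (intro sets.sets_Collect_finite_Ex W) measurable
  have pw: "indicator ?E \<xi> \<le> T \<xi>" for \<xi>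
  proof (cases "\<xi> \<in> ?E")
    case True
    then obtain w where w: "w \<in> W" "sqrt (R \<xi>) + x - 1 \<le> (\<Sum>j<n. \<xi> (m, j) * w j)"
      by (auto simp: R_def)
    have "(\<Sum>j<n. \<xi> (m, j) * w j) \<le> sqrt (Q \<xi>)"
      unfolding Q_def by (rule inner_cone_le) (use W w(1) par in auto)
    \<comment> \<open>Arithmetic-geometric mean inequality with free parameter
      \<open>\<gamma>\<close>: the root is traded for \<open>Q\<close>, whose exponential
      factorises.\<close>
    also have "\<dots> \<le> \<gamma> * sqrt n + Q \<xi> / (4 * \<gamma> * sqrt n)"
    proof -
      define a where "a = \<gamma> * sqrt n"
      have a: "0 < a" using \<gamma> par(5) by (simp add: a_def)
      have "0 \<le> (sqrt (Q \<xi>) - 2 * a)\<^sup>2" by simp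
      hence "sqrt (Q \<xi>) * (4 * a) \<le> Q \<xi> + 4 * a\<^sup>2"
        using Q0 by (simp add: power2_diff)
      hence "sqrt (Q \<xi>) \<le> a + Q \<xi> / (4 * a)" using a by (simp add: field_simps power2_eq_square)
      thus ?thesis by (simp add: a_def mult.assoc)
    qed
    finally have "sqrt (R \<xi>) + x - 1 \<le> \<gamma> * sqrt n + Q \<xi> / (4 * \<gamma> * sqrt n)" using w(2) by linarith
    hence "c * (sqrt (R \<xi>) + x - 1) \<le> c * (\<gamma> * sqrt n + Q \<xi> / (4 * \<gamma> * sqrt n))"
      by (intro mult_left_mono cd)
    also have "\<dots> = c3 * \<gamma> * n + c3 / (4 * \<gamma>) * Q \<xi>"
      using par(5) \<gamma> by (simp add: c_def field_simps)
    finally have "1 \<le> exp (- c * (x - 1) + c3 * \<gamma> * n + c3 / (4 * \<gamma>) * Q \<xi> + - c * sqrt (R \<xi>))"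
      by (simp add: algebra_simps)
    also have "\<dots> = ?C * ?D * (exp (c3 / (4 * \<gamma>) * Q \<xi>) * exp (- c * sqrt (R \<xi>)))"
      by (simp only: exp_add c_def) simp
    also have "exp (- c * sqrt (R \<xi>)) \<le> (\<Sum>j=1..J. e j * exp (- \<sigma> j * R \<xi>)) + exp (- c * (real J * d))"
      using exp_radius_le_gaussian_mixture[where J = J and \<sigma> = \<sigma>, OF cd real_sqrt_ge_zero[OF R0[of \<xi>]] \<sigma>] R0[of \<xi>]
      by (simp add: e_def)
    hence "?C * ?D * (exp (c3 / (4 * \<gamma>) * Q \<xi>) * exp (- c * sqrt (R \<xi>))) \<le>
        ?C * ?D * (exp (c3 / (4 * \<gamma>) * Q \<xi>) * ((\<Sum>j=1..J. e j * exp (- \<sigma> j * R \<xi>)) + exp (- c * (real J * d))))"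
      by (intro mult_left_mono) auto
    also have "\<dots> = T \<xi>"
      unfolding T_def by (simp add: distrib_left sum_distrib_left mult_ac)
    finally show ?thesis using True by simp
  qed (use T0 in auto)
  have "measure P ?E = (LINT \<xi>|P. indicator ?E \<xi>)" using E by simp
  also have "\<dots> \<le> (LINT \<xi>|P. T \<xi>)"
  proof (rule integral_mono)
    show "integrable P (indicator ?E :: _ \<Rightarrow> real)"
      using E unfolding P_def
      by (intro gauss_PiM.integrable_const_bound[where B = 1, OF AE_I2]) (auto simp: indicator_def)
    show "integrable P T" using ET by (simp add: has_bochner_integral_iff)
  qed (use pw in auto)
  also have "\<dots> = ?C * ?D * ((\<Sum>j=1..J. e j * (?w * (1 / sqrt (1 + 2 * \<sigma> j)) ^ m))
      + exp (- c * (real J * d)) * ?w)"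
    using ET by (simp add: has_bochner_integral_iff)
  also have "\<dots> = ?C * ?D * ?w * ((\<Sum>j=1..J. e j * (1 / sqrt (1 + 2 * \<sigma> j)) ^ m) + exp (- c * (real J * d)))"
    by (simp add: distrib_left sum_distrib_left mult_ac)
  also have "(\<Sum>j=1..J. e j * (1 / sqrt (1 + 2 * \<sigma> j)) ^ m) =
      (\<Sum>j=1..J. exp (n * (c3 * \<delta> - c3 * (real j * \<delta>) / 2)) * (1 / sqrt (1 + c3 / (real j * \<delta>))) ^ m)"
  proof (intro sum.cong refl)
    fix j assume "j \<in> {1..J}"
    hence j: "0 < real j * \<delta>" using par by auto
    have "- c * (real j - 1) * d + \<sigma> j * (real j * d)\<^sup>2 = (sqrt n * sqrt n) * (c3 * \<delta> - c3 * (real j * \<delta>) / 2)"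
      using j par(4) by (simp add: c_def d_def \<sigma>_def field_simps power2_eq_square)
    thus "e j * (1 / sqrt (1 + 2 * \<sigma> j)) ^ m =
        exp (n * (c3 * \<delta> - c3 * (real j * \<delta>) / 2)) * (1 / sqrt (1 + c3 / (real j * \<delta>))) ^ m"
      by (simp add: e_def \<sigma>_def)
  qed
  also have "- c * (real J * d) = - (real n * (c3 * (real J * \<delta>)))"
  proof -
    have "- c * (real J * d) = - (sqrt n * sqrt n) * (c3 * (real J * \<delta>))" by (simp add: c_def d_def)
    thus ?thesis by simp
  qed
  finally show ?thesis .
qed

text \<open>The density on the unit interval above \<open>y\<close> is at least its value at
  \<open>y + 1\<close>. The shift costs a factor exponential in \<open>y\<close> only, which is
  harmless for \<open>y\<close> of order \<open>sqrt n\<close>.\<close>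

lemma measure_gauss_atLeast_ge:
  assumes "0 \<le> y"
  shows "exp (- (y + 1)\<^sup>2 / 2) / sqrt (2 * pi) \<le> measure gauss {y..}"
proof -
  have "exp (- (y + 1)\<^sup>2 / 2) / sqrt (2 * pi) = (LBINT t. indicator {y..y + 1} t * (exp (- (y + 1)\<^sup>2 / 2) / sqrt (2 * pi)))"
    by simp
  also have "\<dots> \<le> (LBINT t. std_normal_density t * indicator {y..y + 1} t)"
  proof (rule integral_mono)
    show "integrable lborel (\<lambda>t. std_normal_density t * indicator {y..y + 1} t)"
      by (rule integrable_real_mult_indicator) auto
    show "indicator {y..y + 1} t * (exp (- (y + 1)\<^sup>2 / 2) / sqrt (2 * pi)) \<le> std_normal_density t * indicator {y..y + 1} t" for t
      using assms by (auto simp: indicator_def std_normal_density_def divide_simps intro!: power_mono)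
  qed simp
  also have "\<dots> = measure gauss {y..y + 1}"
    using integral_density[of "indicator {y..y + 1} :: real \<Rightarrow> real" lborel std_normal_density]
    unfolding gauss_def by simp
  also have "\<dots> \<le> measure gauss {y..}"
    by (rule gauss.finite_measure_mono) auto
  finally show ?thesis .
qed

section \<open>Kernel vectors in the descent cone\<close>

text \<open>The slack 1 in place of an exact kernel vector lets a finite net stand for the cone; it
  only shifts the level \<open>x\<close> by a constant.\<close>

definition kernel_event :: "nat \<Rightarrow> nat \<Rightarrow> (nat \<Rightarrow> real) set \<Rightarrow> (nat \<times> nat \<Rightarrow> real) \<Rightarrow> bool" where
  "kernel_event m n W \<xi> \<longleftrightarrow> (\<exists>w\<in>W. (\<Sum>i<m. (\<Sum>j<n. \<xi> (i, j) * w j)\<^sup>2) \<le> 1)"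

lemma sets_kernel_event:
  assumes "finite W"
  shows "{\<xi> \<in> space (PiM I (\<lambda>_. gauss)). kernel_event m n W \<xi>} \<in> sets (PiM I (\<lambda>_. gauss))"
  unfolding kernel_event_def by (intro sets.sets_Collect_finite_Ex assms) measurable

lemma kernel_event_cong:
  assumes "\<And>i j. i < m \<Longrightarrow> j < n \<Longrightarrow> \<xi> (i, j) = \<xi>' (i, j)"
  shows "kernel_event m n W \<xi> \<longleftrightarrow> kernel_event m n W \<xi>'"
proof -
  have "(\<Sum>i<m. (\<Sum>j<n. \<xi> (i, j) * w j)\<^sup>2) = (\<Sum>i<m. (\<Sum>j<n. \<xi>' (i, j) * w j)\<^sup>2)" for w
    by (intro sum.cong refl arg_cong[where f = "\<lambda>u. u\<^sup>2"]) (auto simp: assms)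
  thus ?thesis by (simp add: kernel_event_def)
qed

text \<open>The corner entry is independent of the block that holds \<open>A\<close>; the rest of
  row \<open>m\<close> and column \<open>n\<close> is integrated out.\<close>

lemma prob_kernel_event_times:
  fixes W :: "(nat \<Rightarrow> real) set" and m n :: nat
  assumes W: "finite W"
  defines "P \<equiv> PiM ({..m} \<times> {..n}) (\<lambda>_. gauss)"
    and "P0 \<equiv> PiM ({..<m} \<times> {..<n}) (\<lambda>_. gauss)"
  shows "measure P {\<xi> \<in> space P. kernel_event m n W \<xi> \<and> y \<le> \<xi> (m, n)} =
    measure P0 {\<xi> \<in> space P0. kernel_event m n W \<xi>} * measure gauss {y..}"
proof -
  define I where "I = {..m} \<times> {..n} - {(m, n)}"
  define Q where "Q = PiM I (\<lambda>_. gauss)"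
  have I: "finite I" "(m, n) \<notin> I" "insert (m, n) I = {..m} \<times> {..n}" by (auto simp: I_def)
  have sub: "{..<m} \<times> {..<n} \<subseteq> I" by (auto simp: I_def)
  let ?E = "{\<xi> \<in> space P. kernel_event m n W \<xi> \<and> y \<le> \<xi> (m, n)}"
  let ?F = "{\<xi> \<in> space Q. kernel_event m n W \<xi>}"
  let ?G = "{\<xi> \<in> space P0. kernel_event m n W \<xi>}"
  have E: "?E \<in> sets P"
    unfolding P_def by (intro sets.sets_Collect_conj sets_kernel_event W) measurable
  have F: "?F \<in> sets Q" unfolding Q_def by (rule sets_kernel_event[OF W])
  have G: "?G \<in> sets P0" unfolding P0_def by (rule sets_kernel_event[OF W])
  have "emeasure P ?E = (\<integral>\<^sup>+ \<xi>. indicator ?E \<xi> \<partial>P)" using E by simp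
  also have "\<dots> = (\<integral>\<^sup>+ \<xi>. (\<integral>\<^sup>+ t. indicator ?E (\<xi>((m, n) := t)) \<partial>gauss) \<partial>Q)"
    using gauss_PiM.product_nn_integral_insert[OF I(1,2), of "indicator ?E"] E
    by (simp add: I(3) P_def Q_def)
  also have "\<dots> = (\<integral>\<^sup>+ \<xi>. (\<integral>\<^sup>+ t. indicator ?F \<xi> * indicator {y..} t \<partial>gauss) \<partial>Q)"
  proof (intro nn_integral_cong)
    fix \<xi> :: "nat \<times> nat \<Rightarrow> real" and t assume "\<xi> \<in> space Q"
    moreover from this have "\<xi>((m, n) := t) \<in> space P"
      by (auto simp: P_def Q_def space_PiM I(3)[symmetric] PiE_def extensional_def)
    moreover have "kernel_event m n W (\<xi>((m, n) := t)) \<longleftrightarrow> kernel_event m n W \<xi>"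
      by (rule kernel_event_cong) auto
    ultimately show "(indicator ?E (\<xi>((m, n) := t)) :: ennreal) = indicator ?F \<xi> * indicator {y..} t"
      by (auto simp: indicator_def)
  qed
  also have "\<dots> = emeasure Q ?F * emeasure gauss {y..}"
    using F by (simp add: nn_integral_cmult_indicator nn_integral_multc)
  also have "emeasure Q ?F = emeasure P0 ?G"
  proof -
    have "emeasure P0 ?G = emeasure (distr Q P0 (\<lambda>\<xi>. restrict \<xi> ({..<m} \<times> {..<n}))) ?G"
      using gauss_PiM.distr_restrict[OF sub I(1)] by (simp add: P0_def Q_def)
    also have "\<dots> = emeasure Q ((\<lambda>\<xi>. restrict \<xi> ({..<m} \<times> {..<n})) -` ?G \<inter> space Q)"
      using sub by (intro emeasure_distr G) (auto simp: P0_def Q_def intro!: measurable_restrict_subset)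
    also have "(\<lambda>\<xi>. restrict \<xi> ({..<m} \<times> {..<n})) -` ?G \<inter> space Q = ?F"
    proof -
      have "kernel_event m n W (restrict \<xi> ({..<m} \<times> {..<n})) \<longleftrightarrow> kernel_event m n W \<xi>" for \<xi>
        by (rule kernel_event_cong) auto
      thus ?thesis by (auto simp: P0_def Q_def space_PiM)
    qed
    finally show ?thesis ..
  qed
  finally show ?thesis by (simp add: measure_def enn2real_mult)
qed

text \<open>With \<open>x = c = c3 * sqrt n\<close>, dividing by the tail of \<open>g0\<close>
  contributes \<open>(c + 3)^2 / 2\<close> and Chernoff \<open>- c * (c - 1)\<close>; the sum
  \<open>- c^2 / 2 + 4 * c + 9 / 2\<close> explains the constants. \<open>\<iota>\<close> bounds the
  exponents of all radial cells, with \<open>b = j * \<delta>\<close>, and of the tail beyond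
  them.\<close>

lemma prob_kernel_event_le:
  fixes m n J :: nat and S :: "nat set" and W :: "(nat \<Rightarrow> real) set" and c3 \<gamma> \<nu> \<delta> \<alpha> \<iota> :: real
  assumes W: "finite W" "\<And>w. w \<in> W \<Longrightarrow> (\<Sum>j<n. (w j)\<^sup>2) = 1" "\<And>w. w \<in> W \<Longrightarrow> (\<Sum>j<n. w j) \<le> 0"
      "\<And>w j. w \<in> W \<Longrightarrow> j < n \<Longrightarrow> j \<notin> S \<Longrightarrow> 0 \<le> w j"
    and par: "0 < c3" "c3 / 2 < \<gamma>" "0 \<le> \<nu>" "0 < \<delta>" "0 < n" "S \<subseteq> {..<n}"
    and sph: "real m = \<alpha> * real n" "\<And>b. 0 < b \<Longrightarrow> - c3 * b / 2 - \<alpha> / 2 * ln (1 + c3 / b) \<le> \<iota>"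
      "- (c3 * (real J * \<delta>)) \<le> \<iota>"
  defines "P0 \<equiv> PiM ({..<m} \<times> {..<n}) (\<lambda>_. gauss)"
  shows "measure P0 {\<xi> \<in> space P0. kernel_event m n W \<xi>}
    \<le> 2 * sqrt (2 * pi) * (real J + 1) * exp (9 / 2 + 4 * c3 * sqrt n) *
       exp (n * (- c3\<^sup>2 / 2 + \<iota> + c3 * \<delta> + c3 * \<gamma>)) *
       (w2 c3 \<nu> \<gamma> ^ card S * w1_plus c3 \<nu> \<gamma> ^ (n - card S))"
proof -
  define P where "P = PiM ({..m} \<times> {..n}) (\<lambda>_. gauss)"
  define c where "c = c3 * sqrt n"
  have c: "0 < c" "c\<^sup>2 = n * c3\<^sup>2" using par by (auto simp: c_def power_mult_distrib)
  let ?p = "measure P0 {\<xi> \<in> space P0. kernel_event m n W \<xi>}"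
  let ?w = "w2 c3 \<nu> \<gamma> ^ card S * w1_plus c3 \<nu> \<gamma> ^ (n - card S)"
  let ?B = "(\<Sum>j=1..J. exp (n * (c3 * \<delta> - c3 * (real j * \<delta>) / 2)) * (1 / sqrt (1 + c3 / (real j * \<delta>))) ^ m)
         + exp (- (real n * (c3 * (real J * \<delta>))))"
  have w: "0 \<le> ?w"
  proof -
    have "0 < \<gamma>" using par by linarith
    hence "0 \<le> w1_plus c3 \<nu> \<gamma>"
      using has_bochner_integral_integral_eq[OF has_bochner_integral_w1[of c3 \<gamma> \<nu>]] par
      by (metis Bochner_Integration.integral_nonneg exp_ge_zero)
    moreover have "0 \<le> w2 c3 \<nu> \<gamma>" using par by (simp add: w2_def)
    ultimately show ?thesis by simp
  qed
  have B: "?B \<le> (real J + 1) * exp (n * (\<iota> + c3 * \<delta>))"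
  proof -
    have "exp (n * (c3 * \<delta> - c3 * (real j * \<delta>) / 2)) * (1 / sqrt (1 + c3 / (real j * \<delta>))) ^ m
        \<le> exp (n * (\<iota> + c3 * \<delta>))" if "j \<in> {1..J}" for j
    proof -
      define b where "b = real j * \<delta>"
      have b: "0 < b" using that par by (auto simp: b_def)
      have pos: "0 < 1 + c3 / b" using b par by (simp add: add_pos_pos)
      have "1 / sqrt (1 + c3 / b) = exp (- ln (1 + c3 / b) / 2)"
        using pos by (simp add: exp_minus ln_sqrt[symmetric] inverse_eq_divide)
      hence "exp (n * (c3 * \<delta> - c3 * b / 2)) * (1 / sqrt (1 + c3 / b)) ^ m =
          exp (n * (c3 * \<delta> + (- c3 * b / 2 - \<alpha> / 2 * ln (1 + c3 / b))))"
        by (simp add: exp_of_nat_mult[symmetric] exp_add[symmetric] sph(1) algebra_simps)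
      also have "\<dots> \<le> exp (n * (\<iota> + c3 * \<delta>))"
        using sph(2)[OF b] by (auto intro!: mult_left_mono)
      finally show ?thesis by (simp add: b_def)
    qed
    hence "(\<Sum>j=1..J. exp (n * (c3 * \<delta> - c3 * (real j * \<delta>) / 2)) * (1 / sqrt (1 + c3 / (real j * \<delta>))) ^ m)
        \<le> real (card {1..J}) * exp (n * (\<iota> + c3 * \<delta>))"
      by (intro sum_bounded_above) auto
    moreover have "exp (- (real n * (c3 * (real J * \<delta>)))) \<le> exp (n * (\<iota> + c3 * \<delta>))"
    proof -
      have "- (c3 * (real J * \<delta>)) \<le> \<iota> + c3 * \<delta>" using sph(3) par by (simp add: add_increasing2)
      hence "n * - (c3 * (real J * \<delta>)) \<le> n * (\<iota> + c3 * \<delta>)" by (intro mult_left_mono) auto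
      thus ?thesis by simp
    qed
    ultimately have "?B \<le> real (card {1..J}) * exp (n * (\<iota> + c3 * \<delta>)) + exp (n * (\<iota> + c3 * \<delta>))"
      by (rule add_mono)
    thus ?thesis by (simp add: distrib_right)
  qed
  have "?p * (exp (- (c + 2 + 1)\<^sup>2 / 2) / sqrt (2 * pi)) \<le> ?p * measure gauss {c + 2..}"
    using c by (intro mult_left_mono measure_gauss_atLeast_ge) auto
  also have "\<dots> = measure P {\<xi> \<in> space P. kernel_event m n W \<xi> \<and> c + 2 \<le> \<xi> (m, n)}"
    unfolding P_def P0_def by (rule prob_kernel_event_times[OF W(1), symmetric])
  also have "\<dots> \<le> 2 * measure P {\<xi> \<in> space P. \<exists>w\<in>W. sqrt (\<Sum>i<m. (\<xi> (i, n))\<^sup>2) + c - 1 \<le> (\<Sum>j<n. \<xi> (m, j) * w j)}"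
    unfolding P_def kernel_event_def by (rule gaussian_escape[OF W(1,2)])
  also have "\<dots> \<le> 2 * (exp (- c3 * sqrt n * (c - 1)) * exp (c3 * \<gamma> * n) * ?w * ?B)"
  proof (rule mult_left_mono)
    show "measure P {\<xi> \<in> space P. \<exists>w\<in>W. sqrt (\<Sum>i<m. (\<xi> (i, n))\<^sup>2) + c - 1 \<le> (\<Sum>j<n. \<xi> (m, j) * w j)}
        \<le> exp (- c3 * sqrt n * (c - 1)) * exp (c3 * \<gamma> * n) * ?w * ?B"
      unfolding P_def by (rule prob_width_le) (use W par in auto)
  qed simp
  also have "\<dots> \<le> 2 * (exp (- c3 * sqrt n * (c - 1)) * exp (c3 * \<gamma> * n) * ?w * ((real J + 1) * exp (n * (\<iota> + c3 * \<delta>))))"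
    by (intro mult_left_mono B mult_nonneg_nonneg[OF _ w]) auto
  finally have "?p \<le> 2 * (exp (- c3 * sqrt n * (c - 1)) * exp (c3 * \<gamma> * n) * ?w * ((real J + 1) * exp (n * (\<iota> + c3 * \<delta>))))
      * (sqrt (2 * pi) * exp ((c + 2 + 1)\<^sup>2 / 2))"
    by (simp add: exp_minus field_simps)
  also have "\<dots> = 2 * sqrt (2 * pi) * (real J + 1) *
      (exp (- c3 * sqrt n * (c - 1)) * exp (c3 * \<gamma> * n) * exp (n * (\<iota> + c3 * \<delta>)) * exp ((c + 2 + 1)\<^sup>2 / 2)) * ?w"
    by (simp only: mult_ac)
  also have "exp (- c3 * sqrt n * (c - 1)) * exp (c3 * \<gamma> * n) * exp (n * (\<iota> + c3 * \<delta>)) * exp ((c + 2 + 1)\<^sup>2 / 2) =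
      exp (9 / 2 + 4 * c3 * sqrt n) * exp (n * (- c3\<^sup>2 / 2 + \<iota> + c3 * \<delta> + c3 * \<gamma>))"
  proof -
    have "- c3 * sqrt n * (c - 1) + c3 * \<gamma> * n + n * (\<iota> + c3 * \<delta>) + (c + 2 + 1)\<^sup>2 / 2 =
        9 / 2 + 4 * c - c\<^sup>2 / 2 + n * (\<iota> + c3 * \<delta> + c3 * \<gamma>)"
      by (simp add: c_def[symmetric] power2_eq_square algebra_simps)
    also have "\<dots> = 9 / 2 + 4 * c3 * sqrt n + n * (- c3\<^sup>2 / 2 + \<iota> + c3 * \<delta> + c3 * \<gamma>)"
      unfolding c(2) by (simp add: c_def algebra_simps)
    finally show ?thesis by (simp add: exp_add[symmetric])
  qed
  finally show ?thesis by (simp only: mult.assoc)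
qed

text \<open>Rounding the coordinates to a grid sorts \<open>C\<close> into finitely many cells, and
  one point is kept from each occupied cell. Choosing it in \<open>C\<close> keeps the cone
  constraints exact.\<close>

lemma finite_sup_norm_net:
  fixes C :: "(nat \<Rightarrow> real) set"
  assumes \<epsilon>: "0 < \<epsilon>" and bd: "\<And>w j. w \<in> C \<Longrightarrow> j < n \<Longrightarrow> \<bar>w j\<bar> \<le> 1"
  shows "\<exists>W\<subseteq>C. finite W \<and> (\<forall>w\<in>C. \<exists>w'\<in>W. \<forall>j<n. \<bar>w' j - w j\<bar> \<le> \<epsilon>)"
proof -
  define cell where "cell = (\<lambda>w :: nat \<Rightarrow> real. \<lambda>j\<in>{..<n}. \<lfloor>w j / \<epsilon>\<rfloor>)"
  have "cell ` C \<subseteq> PiE {..<n} (\<lambda>_. {\<lfloor>- 1 / \<epsilon>\<rfloor>..\<lfloor>1 / \<epsilon>\<rfloor>})"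
  proof (intro image_subsetI PiE_I)
    fix w j assume w: "w \<in> C" "j \<in> {..<n}"
    have "- 1 / \<epsilon> \<le> w j / \<epsilon>" "w j / \<epsilon> \<le> 1 / \<epsilon>"
      by (rule divide_right_mono; use bd[of w j] w \<epsilon> in \<open>simp add: abs_le_iff\<close>)+
    thus "cell w j \<in> {\<lfloor>- 1 / \<epsilon>\<rfloor>..\<lfloor>1 / \<epsilon>\<rfloor>}"
      using w(2) by (auto simp: cell_def intro!: floor_mono)
  qed (auto simp: cell_def)
  hence "finite (cell ` C)"
    by (rule finite_subset) (intro finite_PiE, auto)
  then obtain W where W: "W \<subseteq> C" "finite W" "cell ` C = cell ` W"
    using finite_subset_image[of "cell ` C" cell C] by blast
  have "\<exists>w'\<in>W. \<forall>j<n. \<bar>w' j - w j\<bar> \<le> \<epsilon>" if w: "w \<in> C" for w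
  proof -
    have "cell w \<in> cell ` W" using W(3) w by blast
    then obtain w' where w': "w' \<in> W" "cell w' = cell w" by auto
    have "\<bar>w' j - w j\<bar> \<le> \<epsilon>" if "j < n" for j
    proof -
      have "\<lfloor>w' j / \<epsilon>\<rfloor> = \<lfloor>w j / \<epsilon>\<rfloor>" using fun_cong[OF w'(2), of j] that by (simp add: cell_def)
      hence "\<bar>w' j / \<epsilon> - w j / \<epsilon>\<bar> \<le> 1" by linarith
      hence "\<bar>(w' j - w j) / \<epsilon>\<bar> \<le> 1" by (simp add: diff_divide_distrib)
      thus ?thesis using \<epsilon> by (simp add: abs_divide divide_le_eq)
    qed
    thus ?thesis using w'(1) by auto
  qed
  thus ?thesis using W by auto
qed

section \<open>Failure of recovery and kernel vectors\<close>

definition descent_cone :: "nat \<Rightarrow> nat set \<Rightarrow> (nat \<Rightarrow> real) set" where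
  "descent_cone n S = {w. (\<Sum>j<n. (w j)\<^sup>2) = 1 \<and> (\<Sum>j<n. w j) \<le> 0 \<and> (\<forall>j<n. j \<notin> S \<longrightarrow> 0 \<le> w j)}"

lemma descent_cone_abs_le: "w \<in> descent_cone n S \<Longrightarrow> j < n \<Longrightarrow> \<bar>w j\<bar> \<le> 1"
proof -
  assume "w \<in> descent_cone n S" "j < n"
  hence "(w j)\<^sup>2 \<le> 1"
    using member_le_sum[of j "{..<n}" "\<lambda>j. (w j)\<^sup>2"] by (auto simp: descent_cone_def)
  thus ?thesis by (simp add: abs_square_le_1)
qed

text \<open>Whether \<open>x\<close> fails to be minimal or has a rival minimiser, there is a
  feasible \<open>z \<noteq> x\<close> of no larger norm, and \<open>w\<close> is
  \<open>z - x\<close> normalised. On nonnegative vectors the norm is the coordinate sum, and off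
  the support the difference is just \<open>z\<close>.\<close>

lemma failure_imp_kernel_vector:
  fixes A :: "real Matrix.mat" and x :: "real Matrix.vec"
  assumes A: "A \<in> carrier_mat m n" and x: "x \<in> carrier_vec n" "0\<^sub>v n \<le> x"
    and fail: "l1_solutions_plus A (A *\<^sub>v x) \<noteq> {x}"
  shows "\<exists>w\<in>descent_cone n {j. j < n \<and> vec_index x j \<noteq> 0}. \<forall>i<m. (\<Sum>j<n. A $$ (i, j) * w j) = 0"
proof -
  have fx: "x \<in> feasible_plus A (A *\<^sub>v x)" using A x by (auto simp: feasible_plus_def)
  have "\<exists>z\<in>feasible_plus A (A *\<^sub>v x). z \<noteq> x \<and> l1_norm z \<le> l1_norm x"
  proof (cases "x \<in> l1_solutions_plus A (A *\<^sub>v x)")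
    case True
    then obtain z where "z \<in> l1_solutions_plus A (A *\<^sub>v x)" "z \<noteq> x" using fail by auto
    thus ?thesis using fx by (auto simp: l1_solutions_plus_def is_arg_min_linorder)
  next
    case False
    thus ?thesis using fx by (force simp: l1_solutions_plus_def is_arg_min_def)
  qed
  then obtain z where z: "z \<in> feasible_plus A (A *\<^sub>v x)" "z \<noteq> x" "l1_norm z \<le> l1_norm x" by auto
  have zc: "z \<in> carrier_vec n" "A *\<^sub>v z = A *\<^sub>v x" "0\<^sub>v n \<le> z"
    using z(1) A by (auto simp: feasible_plus_def)
  have nn: "0 \<le> vec_index z j" "0 \<le> vec_index x j" if "j < n" for j
    using zc x that by (auto simp: less_eq_vec_def)
  define d where "d j = vec_index z j - vec_index x j" for j
  define r where "r = sqrt (\<Sum>j<n. (d j)\<^sup>2)"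
  have "\<exists>j<n. d j \<noteq> 0"
    using z(2) zc(1) x(1) by (auto simp: d_def intro!: eq_vecI)
  then obtain j0 where j0: "j0 < n" "d j0 \<noteq> 0" by auto
  hence "0 < (\<Sum>j<n. (d j)\<^sup>2)" by (intro sum_pos2[of _ j0]) auto
  hence r: "0 < r" "r\<^sup>2 = (\<Sum>j<n. (d j)\<^sup>2)" by (auto simp: r_def)
  have "(\<Sum>j<n. d j) = l1_norm z - l1_norm x"
    using zc(1) x(1) nn by (simp add: l1_norm_def d_def sum_subtractf)
  hence d0: "(\<Sum>j<n. d j) \<le> 0" using z(3) by simp
  have "(\<Sum>j<n. A $$ (i, j) * d j) = 0" if "i < m" for i
  proof -
    have "vec_index (A *\<^sub>v z) i = vec_index (A *\<^sub>v x) i" using zc(2) by simp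
    thus ?thesis
      using that A zc(1) x(1)
      by (simp add: scalar_prod_def d_def right_diff_distrib sum_subtractf atLeast0LessThan)
  qed
  hence ker: "(\<Sum>j<n. A $$ (i, j) * (d j / r)) = 0" if "i < m" for i
    using that by (simp add: sum_divide_distrib[symmetric])
  have cone: "(\<lambda>j. d j / r) \<in> descent_cone n {j. j < n \<and> vec_index x j \<noteq> 0}"
    using r d0 nn
    by (auto simp: descent_cone_def power_divide sum_divide_distrib[symmetric] divide_le_0_iff d_def)
  show ?thesis
  proof (rule bexI[OF _ cone])
    show "\<forall>i<m. (\<Sum>j<n. A $$ (i, j) * (\<lambda>j. d j / r) j) = 0" using ker by blast
  qed
qed

lemma kernel_event_of_net:
  assumes C: "w \<in> C" "\<And>i. i < m \<Longrightarrow> (\<Sum>j<n. \<xi> (i, j) * w j) = 0"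
    and K: "\<And>i j. i < m \<Longrightarrow> j < n \<Longrightarrow> \<bar>\<xi> (i, j)\<bar> \<le> K" "0 \<le> K"
    and net: "w' \<in> W" "\<And>j. j < n \<Longrightarrow> \<bar>w' j - w j\<bar> \<le> 1 / ((real m + 1) * (real n + 1) * (K + 1))"
  shows "kernel_event m n W \<xi>"
proof -
  \<comment> \<open>The mesh makes every row of the product at most \<open>1 / (m + 1)\<close> in
    size, so that the \<open>m\<close> squares sum to at most 1.\<close>
  define \<epsilon> where "\<epsilon> = 1 / ((real m + 1) * (real n + 1) * (K + 1))"
  have \<epsilon>: "0 < \<epsilon>" using K(2) by (simp add: \<epsilon>_def)
  have "\<bar>\<Sum>j<n. \<xi> (i, j) * w' j\<bar> \<le> 1 / (real m + 1)" if i: "i < m" for i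
  proof -
    have "(\<Sum>j<n. \<xi> (i, j) * w' j) = (\<Sum>j<n. \<xi> (i, j) * (w' j - w j))"
      using C(2)[OF i] by (simp add: right_diff_distrib sum_subtractf)
    also have "\<bar>\<dots>\<bar> \<le> (\<Sum>j<n. K * \<epsilon>)"
    proof (rule order_trans[OF sum_abs], rule sum_mono)
      fix j assume "j \<in> {..<n}"
      thus "\<bar>\<xi> (i, j) * (w' j - w j)\<bar> \<le> K * \<epsilon>"
        unfolding abs_mult \<epsilon>_def by (intro mult_mono K(1)[OF i] net(2) K(2)) auto
    qed
    also have "\<dots> = real n * (K * \<epsilon>)" by simp
    also have "\<dots> \<le> (real n + 1) * ((K + 1) * \<epsilon>)"
      using K(2) \<epsilon> by (intro mult_mono) auto
    also have "\<dots> = 1 / (real m + 1)" using K(2) by (simp add: \<epsilon>_def divide_simps)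
    finally show ?thesis .
  qed
  hence "(\<Sum>i<m. (\<Sum>j<n. \<xi> (i, j) * w' j)\<^sup>2) \<le> (\<Sum>i<m. (1 / (real m + 1))\<^sup>2)"
    by (intro sum_mono abs_le_square_iff[THEN iffD1]) auto
  also have "\<dots> = real m / (real m + 1)\<^sup>2" by (simp add: power_divide)
  also have "\<dots> \<le> 1"
  proof -
    have "real m \<le> (real m + 1)\<^sup>2" by (simp add: power2_eq_square algebra_simps)
    thus ?thesis by simp
  qed
  finally show ?thesis using net(1) by (auto simp: kernel_event_def)
qed

text \<open>Transfers the question from an arbitrary probability space to the product of Gaussians:
  independence and marginals determine the joint law. Positive dimensions keep the index set
  nonempty, as that characterisation demands.\<close>

lemma distr_gaussian_entries:
  assumes G: "std_gaussian_matrix M m n A" and mn: "0 < m" "0 < n"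
  shows "(\<lambda>\<omega>. \<lambda>rc\<in>{..<m} \<times> {..<n}. A \<omega> $$ rc) \<in> measurable M (PiM ({..<m} \<times> {..<n}) (\<lambda>_. gauss))"
    "distr M (PiM ({..<m} \<times> {..<n}) (\<lambda>_. gauss)) (\<lambda>\<omega>. \<lambda>rc\<in>{..<m} \<times> {..<n}. A \<omega> $$ rc) =
      PiM ({..<m} \<times> {..<n}) (\<lambda>_. gauss)"
proof -
  let ?I = "{..<m} \<times> {..<n}"
  interpret prob_space M using G by (simp add: std_gaussian_matrix_def)
  have ind: "indep_vars (\<lambda>_. borel) (\<lambda>rc \<omega>. A \<omega> $$ rc) ?I"
    using G by (simp add: std_gaussian_matrix_def)
  have dist: "distributed M lborel (\<lambda>\<omega>. A \<omega> $$ rc) (\<lambda>t. ennreal (std_normal_density t))" if "rc \<in> ?I" for rc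
    using G that unfolding std_gaussian_matrix_def by blast
  have meas: "(\<lambda>\<omega>. A \<omega> $$ rc) \<in> borel_measurable M" if "rc \<in> ?I" for rc
    using distributed_measurable[OF dist[OF that]] by simp
  have marg: "distr M borel (\<lambda>\<omega>. A \<omega> $$ rc) = gauss" if "rc \<in> ?I" for rc
  proof -
    have "distr M borel (\<lambda>\<omega>. A \<omega> $$ rc) = distr M lborel (\<lambda>\<omega>. A \<omega> $$ rc)"
      by (intro distr_cong) auto
    also have "\<dots> = gauss"
      using distributed_distr_eq_density[OF dist[OF that]] by (simp add: gauss_def)
    finally show ?thesis .
  qed
  have sets: "sets (PiM ?I (\<lambda>_. gauss)) = sets (PiM ?I (\<lambda>_. borel))"
    by (intro sets_PiM_cong) auto
  show "(\<lambda>\<omega>. \<lambda>rc\<in>?I. A \<omega> $$ rc) \<in> measurable M (PiM ?I (\<lambda>_. gauss))"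
    using meas by (intro measurable_restrict) (simp cong: measurable_cong_sets)
  have "distr M (PiM ?I (\<lambda>_. gauss)) (\<lambda>\<omega>. \<lambda>rc\<in>?I. A \<omega> $$ rc) =
      distr M (PiM ?I (\<lambda>_. borel)) (\<lambda>\<omega>. \<lambda>rc\<in>?I. A \<omega> $$ rc)"
    by (intro distr_cong sets) auto
  also have "\<dots> = PiM ?I (\<lambda>rc. distr M borel (\<lambda>\<omega>. A \<omega> $$ rc))"
    using ind meas mn by (subst (asm) indep_vars_iff_distr_eq_PiM') auto
  also have "\<dots> = PiM ?I (\<lambda>_. gauss)"
    by (intro PiM_cong marg refl)
  finally show "distr M (PiM ?I (\<lambda>_. gauss)) (\<lambda>\<omega>. \<lambda>rc\<in>?I. A \<omega> $$ rc) = PiM ?I (\<lambda>_. gauss)" .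
qed

text \<open>For fixed dimensions the entries of the matrix are bounded by some \<open>K\<close> with probability tending
  to 1, so that an arbitrarily fine finite net of the descent cone costs nothing in the limit.\<close>

lemma P_err_plus_le:
  assumes G: "std_gaussian_matrix M m n A" and mn: "0 < m" "0 < n"
    and x: "x \<in> carrier_vec n" "0\<^sub>v n \<le> x"
    and b: "\<And>W. finite W \<Longrightarrow> W \<subseteq> descent_cone n {j. j < n \<and> vec_index x j \<noteq> 0} \<Longrightarrow>
      measure (PiM ({..<m} \<times> {..<n}) (\<lambda>_. gauss))
        {\<xi> \<in> space (PiM ({..<m} \<times> {..<n}) (\<lambda>_. gauss)). kernel_event m n W \<xi>} \<le> b"
  shows "P_err_plus M A x \<le> b"
proof -
  let ?I = "{..<m} \<times> {..<n}" and ?S = "{j. j < n \<and> vec_index x j \<noteq> 0}"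
  let ?P0 = "PiM ?I (\<lambda>_. gauss)" and ?X = "\<lambda>\<omega>. \<lambda>rc\<in>?I. A \<omega> $$ rc"
  interpret prob_space M using G by (simp add: std_gaussian_matrix_def)
  note X = distr_gaussian_entries[OF G mn]
  define F where "F = {\<omega> \<in> space M. l1_solutions_plus (A \<omega>) (A \<omega> *\<^sub>v x) \<noteq> {x}}"
  \<comment> \<open>The exceptional event that some entry exceeds \<open>K\<close>; off it a single
    mesh serves all matrices.\<close>
  define L where "L = (\<lambda>K :: nat. {\<omega> \<in> space M. \<exists>rc\<in>?I. real K < \<bar>?X \<omega> rc\<bar>})"
  have A: "A \<omega> \<in> carrier_mat m n" if "\<omega> \<in> space M" for \<omega>
    using G that by (simp add: std_gaussian_matrix_def)
  have b0: "0 \<le> b" using b[of "{}"] measure_nonneg[of ?P0] by (meson empty_subsetI finite.emptyI order_trans)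
  have [measurable]: "(\<lambda>\<omega>. ?X \<omega> rc) \<in> borel_measurable M" for rc
    using measurable_compose[OF X(1) measurable_gauss_component[of rc ?I]] .
  have L: "L K \<in> sets M" for K
    unfolding L_def
  proof (rule sets.sets_Collect_finite_Ex)
    show "{\<omega> \<in> space M. real K < \<bar>?X \<omega> rc\<bar>} \<in> sets M" for rc by measurable
  qed simp
  have step: "prob F \<le> b + prob (L K)" if F: "F \<in> sets M" for K :: nat
  proof -
    define \<epsilon> where "\<epsilon> = 1 / ((real m + 1) * (real n + 1) * (real K + 1))"
    have "0 < \<epsilon>" by (simp add: \<epsilon>_def)
    hence "\<exists>W\<subseteq>descent_cone n ?S. finite W \<and> (\<forall>w\<in>descent_cone n ?S. \<exists>w'\<in>W. \<forall>j<n. \<bar>w' j - w j\<bar> \<le> \<epsilon>)"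
      by (rule finite_sup_norm_net) (rule descent_cone_abs_le)
    then obtain W where W: "W \<subseteq> descent_cone n ?S" "finite W"
      and net: "\<And>w. w \<in> descent_cone n ?S \<Longrightarrow> \<exists>w'\<in>W. \<forall>j<n. \<bar>w' j - w j\<bar> \<le> \<epsilon>"
      by auto
    define E where "E = ?X -` {\<xi> \<in> space ?P0. kernel_event m n W \<xi>} \<inter> space M"
    have E: "E \<in> sets M"
      unfolding E_def using X(1) sets_kernel_event[OF W(2)] by (rule measurable_sets)
    have "F \<subseteq> E \<union> L K"
    proof
      fix \<omega> assume \<omega>: "\<omega> \<in> F"
      hence sp: "\<omega> \<in> space M" by (simp add: F_def)
      show "\<omega> \<in> E \<union> L K"
      proof (rule UnCI)
        assume nL: "\<omega> \<notin> L K"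
        obtain w where w: "w \<in> descent_cone n ?S" "\<And>i. i < m \<Longrightarrow> (\<Sum>j<n. A \<omega> $$ (i, j) * w j) = 0"
          using failure_imp_kernel_vector[OF A[OF sp] x] \<omega> by (auto simp: F_def)
        obtain w' where w': "w' \<in> W" "\<And>j. j < n \<Longrightarrow> \<bar>w' j - w j\<bar> \<le> \<epsilon>" using net[OF w(1)] by auto
        have "kernel_event m n W (?X \<omega>)"
        proof (rule kernel_event_of_net)
          show "\<bar>?X \<omega> (i, j)\<bar> \<le> real K" if "i < m" "j < n" for i j
            using nL sp that by (force simp: L_def)
          show "(\<Sum>j<n. ?X \<omega> (i, j) * w j) = 0" if "i < m" for i
            using w(2)[OF that] that by simp
        qed (use w' w in \<open>auto simp: \<epsilon>_def\<close>)
        thus "\<omega> \<in> E" using sp measurable_space[OF X(1) sp] by (simp add: E_def)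
      qed
    qed
    hence "prob F \<le> prob (E \<union> L K)" using E L by (intro finite_measure_mono) auto
    also have "\<dots> \<le> prob E + prob (L K)" by (intro measure_subadditive E L) (auto simp: emeasure_eq_measure)
    also have "prob E = measure (distr M ?P0 ?X) {\<xi> \<in> space ?P0. kernel_event m n W \<xi>}"
      unfolding E_def using X(1) sets_kernel_event[OF W(2)] by (rule measure_distr[symmetric])
    also have "\<dots> \<le> b" unfolding X(2) by (rule b[OF W(2,1)])
    finally show ?thesis by simp
  qed
  show ?thesis
  proof (cases "F \<in> sets M")
    \<comment> \<open>\<open>measure\<close> is 0 on sets outside the sigma-algebra, so the claim
      reduces to \<open>0 \<le> b\<close>.\<close>
    case False
    thus ?thesis using b0 by (simp add: P_err_plus_def F_def[symmetric] measure_notin_sets)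
  next
    case True
    have "(\<Inter>K. L K) = {}"
    proof (rule ccontr)
      assume "(\<Inter>K. L K) \<noteq> {}"
      then obtain \<omega> where \<omega>: "\<And>K. \<omega> \<in> L K" by auto
      obtain K :: nat where K: "(\<Sum>rc\<in>?I. \<bar>?X \<omega> rc\<bar>) < real K" using reals_Archimedean2 by blast
      obtain rc where rc: "rc \<in> ?I" "real K < \<bar>?X \<omega> rc\<bar>" using \<omega>[of K] by (auto simp: L_def)
      have "\<bar>?X \<omega> rc\<bar> \<le> (\<Sum>rc\<in>?I. \<bar>?X \<omega> rc\<bar>)" by (rule member_le_sum[OF rc(1)]) auto
      thus False using K rc(2) by simp
    qed
    moreover have "(\<lambda>K. prob (L K)) \<longlonglongrightarrow> prob (\<Inter>K. L K)"
    proof (rule finite_Lim_measure_decseq)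
      show "decseq L"
      proof (rule decseq_SucI, rule subsetI)
        fix K \<omega> assume "\<omega> \<in> L (Suc K)"
        then obtain rc where "\<omega> \<in> space M" "rc \<in> ?I" "real (Suc K) < \<bar>?X \<omega> rc\<bar>" unfolding L_def by blast
        moreover from this have "real K < \<bar>?X \<omega> rc\<bar>" by linarith
        ultimately show "\<omega> \<in> L K" unfolding L_def by blast
      qed
    qed (use L in auto)
    ultimately have "(\<lambda>K. b + prob (L K)) \<longlonglongrightarrow> b + 0"
      by (intro tendsto_intros) simp
    hence "prob F \<le> b + 0"
      by (rule tendsto_lowerbound) (use step[OF True] in auto)
    thus ?thesis by (simp add: P_err_plus_def F_def)
  qed
qed

section \<open>The optimal parameters\<close>

text \<open>The classical lower bound for Mills' ratio, rescaled by \<open>sqrt 2\<close>. The right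
  side minus the left has a negative derivative and limit 0 at infinity, so it is
  nonnegative.\<close>

lemma mills_ratio_lower:
  "2 / sqrt pi * (x * exp (- (x\<^sup>2)) / (1 + 2 * x\<^sup>2)) \<le> erfc x"
proof -
  define g where "g = (\<lambda>x. erfc x - 2 / sqrt pi * (x * exp (- (x\<^sup>2)) / (1 + 2 * x\<^sup>2)))"
  have pos: "1 + 2 * y\<^sup>2 \<noteq> 0" for y :: real using zero_le_power2[of y] by linarith
  have Dg: "(g has_real_derivative (- 2 / sqrt pi * exp (- (y\<^sup>2)) * (2 / (1 + 2 * y\<^sup>2)\<^sup>2))) (at y)" for y
  proof -
    have "((\<lambda>x. erfc x) has_real_derivative - (2 / sqrt pi * exp (- (y\<^sup>2)))) (at y)"
      unfolding erfc_def by (auto intro!: derivative_eq_intros erf_has_derivative)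
    moreover have "((\<lambda>x. x * exp (- (x\<^sup>2)) / (1 + 2 * x\<^sup>2)) has_real_derivative
        ((exp (- (y\<^sup>2)) - 2 * y\<^sup>2 * exp (- (y\<^sup>2))) * (1 + 2 * y\<^sup>2) - y * exp (- (y\<^sup>2)) * (4 * y)) / ((1 + 2 * y\<^sup>2) * (1 + 2 * y\<^sup>2))) (at y)"
      by (auto intro!: derivative_eq_intros simp: pos[unfolded power2_eq_square] power2_eq_square)
    ultimately have D: "(g has_real_derivative - (2 / sqrt pi * exp (- (y\<^sup>2))) - 2 / sqrt pi *
        (((exp (- (y\<^sup>2)) - 2 * y\<^sup>2 * exp (- (y\<^sup>2))) * (1 + 2 * y\<^sup>2) - y * exp (- (y\<^sup>2)) * (4 * y)) / ((1 + 2 * y\<^sup>2) * (1 + 2 * y\<^sup>2)))) (at y)"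
      unfolding g_def by (intro DERIV_diff DERIV_cmult)
    have num: "(1 - 2 * y\<^sup>2) * (1 + 2 * y\<^sup>2) - 4 * y\<^sup>2 = 2 - (1 + 2 * y\<^sup>2)\<^sup>2"
      by (simp add: power2_eq_square algebra_simps)
    have "1 + (((1 - 2 * y\<^sup>2) * (1 + 2 * y\<^sup>2) - 4 * y\<^sup>2) / (1 + 2 * y\<^sup>2)\<^sup>2) = 2 / (1 + 2 * y\<^sup>2)\<^sup>2"
      unfolding num using pos[of y] by (simp add: diff_divide_distrib)
    hence "- 2 / sqrt pi * exp (- (y\<^sup>2)) * (2 / (1 + 2 * y\<^sup>2)\<^sup>2) =
          - 2 / sqrt pi * exp (- (y\<^sup>2)) * (1 + (((1 - 2 * y\<^sup>2) * (1 + 2 * y\<^sup>2) - 4 * y\<^sup>2) / (1 + 2 * y\<^sup>2)\<^sup>2))"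
        by simp
      also have "\<dots> = - (2 / sqrt pi * exp (- (y\<^sup>2))) - 2 / sqrt pi *
        (((exp (- (y\<^sup>2)) - 2 * y\<^sup>2 * exp (- (y\<^sup>2))) * (1 + 2 * y\<^sup>2) - y * exp (- (y\<^sup>2)) * (4 * y)) / ((1 + 2 * y\<^sup>2) * (1 + 2 * y\<^sup>2)))"
        by (simp add: power2_eq_square algebra_simps diff_divide_distrib add_divide_distrib)
    finally show ?thesis by (rule DERIV_cong[OF D sym])
  qed
  have dec: "g y \<le> g x" if "x \<le> y" for x y
    by (rule DERIV_nonpos_imp_nonincreasing[OF that], intro exI conjI, rule Dg) simp
  have "((\<lambda>x. x * exp (- (x\<^sup>2)) / (1 + 2 * x\<^sup>2)) \<longlongrightarrow> (0 :: real)) at_top" by real_asymp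
  hence "(g \<longlongrightarrow> (1 - 1) - 2 / sqrt pi * 0) at_top"
    unfolding g_def erfc_def by (intro tendsto_intros erf_at_top)
  hence "(g \<longlongrightarrow> 0) at_top" by simp
  hence "0 \<le> g x"
    by (rule tendsto_upperbound) (auto intro!: eventually_mono[OF eventually_ge_at_top[of x]] dec)
  thus ?thesis by (simp add: g_def)
qed

text \<open>The derivative is a positive multiple of the gap in \<open>mills_ratio_lower\<close>.
  The defining equations of \<open>\<beta>w\<close> and \<open>\<beta>0\<close> fix the values of
  this function at the two \<open>erfinv\<close> points, so it compares them.\<close>

lemma erfc_ratio_mono:
  assumes "x \<le> y"
  shows "x * erfc x * exp (x\<^sup>2) \<le> y * erfc y * exp (y\<^sup>2)"
proof (rule DERIV_nonneg_imp_nondecreasing[OF assms], intro exI conjI)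
  fix z
  show "((\<lambda>x. x * erfc x * exp (x\<^sup>2)) has_real_derivative
      exp (z\<^sup>2) * ((1 + 2 * z\<^sup>2) * erfc z - 2 / sqrt pi * (z * exp (- (z\<^sup>2))))) (at z)"
    unfolding erfc_def
    by (auto intro!: derivative_eq_intros erf_has_derivative simp: algebra_simps power2_eq_square)
  have "1 + 2 * z\<^sup>2 > 0" using zero_le_power2[of z] by linarith
  hence "2 / sqrt pi * (z * exp (- (z\<^sup>2))) \<le> (1 + 2 * z\<^sup>2) * erfc z"
    using mult_left_mono[OF mills_ratio_lower[of z], of "1 + 2 * z\<^sup>2"] by simp
  thus "0 \<le> exp (z\<^sup>2) * ((1 + 2 * z\<^sup>2) * erfc z - 2 / sqrt pi * (z * exp (- (z\<^sup>2))))" by simp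
qed

text \<open>The terms in \<open>2 / sqrt pi * exp (- z^2)\<close> cancel in the derivative. If
  \<open>xi_plus \<alpha> b = 1\<close>, the value at \<open>erfinv (erfinv_arg \<alpha> b)\<close>
  is \<open>2 * b / (1 - b)\<close>, free of \<open>\<alpha>\<close>.\<close>

lemma mills_excess_antimono:
  assumes "0 < x" "x < y"
  shows "exp (- (y\<^sup>2)) / (sqrt pi * y) - erfc y < exp (- (x\<^sup>2)) / (sqrt pi * x) - erfc x"
proof (rule DERIV_neg_imp_decreasing[OF assms(2)], intro exI conjI)
  fix z assume "x \<le> z" "z \<le> y"
  hence z: "0 < z" using assms by simp
  define k where "k = sqrt pi"
  have k: "k \<noteq> 0" by (simp add: k_def)
  note D = erf_has_derivative[folded k_def]
  show "((\<lambda>x. exp (- (x\<^sup>2)) / (sqrt pi * x) - erfc x) has_real_derivative - exp (- (z\<^sup>2)) / (sqrt pi * z\<^sup>2)) (at z)"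
    unfolding erfc_def k_def[symmetric] using z k
    by (auto intro!: derivative_eq_intros D simp: field_simps power2_eq_square)
  show "- exp (- (z\<^sup>2)) / (sqrt pi * z\<^sup>2) < 0" using z by simp
qed

lemma erf_le_iff: "erf x \<le> erf y \<longleftrightarrow> x \<le> y"
  using erf_strict_mono[of x y] erf_strict_mono[of y x] by (cases x y rule: linorder_cases) auto

section \<open>The defining equations of \<beta>w and \<beta>0\<close>

lemma erfinv_arg_props:
  assumes "\<alpha> < 1" "2 * \<alpha> - 1 < b" "b < \<alpha>"
  shows "0 < erfinv (erfinv_arg \<alpha> b)" "erf (erfinv (erfinv_arg \<alpha> b)) = erfinv_arg \<alpha> b"
    "erfc (erfinv (erfinv_arg \<alpha> b)) = 2 * (\<alpha> - b) / (1 - b)"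
proof -
  have a: "0 < erfinv_arg \<alpha> b" "erfinv_arg \<alpha> b < 1" using assms by (auto simp: field_simps)
  show "0 < erfinv (erfinv_arg \<alpha> b)" by (rule erfinv_pos[OF a])
  show 1: "erf (erfinv (erfinv_arg \<alpha> b)) = erfinv_arg \<alpha> b" using a by (intro erf_erfinv) auto
  show "erfc (erfinv (erfinv_arg \<alpha> b)) = 2 * (\<alpha> - b) / (1 - b)"
    unfolding erfc_def 1 using assms by (simp add: field_simps)
qed

lemma xi_plus_eq: "xi_plus \<alpha> b = (1 - b) * exp (- ((erfinv (erfinv_arg \<alpha> b))\<^sup>2)) / (2 * sqrt pi * \<alpha> * erfinv (erfinv_arg \<alpha> b))"
  by (simp add: xi_plus_def real_sqrt_divide real_sqrt_mult)

lemma exp_square_eq: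
  fixes e \<alpha> u t :: real
  assumes "t * (u * exp (- (e\<^sup>2)) / (2 * sqrt pi * \<alpha> * e)) = 1" "0 < \<alpha>" "0 < e"
  shows "exp (e\<^sup>2) = t * u / (2 * sqrt pi * \<alpha> * e)"
  using assms by (simp add: exp_minus field_simps)

text \<open>Raising \<open>\<alpha>w\<close> to \<open>\<alpha>\<close> lowers the
  \<open>erfinv\<close> value at \<open>\<beta>\<close>, and \<open>mills_excess_antimono\<close>
  turns this into \<open>xi_plus \<alpha> \<beta> > 1\<close>. As \<open>xi_plus \<alpha>\<close>
  decreases in its second argument and is 1 at \<open>\<beta>w\<close>, the case
  \<open>\<beta>w \<le> \<beta>\<close> is impossible.\<close>

lemma less_betaw:
  assumes "0 < \<beta>" "\<beta> < \<alpha>" "\<alpha> < 1"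
    and \<alpha>w: "\<beta> < \<alpha>w" "\<alpha>w < (1 + \<beta>) / 2" "xi_plus \<alpha>w \<beta> = 1" "\<alpha>w < \<alpha>"
    and \<beta>w: "2 * \<alpha> - 1 < \<beta>w" "\<beta>w < \<alpha>" "xi_plus \<alpha> \<beta>w = 1"
  shows "\<beta> < \<beta>w"
proof (rule ccontr)
  assume "\<not> \<beta> < \<beta>w"
  hence le: "\<beta>w \<le> \<beta>" by simp
  define e e' ew where "e = erfinv (erfinv_arg \<alpha> \<beta>)" and "e' = erfinv (erfinv_arg \<alpha>w \<beta>)"
    and "ew = erfinv (erfinv_arg \<alpha> \<beta>w)"
  \<comment> \<open>The assumption \<open>\<beta>w \<le> \<beta>\<close> supplies
    \<open>2 * \<alpha> - 1 < \<beta>\<close>, which makes \<open>e\<close> positive.\<close>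
  have e: "0 < e" "erf e = erfinv_arg \<alpha> \<beta>" "erfc e = 2 * (\<alpha> - \<beta>) / (1 - \<beta>)"
    using erfinv_arg_props[of \<alpha> \<beta>] assms le by (auto simp: e_def)
  have e': "0 < e'" "erf e' = erfinv_arg \<alpha>w \<beta>" "erfc e' = 2 * (\<alpha>w - \<beta>) / (1 - \<beta>)"
    using erfinv_arg_props[of \<alpha>w \<beta>] assms by (auto simp: e'_def)
  have ew: "0 < ew" "erf ew = erfinv_arg \<alpha> \<beta>w"
    using erfinv_arg_props[of \<alpha> \<beta>w] assms by (auto simp: ew_def)
  have "erf e < erf e'" unfolding e e' using assms by (auto simp: divide_strict_right_mono)
  hence "e < e'" using erf_le_iff[of e' e] by linarith
  from mills_excess_antimono[OF e(1) this]
  have "exp (- (e'\<^sup>2)) / (sqrt pi * e') - 2 * (\<alpha>w - \<beta>) / (1 - \<beta>) < exp (- (e\<^sup>2)) / (sqrt pi * e) - 2 * (\<alpha> - \<beta>) / (1 - \<beta>)"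
    unfolding e(3) e'(3) .
  moreover have "exp (- (e'\<^sup>2)) / (sqrt pi * e') = 2 * \<alpha>w / (1 - \<beta>)"
  proof -
    have "exp (e'\<^sup>2) = 1 * (1 - \<beta>) / (2 * sqrt pi * \<alpha>w * e')"
      using \<alpha>w(3) e'(1) assms unfolding xi_plus_eq e'_def[symmetric] by (intro exp_square_eq) auto
    thus ?thesis using e'(1) assms by (simp add: exp_minus)
  qed
  ultimately have "2 * \<alpha> / (1 - \<beta>) < exp (- (e\<^sup>2)) / (sqrt pi * e)"
    by (simp add: diff_divide_distrib algebra_simps)
  also have "\<dots> \<le> exp (- (ew\<^sup>2)) / (sqrt pi * ew)"
  proof -
    have "erf ew \<le> erf e" unfolding e ew using assms le by (auto intro!: divide_left_mono)
    hence "ew \<le> e" by (simp add: erf_le_iff)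
    thus ?thesis using ew(1) by (intro frac_le) (auto intro!: power_mono)
  qed
  also have "\<dots> = 2 * \<alpha> / (1 - \<beta>w)"
  proof -
    have "exp (ew\<^sup>2) = 1 * (1 - \<beta>w) / (2 * sqrt pi * \<alpha> * ew)"
      using \<beta>w(3) ew(1) assms unfolding xi_plus_eq ew_def[symmetric] by (intro exp_square_eq) auto
    thus ?thesis using ew(1) assms by (simp add: exp_minus)
  qed
  finally show False using le assms by (simp add: field_simps)
qed

text \<open>The increasing function of \<open>erfc_ratio_mono\<close> takes the value
  \<open>(\<alpha> - \<beta>) / (sqrt pi * \<alpha>)\<close> at \<open>e0\<close> and
  \<open>(\<alpha> - \<beta>w) / (sqrt pi * \<alpha>)\<close> at \<open>ew\<close>, so
  \<open>\<beta> < \<beta>w\<close> decides the order.\<close>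

lemma erfinv_betaw_less_beta0:
  assumes "0 < \<beta>" "\<beta> < \<alpha>" "\<alpha> < 1" "\<beta> < \<beta>w"
    and \<beta>w: "2 * \<alpha> - 1 < \<beta>w" "\<beta>w < \<alpha>" "xi_plus \<alpha> \<beta>w = 1"
    and \<beta>0: "2 * \<alpha> - 1 < \<beta>0" "\<beta>0 < \<alpha>" "(\<alpha> - \<beta>) / (\<alpha> - \<beta>0) * xi_plus \<alpha> \<beta>0 = 1"
  shows "erfinv (erfinv_arg \<alpha> \<beta>w) < erfinv (erfinv_arg \<alpha> \<beta>0)"
proof (rule ccontr)
  define e0 ew where "e0 = erfinv (erfinv_arg \<alpha> \<beta>0)" and "ew = erfinv (erfinv_arg \<alpha> \<beta>w)"
  have e0: "0 < e0" "erfc e0 = 2 * (\<alpha> - \<beta>0) / (1 - \<beta>0)"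
    using erfinv_arg_props[of \<alpha> \<beta>0] assms by (auto simp: e0_def)
  have ew: "0 < ew" "erfc ew = 2 * (\<alpha> - \<beta>w) / (1 - \<beta>w)"
    using erfinv_arg_props[of \<alpha> \<beta>w] assms by (auto simp: ew_def)
  have pos: "1 - \<beta>w > 0" "1 - \<beta>0 > 0" "\<alpha> - \<beta>0 > 0" "\<alpha> > 0" using assms by auto
  have 1: "e0 * erfc e0 * exp (e0\<^sup>2) = (\<alpha> - \<beta>) / (sqrt pi * \<alpha>)"
  proof -
    have "exp (e0\<^sup>2) = (\<alpha> - \<beta>) / (\<alpha> - \<beta>0) * (1 - \<beta>0) / (2 * sqrt pi * \<alpha> * e0)"
      using \<beta>0(3) e0(1) assms unfolding xi_plus_eq e0_def[symmetric] by (intro exp_square_eq) auto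
    thus ?thesis unfolding e0(2) using e0(1) pos
      by (simp add: frac_eq_eq)
  qed
  have 2: "ew * erfc ew * exp (ew\<^sup>2) = (\<alpha> - \<beta>w) / (sqrt pi * \<alpha>)"
  proof -
    have "exp (ew\<^sup>2) = 1 * (1 - \<beta>w) / (2 * sqrt pi * \<alpha> * ew)"
      using \<beta>w(3) ew(1) assms unfolding xi_plus_eq ew_def[symmetric] by (intro exp_square_eq) auto
    thus ?thesis unfolding ew(2) using ew(1) pos by (simp add: frac_eq_eq)
  qed
  assume "\<not> erfinv (erfinv_arg \<alpha> \<beta>w) < erfinv (erfinv_arg \<alpha> \<beta>0)"
  hence "e0 \<le> ew" by (simp add: e0_def ew_def)
  from erfc_ratio_mono[OF this] show False
    unfolding 1 2 using assms by (simp add: divide_le_cancel)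
qed

section \<open>Evaluation of the objective function\<close>

lemma gamma_hat_eq:
  assumes "0 < a" "0 < \<alpha>"
  shows "gamma_hat \<alpha> ((1 - a\<^sup>2) * sqrt \<alpha> / a) = - a * sqrt \<alpha> / 2"
proof -
  \<comment> \<open>Writing \<open>c3\<close> in terms of \<open>a\<close> makes the radicand a
    square, by \<open>(1 - a^2)^2 + 4 * a^2 = (1 + a^2)^2\<close>.\<close>
  have "((1 - a\<^sup>2) * sqrt \<alpha> / a)\<^sup>2 + 4 * \<alpha> = ((1 + a\<^sup>2) * sqrt \<alpha> / a)\<^sup>2"
    using assms by (simp add: power_divide power_mult_distrib field_simps power2_eq_square)
  hence "sqrt (((1 - a\<^sup>2) * sqrt \<alpha> / a)\<^sup>2 + 4 * \<alpha>) = (1 + a\<^sup>2) * sqrt \<alpha> / a"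
    using assms by simp
  thus ?thesis unfolding gamma_hat_def using assms by (simp add: field_simps power2_eq_square)
qed

lemma I_sph_eq:
  assumes "0 < a" "0 < \<alpha>"
  shows "I_sph \<alpha> ((1 - a\<^sup>2) * sqrt \<alpha> / a) = \<alpha> * ln a - (1 - a\<^sup>2) * \<alpha> / 2"
proof -
  have "1 - (1 - a\<^sup>2) * sqrt \<alpha> / a / (2 * (- a * sqrt \<alpha> / 2)) = 1 / a\<^sup>2"
    using assms by (simp add: field_simps power2_eq_square)
  moreover have "ln (1 / a\<^sup>2) = - 2 * ln a" using assms by (simp add: ln_div ln_realpow)
  moreover have "- a * sqrt \<alpha> / 2 * ((1 - a\<^sup>2) * sqrt \<alpha> / a) = - ((1 - a\<^sup>2) * \<alpha> / 2)"
    using assms by (simp add: field_simps)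
  ultimately show ?thesis unfolding I_sph_def gamma_hat_eq[OF assms] by simp
qed

text \<open>The condition \<open>\<alpha> = r^2 + c * r\<close> says that \<open>b = r\<close> is
  stationary. The estimate \<open>ln u \<le> u - 1\<close> is enough for global maximality: it
  leaves the gap \<open>- (c / 2) * (b - r)^2 / (b + c)\<close>.\<close>

lemma spherical_exponent_le:
  fixes c r \<alpha> b :: real
  assumes "0 < c" "0 < r" "\<alpha> = r\<^sup>2 + c * r" "0 < b"
  shows "- c * b / 2 - \<alpha> / 2 * ln (1 + c / b) \<le> - c * r / 2 - \<alpha> / 2 * ln (1 + c / r)"
proof -
  have \<alpha>: "0 < \<alpha>" using assms by (simp add: add_pos_pos)
  have p: "0 < 1 + c / b" "0 < 1 + c / r" using assms by (auto simp: add_pos_pos)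
  have "ln ((1 + c / r) / (1 + c / b)) \<le> (1 + c / r) / (1 + c / b) - 1"
    using p by (intro ln_le_minus_one) auto
  hence "ln (1 + c / r) - ln (1 + c / b) \<le> (1 + c / r) / (1 + c / b) - 1"
    using p by (simp add: ln_div)
  also have "\<dots> = c * (b - r) / (r * (b + c))"
  proof -
    have "1 + c / r = (r + c) / r" "1 + c / b = (b + c) / b" "b + c \<noteq> 0"
      using assms by (auto simp: field_simps)
    thus ?thesis using assms(2,4) by (simp add: divide_simps) (simp add: algebra_simps)
  qed
  finally have "\<alpha> / 2 * (ln (1 + c / r) - ln (1 + c / b)) \<le> \<alpha> / 2 * (c * (b - r) / (r * (b + c)))"
    using \<alpha> by (intro mult_left_mono) auto
  moreover have "\<alpha> / 2 * (c * (b - r) / (r * (b + c))) + c * (r - b) / 2 = - (c / 2) * (b - r)\<^sup>2 / (b + c)"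
  proof -
    have nz: "b + c \<noteq> 0" "r \<noteq> 0" using assms by auto
    have "\<alpha> = r * (r + c)" unfolding assms(3) by (simp add: power2_eq_square algebra_simps)
    hence e: "\<alpha> / 2 * (c * (b - r) / (r * (b + c))) = (r + c) * (c * (b - r)) / (2 * (b + c))"
      using nz by simp
    show ?thesis unfolding e using nz(1)
      by (simp add: divide_simps) (simp add: algebra_simps power2_eq_square)
  qed
  moreover have "- (c / 2) * (b - r)\<^sup>2 / (b + c) \<le> 0"
    using assms by (auto simp: divide_le_0_iff)
  moreover have "c * (r - b) / 2 = c * r / 2 - c * b / 2" "- c * b / 2 = - (c * b / 2)" "- c * r / 2 = - (c * r / 2)"
    by (auto simp: right_diff_distrib diff_divide_distrib)
  ultimately show ?thesis unfolding right_diff_distrib[of "\<alpha> / 2"] by linarith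
qed

lemma I_sph_upper:
  assumes a: "0 < a" "a < 1" and "0 < \<alpha>" "0 < b"
  defines "c3 \<equiv> (1 - a\<^sup>2) * sqrt \<alpha> / a"
  shows "- c3 * b / 2 - \<alpha> / 2 * ln (1 + c3 / b) \<le> I_sph \<alpha> c3"
proof -
  \<comment> \<open>This is \<open>- 2 * gamma_hat \<alpha> c3\<close>, the radius per
    \<open>sqrt n\<close> that dominates the moment of the norm of \<open>g\<close>.\<close>
  define r where "r = a * sqrt \<alpha>"
  have a2: "a\<^sup>2 < 1" using a by (simp add: power_less_one_iff)
  have c: "0 < c3" "0 < r" using a a2 assms(3) by (auto simp: c3_def r_def)
  have cr: "c3 * r = (1 - a\<^sup>2) * \<alpha>" using a assms(3) by (simp add: c3_def r_def)
  have "\<alpha> = r\<^sup>2 + c3 * r" unfolding cr using assms(3) by (simp add: r_def power_mult_distrib algebra_simps)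
  hence "- c3 * b / 2 - \<alpha> / 2 * ln (1 + c3 / b) \<le> - c3 * r / 2 - \<alpha> / 2 * ln (1 + c3 / r)"
    by (intro spherical_exponent_le c assms(4))
  also have "1 + c3 / r = 1 / a\<^sup>2"
    using a assms(3) by (simp add: c3_def r_def field_simps power2_eq_square)
  also have "ln (1 / a\<^sup>2) = - 2 * ln a" using a by (simp add: ln_div ln_realpow)
  also have "- c3 * r / 2 - \<alpha> / 2 * (- 2 * ln a) = I_sph \<alpha> c3"
  proof -
    have "I_sph \<alpha> c3 = \<alpha> * ln a - (1 - a\<^sup>2) * \<alpha> / 2"
      unfolding c3_def by (rule I_sph_eq[OF a(1) assms(3)])
    thus ?thesis unfolding cr[symmetric] by simp
  qed
  finally show ?thesis .
qed

text \<open>The choice of \<open>\<gamma>\<close> gives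
  \<open>1 - c3 / (2 * \<gamma>) = a^2\<close>. Then the exponent in \<open>w2\<close> is
  \<open>e0^2 - ew^2\<close> and the argument of \<open>erfc\<close> in \<open>w1_plus\<close> is
  \<open>e0\<close>, so the equations for \<open>\<beta>w\<close> and \<open>\<beta>0\<close>
  eliminate all exponentials and error functions; the other terms collapse to
  \<open>\<alpha> * ln a\<close>.\<close>

lemma F_plus_optimal:
  assumes "0 < \<beta>" "\<beta> < \<alpha>" "\<alpha> < 1"
    and \<beta>w: "2 * \<alpha> - 1 < \<beta>w" "\<beta>w < \<alpha>" "xi_plus \<alpha> \<beta>w = 1"
    and \<beta>0: "2 * \<alpha> - 1 < \<beta>0" "\<beta>0 < \<alpha>" "(\<alpha> - \<beta>) / (\<alpha> - \<beta>0) * xi_plus \<alpha> \<beta>0 = 1"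
  defines "e0 \<equiv> erfinv (erfinv_arg \<alpha> \<beta>0)" and "ew \<equiv> erfinv (erfinv_arg \<alpha> \<beta>w)"
  assumes less: "ew < e0"
  defines "c3 \<equiv> (1 - (ew / e0)\<^sup>2) * sqrt \<alpha> / (ew / e0)" and "\<gamma> \<equiv> sqrt \<alpha> / (2 * (ew / e0))"
  shows "w2 c3 (sqrt 2 * ew) \<gamma> = ((\<alpha> - \<beta>) * (1 - \<beta>0)) / ((\<alpha> - \<beta>0) * (1 - \<beta>w))"
    "w1_plus c3 (sqrt 2 * ew) \<gamma> = (1 - \<beta>) / (1 - \<beta>w)"
    "F_plus \<alpha> \<beta> c3 (sqrt 2 * ew) \<gamma> = I_ldp_plus \<alpha> \<beta> \<beta>w \<beta>0"
proof -
  define a where "a = ew / e0"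
  have e0: "0 < e0" "erfc e0 = 2 * (\<alpha> - \<beta>0) / (1 - \<beta>0)"
    using erfinv_arg_props[of \<alpha> \<beta>0] assms by (auto simp: e0_def)
  have ew: "0 < ew" "erf ew = erfinv_arg \<alpha> \<beta>w"
    using erfinv_arg_props[of \<alpha> \<beta>w] assms by (auto simp: ew_def)
  have \<alpha>: "0 < \<alpha>" "0 < 1 - \<beta>w" "0 < 1 - \<beta>0" "0 < \<alpha> - \<beta>0" "0 < \<alpha> - \<beta>" using assms by auto
  have a: "0 < a" "a < 1" using ew(1) e0(1) less by (auto simp: a_def)
  have d: "1 - c3 / (2 * \<gamma>) = a\<^sup>2"
    using a \<alpha> by (simp add: c3_def \<gamma>_def a_def[symmetric] field_simps power2_eq_square)
  have "c3 * (sqrt 2 * ew)\<^sup>2 / (4 * \<gamma>) / a\<^sup>2 = (1 - a\<^sup>2) * ew\<^sup>2 / a\<^sup>2"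
    using a \<alpha> by (simp add: c3_def \<gamma>_def a_def[symmetric] power_mult_distrib field_simps)
  also have "\<dots> = e0\<^sup>2 - ew\<^sup>2"
    using ew(1) e0(1) by (simp add: a_def power_divide field_simps)
  finally have ex: "c3 * (sqrt 2 * ew)\<^sup>2 / (4 * \<gamma>) / a\<^sup>2 = e0\<^sup>2 - ew\<^sup>2" .
  have 1: "exp (ew\<^sup>2) = 1 * (1 - \<beta>w) / (2 * sqrt pi * \<alpha> * ew)"
    using \<beta>w(3) ew(1) \<alpha> unfolding xi_plus_eq ew_def[symmetric] by (intro exp_square_eq) auto
  have 2: "exp (e0\<^sup>2) = (\<alpha> - \<beta>) / (\<alpha> - \<beta>0) * (1 - \<beta>0) / (2 * sqrt pi * \<alpha> * e0)"
    using \<beta>0(3) e0(1) \<alpha> unfolding xi_plus_eq e0_def[symmetric] by (intro exp_square_eq) auto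
  have sa: "sqrt (a\<^sup>2) = a" using a by simp
  have w2': "exp (c3 * (sqrt 2 * ew)\<^sup>2 / (4 * \<gamma>) / a\<^sup>2) / sqrt (a\<^sup>2) = ((\<alpha> - \<beta>) * (1 - \<beta>0)) / ((\<alpha> - \<beta>0) * (1 - \<beta>w))"
    unfolding ex exp_diff 1 2 sa unfolding a_def using \<alpha> ew(1) e0(1) by simp
  thus w2: "w2 c3 (sqrt 2 * ew) \<gamma> = ((\<alpha> - \<beta>) * (1 - \<beta>0)) / ((\<alpha> - \<beta>0) * (1 - \<beta>w))"
    unfolding w2_def d .
  have "sqrt 2 * ew / (sqrt 2 * sqrt (a\<^sup>2)) = e0" "sqrt 2 * ew / sqrt 2 = ew"
    using a ew(1) e0(1) by (auto simp: a_def)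
  moreover have "((\<alpha> - \<beta>) * (1 - \<beta>0)) / ((\<alpha> - \<beta>0) * (1 - \<beta>w)) * erfc e0 = 2 * (\<alpha> - \<beta>) / (1 - \<beta>w)"
    unfolding e0(2) using \<alpha> by (simp add: frac_eq_eq) (simp add: algebra_simps)
  moreover have "erf ew + 1 = 2 * (1 - \<alpha>) / (1 - \<beta>w)" unfolding ew(2) by simp
  moreover have "1 / 2 * (2 * (\<alpha> - \<beta>) / (1 - \<beta>w) + 2 * (1 - \<alpha>) / (1 - \<beta>w)) = (1 - \<beta>) / (1 - \<beta>w)"
    using \<alpha> by (simp add: add_divide_distrib[symmetric]) (simp add: field_simps)
  ultimately show w1: "w1_plus c3 (sqrt 2 * ew) \<gamma> = (1 - \<beta>) / (1 - \<beta>w)"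
    unfolding w1_plus_def d w2' by (simp only: add.assoc)
  have s: "- (c3\<^sup>2) / 2 + I_sph \<alpha> c3 + c3 * \<gamma> = \<alpha> * ln a"
  proof -
    have "c3\<^sup>2 = (1 - a\<^sup>2)\<^sup>2 * \<alpha> / a\<^sup>2"
      using \<alpha> by (simp add: c3_def a_def[symmetric] power_divide power_mult_distrib)
    moreover have "c3 * \<gamma> = (1 - a\<^sup>2) * \<alpha> / (2 * a\<^sup>2)"
    proof -
      have "c3 * \<gamma> = (1 - a\<^sup>2) * (sqrt \<alpha> * sqrt \<alpha>) / (2 * a\<^sup>2)"
        by (simp add: c3_def \<gamma>_def a_def[symmetric] power2_eq_square del: real_sqrt_mult_self)
      thus ?thesis using \<alpha> by simp
    qed
    moreover have "- ((1 - a\<^sup>2)\<^sup>2 * \<alpha> / a\<^sup>2) / 2 - (1 - a\<^sup>2) * \<alpha> / 2 + (1 - a\<^sup>2) * \<alpha> / (2 * a\<^sup>2) = 0"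
      using a by (simp add: field_simps power2_eq_square)
    moreover have "I_sph \<alpha> c3 = \<alpha> * ln a - (1 - a\<^sup>2) * \<alpha> / 2"
      unfolding c3_def a_def[symmetric] by (rule I_sph_eq[OF a(1) \<alpha>(1)])
    moreover have "- u / 2 + I + v = L" if "u = X" "v = Z" "- X / 2 - Y + Z = 0" "I = L - Y"
      for u v I L X Y Z :: real using that by linarith
    ultimately show ?thesis by blast
  qed
  show "F_plus \<alpha> \<beta> c3 (sqrt 2 * ew) \<gamma> = I_ldp_plus \<alpha> \<beta> \<beta>w \<beta>0"
    unfolding F_plus_def I_ldp_plus_def w1 w2 e0_def[symmetric] ew_def[symmetric] a_def[symmetric]
    using s by simp
qed

section \<open>The large deviation bound\<close>

text \<open>After division by \<open>n\<close> the terms with \<open>K\<close> and \<open>L\<close>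
  vanish; both may depend on \<open>\<delta>\<close>, which stays fixed while \<open>n\<close>
  grows.\<close>

lemma limsup_log_prob_le:
  fixes p :: "nat \<Rightarrow> real" and n :: "nat \<Rightarrow> nat" and I :: real
  assumes n: "filterlim n at_top sequentially"
    and p: "\<And>\<delta>. 0 < \<delta> \<Longrightarrow> \<exists>K L. \<forall>\<^sub>F i in sequentially.
      p i \<le> exp (K + L * sqrt (n i) + n i * (I + \<delta>))"
    and p0: "\<And>i. 0 \<le> p i"
  shows "limsup (\<lambda>i. log_prob (p i) / ereal (real (n i))) \<le> ereal I"
proof (rule ereal_le_epsilon2)
  fix e :: real assume "0 < e"
  then obtain K L where KL: "\<forall>\<^sub>F i in sequentially. p i \<le> exp (K + L * sqrt (n i) + n i * (I + e / 2))"
    using p[of "e / 2"] by auto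
  have "((\<lambda>x. K / x + L / sqrt x) \<longlongrightarrow> 0) at_top" by real_asymp
  moreover have "filterlim (\<lambda>i. real (n i)) at_top sequentially"
    by (rule filterlim_compose[OF filterlim_real_sequentially n])
  ultimately have "((\<lambda>i. K / real (n i) + L / sqrt (real (n i))) \<longlongrightarrow> 0) sequentially"
    by (rule filterlim_compose)
  hence "\<forall>\<^sub>F i in sequentially. K / real (n i) + L / sqrt (real (n i)) < e / 2"
    by (rule order_tendstoD) (use \<open>0 < e\<close> in simp)
  moreover have "\<forall>\<^sub>F i in sequentially. 0 < n i"
    by (rule eventually_compose_filterlim[OF eventually_gt_at_top n])
  ultimately have "\<forall>\<^sub>F i in sequentially. log_prob (p i) / ereal (real (n i)) \<le> ereal I + ereal e"
    using KL
  proof eventually_elim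
    case (elim i)
    show ?case
    proof (cases "p i = 0")
      \<comment> \<open>\<open>log_prob 0\<close> is \<open>-\<infinity>\<close> and remains so
        after division by the positive \<open>n i\<close>.\<close>
      case True
      thus ?thesis using elim by (simp add: log_prob_def)
    next
      case False
      hence pos: "0 < p i" using p0[of i] by simp
      have "ln (p i) \<le> ln (exp (K + L * sqrt (n i) + n i * (I + e / 2)))"
        using elim pos by (subst ln_le_cancel_iff) auto
      hence "ln (p i) / n i \<le> (K + L * sqrt (n i) + n i * (I + e / 2)) / n i"
        by (intro divide_right_mono) auto
      also have "\<dots> = (K / real (n i) + L / sqrt (real (n i))) + (I + e / 2)"
      proof -
        have "sqrt (n i) / n i = 1 / sqrt (n i)"
          using elim by (simp add: divide_eq_eq real_div_sqrt)
        hence "L / sqrt (n i) = L * sqrt (n i) / n i" by (metis mult.right_neutral times_divide_eq_right)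
        thus ?thesis using elim by (simp add: add_divide_distrib)
      qed
      also have "\<dots> \<le> I + e" using elim(1) by linarith
      finally show ?thesis using False elim by (simp add: log_prob_def)
    qed
  qed
  thus "limsup (\<lambda>i. log_prob (p i) / ereal (real (n i))) \<le> ereal I + ereal e"
    by (rule Limsup_bounded)
qed

text \<open>The bound on kernel events is the same for every net and so passes to the failure
  probability; \<open>k = \<beta> * n\<close> turns the powers of \<open>w2\<close> and
  \<open>w1_plus\<close> into the logarithmic terms of \<open>F_plus\<close>.\<close>

lemma P_err_plus_le_exp_F_plus:
  fixes c3 \<gamma> \<nu> \<delta> \<alpha> \<beta> :: real
  assumes G: "std_gaussian_matrix M m n A" and n: "0 < n"
    and x: "x \<in> carrier_vec n" "sparse_vec k x" "0\<^sub>v n \<le> x"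
    and km: "real k = \<beta> * real n" "real m = \<alpha> * real n" "0 < \<alpha>"
    and par: "0 < c3" "c3 / 2 < \<gamma>" "0 \<le> \<nu>" "0 < \<delta>"
    and w: "0 < w1_plus c3 \<nu> \<gamma>" "0 < w2 c3 \<nu> \<gamma>"
    and sph: "\<And>b. 0 < b \<Longrightarrow> - c3 * b / 2 - \<alpha> / 2 * ln (1 + c3 / b) \<le> I_sph \<alpha> c3"
      "- (c3 * (real J * \<delta>)) \<le> I_sph \<alpha> c3"
  shows "P_err_plus M A x \<le>
    exp (ln (2 * sqrt (2 * pi) * (real J + 1)) + 9 / 2 + 4 * c3 * sqrt n + n * (F_plus \<alpha> \<beta> c3 \<nu> \<gamma> + c3 * \<delta>))"
proof -
  define S where "S = {j. j < n \<and> vec_index x j \<noteq> 0}"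
  have S: "S \<subseteq> {..<n}" "card S = k" using x by (auto simp: S_def sparse_vec_def)
  have kn: "k \<le> n" using S card_mono[of "{..<n}" S] by simp
  have m: "0 < m"
  proof -
    have "0 < real m" using km n by simp
    thus ?thesis by simp
  qed
  let ?w = "w2 c3 \<nu> \<gamma> ^ k * w1_plus c3 \<nu> \<gamma> ^ (n - k)"
  have W: "?w = exp (n * (\<beta> * ln (w2 c3 \<nu> \<gamma>) + (1 - \<beta>) * ln (w1_plus c3 \<nu> \<gamma>)))"
  proof -
    have "n * (\<beta> * ln (w2 c3 \<nu> \<gamma>) + (1 - \<beta>) * ln (w1_plus c3 \<nu> \<gamma>)) =
        real k * ln (w2 c3 \<nu> \<gamma>) + real (n - k) * ln (w1_plus c3 \<nu> \<gamma>)"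
      using kn by (simp add: km(1) of_nat_diff algebra_simps)
    thus ?thesis using w by (simp add: exp_add exp_of_nat_mult)
  qed
  have "P_err_plus M A x \<le> 2 * sqrt (2 * pi) * (real J + 1) * exp (9 / 2 + 4 * c3 * sqrt n) *
       exp (n * (- c3\<^sup>2 / 2 + I_sph \<alpha> c3 + c3 * \<delta> + c3 * \<gamma>)) * ?w"
  proof (rule P_err_plus_le[OF G m n x(1,3)])
    fix W assume fin: "finite W" and sub: "W \<subseteq> descent_cone n {j. j < n \<and> vec_index x j \<noteq> 0}"
    show "measure (PiM ({..<m} \<times> {..<n}) (\<lambda>_. gauss)) {\<xi> \<in> space (PiM ({..<m} \<times> {..<n}) (\<lambda>_. gauss)). kernel_event m n W \<xi>}
        \<le> 2 * sqrt (2 * pi) * (real J + 1) * exp (9 / 2 + 4 * c3 * sqrt n) *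
       exp (n * (- c3\<^sup>2 / 2 + I_sph \<alpha> c3 + c3 * \<delta> + c3 * \<gamma>)) * ?w"
    proof -
      have cone: "(\<Sum>j<n. (w j)\<^sup>2) = 1" "(\<Sum>j<n. w j) \<le> 0" "\<And>j. j < n \<Longrightarrow> j \<notin> S \<Longrightarrow> 0 \<le> w j"
        if "w \<in> W" for w
        using sub that by (auto simp: descent_cone_def S_def)
      show ?thesis
        unfolding S(2)[symmetric] by (rule prob_kernel_event_le[where \<alpha> = \<alpha>],
          fact fin, fact cone(1), fact cone(2), fact cone(3), fact par(1), fact par(2), fact par(3),
          fact par(4), fact n, fact S(1), fact km(2), fact sph(1), fact sph(2))
    qed
  qed
  also have "\<dots> = exp (ln (2 * sqrt (2 * pi) * (real J + 1)) + 9 / 2 + 4 * c3 * sqrt n +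
       n * (F_plus \<alpha> \<beta> c3 \<nu> \<gamma> + c3 * \<delta>))"
  proof -
    have eq: "ln (2 * sqrt (2 * pi) * (real J + 1)) + 9 / 2 + 4 * c3 * sqrt n + n * (F_plus \<alpha> \<beta> c3 \<nu> \<gamma> + c3 * \<delta>) =
        ln (2 * sqrt (2 * pi) * (real J + 1)) + (9 / 2 + 4 * c3 * sqrt n) +
        n * (- c3\<^sup>2 / 2 + I_sph \<alpha> c3 + c3 * \<delta> + c3 * \<gamma>) +
        n * (\<beta> * ln (w2 c3 \<nu> \<gamma>) + (1 - \<beta>) * ln (w1_plus c3 \<nu> \<gamma>))"
      by (simp add: F_plus_def algebra_simps)
    have "exp (ln (2 * sqrt (2 * pi) * (real J + 1))) = 2 * sqrt (2 * pi) * (real J + 1)"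
      by (intro exp_ln mult_pos_pos) auto
    thus ?thesis unfolding W eq exp_add by metis
  qed
  finally show ?thesis .
qed

text \<open>With a limsup the existence of the limit is not presupposed.\<close>

theorem theorem13:
  fixes \<alpha> \<beta> \<alpha>w \<beta>w \<beta>0 :: real
    and n k m :: "nat \<Rightarrow> nat"
    and M :: "nat \<Rightarrow> 'w measure"
    and A :: "nat \<Rightarrow> 'w \<Rightarrow> real Matrix.mat"
    and x :: "nat \<Rightarrow> real Matrix.vec"
  assumes "0 < \<beta>" and "\<beta> < \<alpha>" and "\<alpha> < 1"
    and "filterlim n at_top sequentially"
    and "\<And>i. real (k i) = \<beta> * real (n i)"
    and "\<And>i. real (m i) = \<alpha> * real (n i)"
    and "\<And>i. std_gaussian_matrix (M i) (m i) (n i) (A i)"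
    and "\<And>i. x i \<in> carrier_vec (n i)"
    and "\<And>i. sparse_vec (k i) (x i)"
    and "\<And>i. 0\<^sub>v (n i) \<le> x i"
    and "\<alpha>w \<in> {\<beta><..<(1 + \<beta>) / 2}" and "xi_plus \<alpha>w \<beta> = 1" and "\<alpha>w < \<alpha>"
    and "\<beta>w \<in> {max (2 * \<alpha> - 1) 0<..<\<alpha>}" and "xi_plus \<alpha> \<beta>w = 1"
    and "\<beta>0 \<in> {2 * \<alpha> - 1<..<\<alpha>}" and "(\<alpha> - \<beta>) / (\<alpha> - \<beta>0) * xi_plus \<alpha> \<beta>0 = 1"
  shows "limsup (\<lambda>i. log_prob (P_err_plus (M i) (A i) (x i)) / ereal (real (n i)))
           \<le> ereal (I_ldp_plus \<alpha> \<beta> \<beta>w \<beta>0)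
       \<and> (let \<nu> = sqrt 2 * erfinv (erfinv_arg \<alpha> \<beta>w);
              A0 = erfinv (erfinv_arg \<alpha> \<beta>w) / erfinv (erfinv_arg \<alpha> \<beta>0);
              c3 = (1 - A0\<^sup>2) * sqrt \<alpha> / A0;
              \<gamma> = c3 / (2 * (1 - A0\<^sup>2))
          in 0 \<le> c3 \<and> 0 \<le> \<nu> \<and> c3 / 2 < \<gamma> \<and> \<gamma> = sqrt \<alpha> / (2 * A0)
             \<and> F_plus \<alpha> \<beta> c3 \<nu> \<gamma> = I_ldp_plus \<alpha> \<beta> \<beta>w \<beta>0)"
proof -
  note \<beta>\<alpha> = assms(1-3)
  have \<beta>w: "2 * \<alpha> - 1 < \<beta>w" "\<beta>w < \<alpha>" "xi_plus \<alpha> \<beta>w = 1" using assms(14,15) by auto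
  have \<beta>0: "2 * \<alpha> - 1 < \<beta>0" "\<beta>0 < \<alpha>" "(\<alpha> - \<beta>) / (\<alpha> - \<beta>0) * xi_plus \<alpha> \<beta>0 = 1"
    using assms(16,17) by auto
  define ew e0 where "ew = erfinv (erfinv_arg \<alpha> \<beta>w)" and "e0 = erfinv (erfinv_arg \<alpha> \<beta>0)"
  define \<nu> a where "\<nu> = sqrt 2 * ew" and "a = ew / e0"
  define c3 where "c3 = (1 - a\<^sup>2) * sqrt \<alpha> / a"
  define \<gamma> where "\<gamma> = sqrt \<alpha> / (2 * a)"
  \<comment> \<open>Here \<open>\<alpha>w < \<alpha>\<close> enters; it leads to
    \<open>a < 1\<close> and thus to \<open>c3 > 0\<close>.\<close>
  have "\<beta> < \<beta>w"
    by (rule less_betaw[of \<beta> \<alpha> \<alpha>w]) (use assms in auto)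
  hence less: "ew < e0"
    unfolding ew_def e0_def by (rule erfinv_betaw_less_beta0[OF \<beta>\<alpha> _ \<beta>w \<beta>0])
  have ew: "0 < ew" unfolding ew_def using erfinv_arg_props(1)[OF _ \<beta>w(1,2)] \<beta>\<alpha> by simp
  have \<alpha>: "0 < \<alpha>" using \<beta>\<alpha> by simp
  have a: "0 < a" "a < 1" using ew less by (auto simp: a_def)
  have a2: "a\<^sup>2 < 1" using a by (simp add: power_less_one_iff)
  have c3: "0 < c3" using a a2 \<alpha> by (simp add: c3_def)
  have \<gamma>: "\<gamma> = c3 / (2 * (1 - a\<^sup>2))"
    using a2 by (simp add: \<gamma>_def c3_def del: right_diff_distrib_numeral)
  have "c3 / 2 = \<gamma> * (1 - a\<^sup>2)"
    unfolding \<gamma> using a2 by (simp del: right_diff_distrib_numeral)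
  also have "\<dots> < \<gamma> * 1"
    using a \<alpha> by (intro mult_strict_left_mono) (auto simp: \<gamma>_def)
  finally have c3\<gamma>: "c3 / 2 < \<gamma>" by simp
  have \<nu>: "0 \<le> \<nu>" using ew by (simp add: \<nu>_def)
  note opt = F_plus_optimal[OF \<beta>\<alpha> \<beta>w \<beta>0, folded ew_def e0_def, OF less, folded a_def,
      folded c3_def \<gamma>_def \<nu>_def]
  have w: "0 < w1_plus c3 \<nu> \<gamma>" "0 < w2 c3 \<nu> \<gamma>"
    unfolding opt(1,2) using \<beta>w(2) \<beta>0(2) \<beta>\<alpha> by auto
  have "limsup (\<lambda>i. log_prob (P_err_plus (M i) (A i) (x i)) / ereal (real (n i)))
      \<le> ereal (I_ldp_plus \<alpha> \<beta> \<beta>w \<beta>0)"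
  proof (rule limsup_log_prob_le[OF assms(4)])
    fix d :: real assume d: "0 < d"
    \<comment> \<open>Radial cells of this width cost exactly \<open>d\<close> in the
      exponent.\<close>
    define \<delta> where "\<delta> = d / c3"
    have \<delta>: "0 < \<delta>" "c3 * \<delta> = d" using d c3 by (auto simp: \<delta>_def)
    \<comment> \<open>Enough cells for the tail beyond them to fall below \<open>I_sph\<close>.
      \<open>J\<close> does not depend on \<open>n\<close>, so it enters only the constant
      \<open>K\<close>.\<close>
    obtain J :: nat where "- I_sph \<alpha> c3 / d < real J" using reals_Archimedean2 by blast
    hence J: "- (c3 * (real J * \<delta>)) \<le> I_sph \<alpha> c3"
      using d \<delta> c3 by (simp add: \<delta>_def field_simps)
    define K where "K = ln (2 * sqrt (2 * pi) * (real J + 1)) + 9 / 2"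
    have "P_err_plus (M i) (A i) (x i) \<le>
        exp (K + 4 * c3 * sqrt (n i) + n i * (I_ldp_plus \<alpha> \<beta> \<beta>w \<beta>0 + d))" if n: "0 < n i" for i
      using P_err_plus_le_exp_F_plus[OF assms(7) n assms(8,9,10,5,6) \<alpha> c3 c3\<gamma> \<nu> \<delta>(1) w
          I_sph_upper[OF a \<alpha>, folded c3_def] J]
      unfolding opt(3) \<delta>(2) K_def by simp
    moreover have "\<forall>\<^sub>F i in sequentially. 0 < n i"
      by (rule eventually_compose_filterlim[OF eventually_gt_at_top assms(4)])
    ultimately have "\<forall>\<^sub>F i in sequentially. P_err_plus (M i) (A i) (x i) \<le>
        exp (K + 4 * c3 * sqrt (n i) + n i * (I_ldp_plus \<alpha> \<beta> \<beta>w \<beta>0 + d))"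
      by (rule eventually_mono[rotated])
    thus "\<exists>K L. \<forall>\<^sub>F i in sequentially. P_err_plus (M i) (A i) (x i) \<le>
        exp (K + L * sqrt (n i) + n i * (I_ldp_plus \<alpha> \<beta> \<beta>w \<beta>0 + d))" by blast
  qed (simp add: P_err_plus_def)
  thus ?thesis
    unfolding Let_def ew_def[symmetric] e0_def[symmetric] a_def[symmetric] c3_def[symmetric]
      \<nu>_def[symmetric] \<gamma>[symmetric]
    by (intro conjI less_imp_le[OF c3] \<nu> c3\<gamma> \<gamma>_def opt(3))
qed

end
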